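(* Let $\mathcal{U}$ be a Hilbert space. A holomorphic $L(\mathcal{U})$-valued function $\mathcal{F}$ on $\mathbb{D}^N$ can be represented as $\mathcal{F}=\mathcal{C}(f)$ for some $f\in\mathcal{B}_N(\mathcal{U})$ if and only if the following conditions are fulfilled: (i) $\mathcal{F}=\mathcal{F}_\alpha$ for an Agler unitary colligation $\alpha=(N;U;\mathcal{X}=\bigoplus_{k=1}^N\mathcal{X}_k,\mathcal{U},\mathcal{U})$ with the additional condition $U=U^*$; (ii) $1\notin\sigma(\mathcal{F}(0))$.
   Context: All Hilbert spaces are complex; $L(\mathcal{U})$ denotes the bounded linear operators on $\mathcal{U}$; $\sigma(\cdot)$ is the spectrum. $\Pi=\{z\in\mathbb{C}:\mathrm{Re}\,z>0\}$, $\mathbb{T}$ is the unit circle, $\mathbb{D}^N=\{w\in\mathbb{C}^N:|w_k|<1\}$, $\Omega_N=\bigcup_{\lambda\in\mathbb{T}}(\lambda\Pi)^N\subset\mathbb{C}^N$. The class $\mathcal{B}_N(\mathcal{U})$ consists of the $L(\mathcal{U})$-valued functions $f$ holomorphic on $\Omega_N$ and representable as $f(z)=a(z)-b(z)d(z)^{-1}c(z)$, $z\in\Omega_N$, where, for some Hilbert space $\mathcal{H}$, $A(z)=z_1A_1+\cdots+z_NA_N=\begin{bmatrix} a(z)&b(z)\\ c(z)&d(z)\end{bmatrix}\in L(\mathcal{U}\oplus\mathcal{H})$ with bounded positive semidefinite operators $A_k=A_k^*$ on $\mathcal{U}\oplus\mathcal{H}$ (and $d(z)$ boundedly invertible for $z\in\Omega_N$).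 For $f\in\mathcal{B}_N(\mathcal{U})$ the double Cayley transform $\mathcal{C}(f)$ is the function on $\mathbb{D}^N$ given by $\mathcal{C}(f)(w)=(F(w)-I_{\mathcal{U}})(F(w)+I_{\mathcal{U}})^{-1}$, where $F(w)=f\big(\tfrac{1+w_1}{1-w_1},\ldots,\tfrac{1+w_N}{1-w_N}\big)$. An Agler unitary colligation $\alpha=(N;U;\mathcal{X}=\bigoplus_{k=1}^N\mathcal{X}_k,\mathcal{U},\mathcal{U})$ consists of Hilbert spaces $\mathcal{X}_1,\ldots,\mathcal{X}_N$, their orthogonal sum $\mathcal{X}$, and a unitary operator $U=\begin{bmatrix}A&B\\ C&D\end{bmatrix}\in L(\mathcal{X}\oplus\mathcal{U})$. Its transfer function is $\mathcal{F}_\alpha(w)=D+CP(w)(I_{\mathcal{X}}-AP(w))^{-1}B$, $w\in\mathbb{D}^N$, where $P(w)=\sum_{k=1}^N w_kP_{\mathcal{X}_k}$ and $P_{\mathcal{X}_k}$ is the orthogonal projector of $\mathcal{X}$ onto $\mathcal{X}_k$. *)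

theory Defs
  imports "HOL-Analysis.Analysis"
begin

section \<open>Complex Hilbert spaces\<close>

text \<open>
  A complex Hilbert space is a (real) inner product space of the library, complete in its norm,
  together with a multiplication by complex scalars and a complex inner product, linear in the
  first argument, whose real part is the real inner product. The norm is therefore
  the square root of \<open>cinner x x\<close>.
\<close>

class complex_inner = real_inner +
  fixes scaleC :: "complex \<Rightarrow> 'a \<Rightarrow> 'a" (infixr "*\<^sub>C" 75)
    and cinner :: "'a \<Rightarrow> 'a \<Rightarrow> complex"
  assumes scaleC_add_right: "c *\<^sub>C (x + y) = c *\<^sub>C x + c *\<^sub>C y"
    and scaleC_add_left: "(c + d) *\<^sub>C x = c *\<^sub>C x + d *\<^sub>C x"
    and scaleC_scaleC: "c *\<^sub>C (d *\<^sub>C x) = (c * d) *\<^sub>C x"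
    and scaleC_of_real: "complex_of_real r *\<^sub>C x = r *\<^sub>R x"
    and cinner_commute: "cinner x y = cnj (cinner y x)"
    and cinner_add_left: "cinner (x + y) z = cinner x z + cinner y z"
    and cinner_scaleC_left: "cinner (c *\<^sub>C x) y = c * cinner x y"
    and Re_cinner: "Re (cinner x y) = inner x y"

class complex_hilbert_space = complex_inner + complete_space

instantiation prod :: (complex_inner, complex_inner) complex_inner
begin

definition scaleC_prod :: "complex \<Rightarrow> 'a \<times> 'b \<Rightarrow> 'a \<times> 'b"
  where "scaleC_prod c x = (c *\<^sub>C fst x, c *\<^sub>C snd x)"

definition cinner_prod :: "'a \<times> 'b \<Rightarrow> 'a \<times> 'b \<Rightarrow> complex"
  where "cinner_prod x y = cinner (fst x) (fst y) + cinner (snd x) (snd y)"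

instance
proof
  fix c d :: complex and r :: real and x y z :: "'a \<times> 'b"
  show "c *\<^sub>C (x + y) = c *\<^sub>C x + c *\<^sub>C y"
    by (simp add: scaleC_prod_def scaleC_add_right)
  show "(c + d) *\<^sub>C x = c *\<^sub>C x + d *\<^sub>C x"
    by (simp add: scaleC_prod_def scaleC_add_left)
  show "c *\<^sub>C (d *\<^sub>C x) = (c * d) *\<^sub>C x"
    by (simp add: scaleC_prod_def scaleC_scaleC)
  show "complex_of_real r *\<^sub>C x = r *\<^sub>R x"
    by (simp add: scaleC_prod_def scaleC_of_real scaleR_prod_def)
  show "cinner x y = cnj (cinner y x)"
    unfolding cinner_prod_def by (metis cinner_commute complex_cnj_add)
  show "cinner (x + y) z = cinner x z + cinner y z"
    by (simp add: cinner_prod_def cinner_add_left)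
  show "cinner (c *\<^sub>C x) y = c * cinner x y"
    by (simp add: cinner_prod_def scaleC_prod_def cinner_scaleC_left algebra_simps)
  show "Re (cinner x y) = inner x y"
    by (simp add: cinner_prod_def inner_prod_def Re_cinner)
qed

end

instance prod :: (complex_hilbert_space, complex_hilbert_space) complex_hilbert_space ..

instantiation vec :: (complex_inner, finite) complex_inner
begin

definition scaleC_vec :: "complex \<Rightarrow> 'a ^ 'b \<Rightarrow> 'a ^ 'b"
  where "scaleC_vec c x = (\<chi> k. c *\<^sub>C (x $ k))"

definition cinner_vec :: "'a ^ 'b \<Rightarrow> 'a ^ 'b \<Rightarrow> complex"
  where "cinner_vec x y = (\<Sum>k\<in>UNIV. cinner (x $ k) (y $ k))"

instance
proof
  fix c d :: complex and r :: real and x y z :: "'a ^ 'b"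
  show "c *\<^sub>C (x + y) = c *\<^sub>C x + c *\<^sub>C y"
    by (simp add: scaleC_vec_def scaleC_add_right vec_eq_iff)
  show "(c + d) *\<^sub>C x = c *\<^sub>C x + d *\<^sub>C x"
    by (simp add: scaleC_vec_def scaleC_add_left vec_eq_iff)
  show "c *\<^sub>C (d *\<^sub>C x) = (c * d) *\<^sub>C x"
    by (simp add: scaleC_vec_def scaleC_scaleC vec_eq_iff)
  show "complex_of_real r *\<^sub>C x = r *\<^sub>R x"
    by (simp add: scaleC_vec_def scaleC_of_real vec_eq_iff)
  show "cinner x y = cnj (cinner y x)"
    unfolding cinner_vec_def cnj_sum by (rule sum.cong[OF refl]) (rule cinner_commute)
  show "cinner (x + y) z = cinner x z + cinner y z"
    by (simp add: cinner_vec_def cinner_add_left sum.distrib)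
  show "cinner (c *\<^sub>C x) y = c * cinner x y"
    by (simp add: cinner_vec_def scaleC_vec_def cinner_scaleC_left sum_distrib_left)
  show "Re (cinner x y) = inner x y"
    by (simp add: cinner_vec_def inner_vec_def Re_cinner)
qed

end

instance vec :: (complex_hilbert_space, finite) complex_hilbert_space ..

lemma norm_scaleC: "norm (c *\<^sub>C x) = cmod c * norm (x :: 'a::complex_inner)"
proof -
  have "cinner x (c *\<^sub>C x) = cnj c * cinner x x" for x :: 'a
    by (metis cinner_commute cinner_scaleC_left complex_cnj_cnj complex_cnj_mult)
  then have "cinner (c *\<^sub>C x) (c *\<^sub>C x) = complex_of_real ((cmod c)\<^sup>2) * cinner x x"
    by (simp only: cinner_scaleC_left mult.assoc[symmetric] complex_norm_square)
  then have "inner (c *\<^sub>C x) (c *\<^sub>C x) = (cmod c)\<^sup>2 * inner x x"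
    by (simp only: Re_cinner[symmetric] Re_complex_of_real times_complex.sel Im_complex_of_real
        mult_zero_left diff_zero)
  then show ?thesis
    by (simp add: norm_eq_sqrt_inner real_sqrt_mult)
qed

lemma Im_cinner: "Im (cinner x y) = inner x (\<i> *\<^sub>C (y :: 'a::complex_inner))"
proof -
  have "cinner x (\<i> *\<^sub>C y) = - \<i> * cinner x y"
    by (metis cinner_commute cinner_scaleC_left complex_cnj_i complex_cnj_mult)
  then show ?thesis
    by (simp add: Re_cinner[symmetric, of x "\<i> *\<^sub>C y"])
qed


section \<open>Square-summable sequences\<close>

text \<open>
  The Hilbert space of square-summable sequences in a Hilbert space \<open>'a\<close>. It
  only serves as an ambient space that is closed under finite orthogonal sums, see
  \<open>hilbert_universe\<close> below.
\<close>

typedef (overloaded) 'a ell2 = "{f :: nat \<Rightarrow> 'a::real_inner. summable (\<lambda>n. (norm (f n))\<^sup>2)}"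
  morphisms ell2_nth Abs_ell2
  by (rule exI[of _ "\<lambda>_. 0"]) simp

setup_lifting type_definition_ell2

lemma summable_ell2: "summable (\<lambda>n. (norm (ell2_nth f n))\<^sup>2)"
  using ell2_nth[of f] by simp

lemma ell2_eqI: "(\<And>n. ell2_nth f n = ell2_nth g n) \<Longrightarrow> f = g"
  by (metis ell2_nth_inject ext)

lemma norm_add_square_le: "(norm (x + y))\<^sup>2 \<le> 2 * (norm x)\<^sup>2 + 2 * (norm (y::'a::real_inner))\<^sup>2"
proof -
  have "(norm (x + y))\<^sup>2 \<le> (norm x + norm y)\<^sup>2"
    by (intro power_mono norm_triangle_ineq norm_ge_zero)
  also have "\<dots> \<le> 2 * (norm x)\<^sup>2 + 2 * (norm y)\<^sup>2"
    using sum_squares_bound[of "norm x" "norm y"] by (simp add: power2_sum)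
  finally show ?thesis .
qed

lemma abs_inner_le_squares: "\<bar>inner x y\<bar> \<le> (norm x)\<^sup>2 + (norm (y::'a::real_inner))\<^sup>2"
proof -
  have "\<bar>inner x y\<bar> \<le> norm x * norm y"
    by (rule Cauchy_Schwarz_ineq2)
  also have "\<dots> \<le> (norm x)\<^sup>2 + (norm y)\<^sup>2"
    using sum_squares_bound[of "norm x" "norm y"] mult_nonneg_nonneg[of "norm x" "norm y"]
    unfolding mult.assoc by (smt (verit) norm_ge_zero)
  finally show ?thesis .
qed

lemma summable_inner_ell2: "summable (\<lambda>n. inner (ell2_nth f n) (ell2_nth g n))"
  by (rule summable_comparison_test[OF _ summable_add[OF summable_ell2[of f] summable_ell2[of g]]])
     (auto intro!: exI[of _ 0] abs_inner_le_squares)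

instantiation ell2 :: (real_inner) real_vector
begin

lift_definition zero_ell2 :: "'a ell2" is "\<lambda>_. 0" by simp

lift_definition plus_ell2 :: "'a ell2 \<Rightarrow> 'a ell2 \<Rightarrow> 'a ell2" is "\<lambda>f g n. f n + g n"
proof -
  fix f g :: "nat \<Rightarrow> 'a"
  assume "summable (\<lambda>n. (norm (f n))\<^sup>2)" "summable (\<lambda>n. (norm (g n))\<^sup>2)"
  then have "summable (\<lambda>n. 2 * (norm (f n))\<^sup>2 + 2 * (norm (g n))\<^sup>2)"
    by (intro summable_add summable_mult)
  then show "summable (\<lambda>n. (norm (f n + g n))\<^sup>2)"
    by (rule summable_comparison_test[rotated]) (auto intro!: exI[of _ 0] norm_add_square_le)
qed

lift_definition uminus_ell2 :: "'a ell2 \<Rightarrow> 'a ell2" is "\<lambda>f n. - f n" by simp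

definition minus_ell2 :: "'a ell2 \<Rightarrow> 'a ell2 \<Rightarrow> 'a ell2"
  where "minus_ell2 f g = f + (- g)"

lift_definition scaleR_ell2 :: "real \<Rightarrow> 'a ell2 \<Rightarrow> 'a ell2" is "\<lambda>r f n. r *\<^sub>R f n"
  by (simp add: power_mult_distrib summable_mult)

instance
proof
  fix a b :: real and x y z :: "'a ell2"
  show "x + y + z = x + (y + z)"
    by (rule ell2_eqI) (simp add: plus_ell2.rep_eq add.assoc)
  show "x + y = y + x"
    by (rule ell2_eqI) (simp add: plus_ell2.rep_eq add.commute)
  show "0 + x = x"
    by (rule ell2_eqI) (simp add: plus_ell2.rep_eq zero_ell2.rep_eq)
  show "- x + x = 0"
    by (rule ell2_eqI) (simp add: plus_ell2.rep_eq zero_ell2.rep_eq uminus_ell2.rep_eq)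
  show "x - y = x + - y"
    by (rule minus_ell2_def)
  show "a *\<^sub>R (x + y) = a *\<^sub>R x + a *\<^sub>R y"
    by (rule ell2_eqI) (simp add: plus_ell2.rep_eq scaleR_ell2.rep_eq scaleR_add_right)
  show "(a + b) *\<^sub>R x = a *\<^sub>R x + b *\<^sub>R x"
    by (rule ell2_eqI) (simp add: plus_ell2.rep_eq scaleR_ell2.rep_eq scaleR_add_left)
  show "a *\<^sub>R b *\<^sub>R x = (a * b) *\<^sub>R x"
    by (rule ell2_eqI) (simp add: scaleR_ell2.rep_eq)
  show "1 *\<^sub>R x = x"
    by (rule ell2_eqI) (simp add: scaleR_ell2.rep_eq)
qed

end

lemma ell2_nth_minus: "ell2_nth (f - g) n = ell2_nth f n - ell2_nth g n"
  unfolding minus_ell2_def plus_ell2.rep_eq uminus_ell2.rep_eq by (rule add_uminus_conv_diff)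

instantiation ell2 :: (real_inner) real_inner
begin

definition inner_ell2 :: "'a ell2 \<Rightarrow> 'a ell2 \<Rightarrow> real"
  where "inner_ell2 f g = (\<Sum>n. inner (ell2_nth f n) (ell2_nth g n))"

definition norm_ell2 :: "'a ell2 \<Rightarrow> real"
  where "norm_ell2 f = sqrt (inner f f)"

definition sgn_ell2 :: "'a ell2 \<Rightarrow> 'a ell2"
  where "sgn_ell2 f = f /\<^sub>R norm f"

definition dist_ell2 :: "'a ell2 \<Rightarrow> 'a ell2 \<Rightarrow> real"
  where "dist_ell2 f g = norm (f - g)"

definition uniformity_ell2 :: "('a ell2 \<times> 'a ell2) filter"
  where "uniformity_ell2 = (INF e\<in>{0 <..}. principal {(x, y). dist x y < e})"

definition open_ell2 :: "'a ell2 set \<Rightarrow> bool"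
  where "open_ell2 S = (\<forall>x\<in>S. \<forall>\<^sub>F (x', y) in uniformity. x' = x \<longrightarrow> y \<in> S)"

instance
proof
  fix x y z :: "'a ell2" and r :: real and S :: "'a ell2 set"
  show "dist x y = norm (x - y)" by (rule dist_ell2_def)
  show "sgn x = x /\<^sub>R norm x" by (rule sgn_ell2_def)
  show "uniformity = (INF e\<in>{0 <..}. principal {(x, y :: 'a ell2). dist x y < e})"
    by (rule uniformity_ell2_def)
  show "open S = (\<forall>x\<in>S. \<forall>\<^sub>F (x', y) in uniformity. x' = x \<longrightarrow> y \<in> S)"
    by (rule open_ell2_def)
  show "inner x y = inner y x"
    by (simp add: inner_ell2_def inner_commute)
  show "inner (x + y) z = inner x z + inner y z"
    by (simp add: inner_ell2_def plus_ell2.rep_eq inner_add_left suminf_add summable_inner_ell2)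
  show "inner (r *\<^sub>R x) y = r * inner x y"
    by (simp add: inner_ell2_def scaleR_ell2.rep_eq suminf_mult summable_inner_ell2)
  show "0 \<le> inner x x"
    by (simp add: inner_ell2_def suminf_nonneg summable_inner_ell2)
  show "inner x x = 0 \<longleftrightarrow> x = 0"
  proof
    assume "inner x x = 0"
    then have "\<forall>n. inner (ell2_nth x n) (ell2_nth x n) = 0"
      by (simp only: inner_ell2_def suminf_eq_zero_iff[OF summable_inner_ell2] inner_ge_zero
          simp_thms)
    then show "x = 0"
      by (auto intro!: ell2_eqI simp: zero_ell2.rep_eq)
  qed (simp add: inner_ell2_def zero_ell2.rep_eq)
  show "norm x = sqrt (inner x x)" by (rule norm_ell2_def)
qed

end

lemma norm_ell2_square: "(norm f)\<^sup>2 = (\<Sum>n. (norm (ell2_nth f n))\<^sup>2)"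
  by (simp add: power2_norm_eq_inner inner_ell2_def)

lemma sum_norm_ell2_le: "(\<Sum>n<N. (norm (ell2_nth f n))\<^sup>2) \<le> (norm f)\<^sup>2"
  unfolding norm_ell2_square by (rule sum_le_suminf[OF summable_ell2]) auto

lemma norm_ell2_nth_le: "norm (ell2_nth f n) \<le> norm f"
proof -
  have "(norm (ell2_nth f n))\<^sup>2 \<le> (\<Sum>k<Suc n. (norm (ell2_nth f k))\<^sup>2)"
    by (simp add: sum_nonneg)
  also have "\<dots> \<le> (norm f)\<^sup>2"
    by (rule sum_norm_ell2_le)
  finally show ?thesis
    by (simp add: power2_le_iff_abs_le)
qed

instance ell2 :: ("{real_inner, complete_space}") complete_space
proof
  fix X :: "nat \<Rightarrow> 'a ell2"
  assume X: "Cauchy X"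
  have "convergent (\<lambda>m. ell2_nth (X m) n)" for n
  proof -
    have "Cauchy (\<lambda>m. ell2_nth (X m) n)"
      unfolding Cauchy_altdef2
    proof (intro allI impI)
      fix e :: real assume "e > 0"
      then obtain N where N: "\<forall>m\<ge>N. dist (X m) (X N) < e"
        using X unfolding Cauchy_altdef2 by blast
      have "dist (ell2_nth (X m) n) (ell2_nth (X N) n) \<le> dist (X m) (X N)" for m
        unfolding dist_norm ell2_nth_minus[symmetric] by (rule norm_ell2_nth_le)
      with N show "\<exists>N. \<forall>m\<ge>N. dist (ell2_nth (X m) n) (ell2_nth (X N) n) < e"
        by (meson le_less_trans)
    qed
    then show ?thesis by (rule Cauchy_convergent)
  qed
  then obtain g where g: "(\<lambda>m. ell2_nth (X m) n) \<longlonglongrightarrow> g n" for n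
    unfolding convergent_def by metis
  have partial: "\<exists>M. \<forall>m\<ge>M. \<forall>N. (\<Sum>n<N. (norm (ell2_nth (X m) n - g n))\<^sup>2) \<le> e\<^sup>2"
    if "e > 0" for e :: real
  proof -
    obtain M where M: "\<forall>m\<ge>M. \<forall>k\<ge>M. dist (X m) (X k) < e"
      using X \<open>e > 0\<close> unfolding Cauchy_def by blast
    have "(\<Sum>n<N. (norm (ell2_nth (X m) n - g n))\<^sup>2) \<le> e\<^sup>2" if "m \<ge> M" for m N
    proof (rule tendsto_upperbound)
      show "(\<lambda>k. \<Sum>n<N. (norm (ell2_nth (X m) n - ell2_nth (X k) n))\<^sup>2) \<longlonglongrightarrow>
          (\<Sum>n<N. (norm (ell2_nth (X m) n - g n))\<^sup>2)"
        by (intro tendsto_sum tendsto_power tendsto_norm tendsto_diff tendsto_const g)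
      have "(\<Sum>n<N. (norm (ell2_nth (X m) n - ell2_nth (X k) n))\<^sup>2) \<le> e\<^sup>2" if "k \<ge> M" for k
      proof -
        have "(\<Sum>n<N. (norm (ell2_nth (X m) n - ell2_nth (X k) n))\<^sup>2) \<le> (norm (X m - X k))\<^sup>2"
          unfolding ell2_nth_minus[symmetric] by (rule sum_norm_ell2_le)
        also have "\<dots> \<le> e\<^sup>2"
          using M \<open>m \<ge> M\<close> \<open>k \<ge> M\<close> by (intro power_mono) (auto simp: dist_norm less_imp_le)
        finally show ?thesis .
      qed
      then show "\<forall>\<^sub>F k in sequentially.
          (\<Sum>n<N. (norm (ell2_nth (X m) n - ell2_nth (X k) n))\<^sup>2) \<le> e\<^sup>2"
        unfolding eventually_sequentially by blast
    qed simp
    then show ?thesis by blast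
  qed
  have summ: "summable (\<lambda>n. (norm (ell2_nth (X m) n - g n))\<^sup>2)"
    if "\<forall>N. (\<Sum>n<N. (norm (ell2_nth (X m) n - g n))\<^sup>2) \<le> e" for m e
    by (rule bounded_imp_summable[where B = e])
       (simp_all only: lessThan_Suc_atMost[symmetric] that zero_le_power2)
  obtain M where M: "\<forall>m\<ge>M. \<forall>N. (\<Sum>n<N. (norm (ell2_nth (X m) n - g n))\<^sup>2) \<le> 1\<^sup>2"
    using partial[OF zero_less_one] by blast
  define h where "h = X M - Abs_ell2 (\<lambda>n. ell2_nth (X M) n - g n)"
  have "ell2_nth (Abs_ell2 (\<lambda>n. ell2_nth (X M) n - g n)) = (\<lambda>n. ell2_nth (X M) n - g n)"
    by (intro Abs_ell2_inverse CollectI summ[of M "1\<^sup>2"] M[rule_format] allI order_refl)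
  then have h: "ell2_nth h n = g n" for n
    by (simp add: h_def ell2_nth_minus)
  have "X \<longlonglongrightarrow> h"
    unfolding LIMSEQ_def
  proof (intro allI impI)
    fix e :: real assume "e > 0"
    then obtain M where M: "\<forall>m\<ge>M. \<forall>N. (\<Sum>n<N. (norm (ell2_nth (X m) n - g n))\<^sup>2) \<le> (e / 2)\<^sup>2"
      using partial[OF half_gt_zero[OF \<open>e > 0\<close>]] by blast
    have "dist (X m) h < e" if "m \<ge> M" for m
    proof -
      have "(norm (X m - h))\<^sup>2 \<le> (e / 2)\<^sup>2"
        unfolding norm_ell2_square ell2_nth_minus h
        by (intro suminf_le_const summ[of m "(e / 2)\<^sup>2"] allI M[rule_format] that)
      then have "norm (X m - h) \<le> e / 2"
        using \<open>e > 0\<close> by (simp add: power2_le_iff_abs_le)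
      with \<open>e > 0\<close> show ?thesis by (simp add: dist_norm)
    qed
    then show "\<exists>M. \<forall>m\<ge>M. dist (X m) h < e" by blast
  qed
  then show "convergent X" by (rule convergentI)
qed

lemma summable_cinner_ell2:
  "summable (\<lambda>n. cinner (ell2_nth f n) (ell2_nth g n :: 'a::complex_inner))"
proof (rule summable_comparison_test)
  show "summable (\<lambda>n. 2 * ((norm (ell2_nth f n))\<^sup>2 + (norm (ell2_nth g n))\<^sup>2))"
    by (intro summable_mult summable_add summable_ell2)
  have "cmod (cinner x y) \<le> 2 * ((norm x)\<^sup>2 + (norm y)\<^sup>2)" for x y :: 'a
  proof -
    have "cmod (cinner x y) \<le> \<bar>inner x y\<bar> + \<bar>inner x (\<i> *\<^sub>C y)\<bar>"
      by (metis cmod_le Re_cinner Im_cinner)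
    also have "\<dots> \<le> ((norm x)\<^sup>2 + (norm y)\<^sup>2) + ((norm x)\<^sup>2 + (norm (\<i> *\<^sub>C y))\<^sup>2)"
      by (intro add_mono abs_inner_le_squares)
    finally show ?thesis
      by (simp only: norm_scaleC norm_ii mult_1 mult_2)
  qed
  then show "\<exists>N. \<forall>n\<ge>N. cmod (cinner (ell2_nth f n) (ell2_nth g n))
      \<le> 2 * ((norm (ell2_nth f n))\<^sup>2 + (norm (ell2_nth g n))\<^sup>2)"
    by blast
qed

instantiation ell2 :: (complex_inner) complex_inner
begin

lift_definition scaleC_ell2 :: "complex \<Rightarrow> 'a ell2 \<Rightarrow> 'a ell2" is "\<lambda>c f n. c *\<^sub>C f n"
  by (simp add: norm_scaleC power_mult_distrib summable_mult)

definition cinner_ell2 :: "'a ell2 \<Rightarrow> 'a ell2 \<Rightarrow> complex"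
  where "cinner_ell2 f g = (\<Sum>n. cinner (ell2_nth f n) (ell2_nth g n))"

instance
proof
  fix c d :: complex and r :: real and x y z :: "'a ell2"
  show "c *\<^sub>C (x + y) = c *\<^sub>C x + c *\<^sub>C y"
    by (rule ell2_eqI) (simp add: scaleC_ell2.rep_eq plus_ell2.rep_eq scaleC_add_right)
  show "(c + d) *\<^sub>C x = c *\<^sub>C x + d *\<^sub>C x"
    by (rule ell2_eqI) (simp add: scaleC_ell2.rep_eq plus_ell2.rep_eq scaleC_add_left)
  show "c *\<^sub>C (d *\<^sub>C x) = (c * d) *\<^sub>C x"
    by (rule ell2_eqI) (simp add: scaleC_ell2.rep_eq scaleC_scaleC)
  show "complex_of_real r *\<^sub>C x = r *\<^sub>R x"
    by (rule ell2_eqI) (simp add: scaleC_ell2.rep_eq scaleR_ell2.rep_eq scaleC_of_real)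
  have "(\<lambda>n. cnj (cinner (ell2_nth y n) (ell2_nth x n))) sums cnj (cinner y x)"
    unfolding cinner_ell2_def sums_cnj by (rule summable_sums[OF summable_cinner_ell2])
  then have "(\<lambda>n. cinner (ell2_nth x n) (ell2_nth y n)) sums cnj (cinner y x)"
    by (simp only: cinner_commute[symmetric])
  then show "cinner x y = cnj (cinner y x)"
    by (simp add: cinner_ell2_def sums_iff)
  show "cinner (x + y) z = cinner x z + cinner y z"
    by (simp add: cinner_ell2_def plus_ell2.rep_eq cinner_add_left suminf_add summable_cinner_ell2)
  show "cinner (c *\<^sub>C x) y = c * cinner x y"
    by (simp add: cinner_ell2_def scaleC_ell2.rep_eq cinner_scaleC_left suminf_mult
        summable_cinner_ell2)
  show "Re (cinner x y) = inner x y"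
    unfolding cinner_ell2_def inner_ell2_def
    by (simp add: bounded_linear.suminf[OF bounded_linear_Re summable_cinner_ell2] Re_cinner)
qed

end

instance ell2 :: (complex_hilbert_space) complex_hilbert_space ..


section \<open>Bounded operators on closed subspaces\<close>

text \<open>
  The statement quantifies over Hilbert spaces existentially. Such a space is rendered as a closed
  complex subspace of an ambient Hilbert space (a type), and its operators are functions on the
  ambient type of which only the values on the subspace matter.
\<close>

definition closed_csubspace :: "'a::complex_hilbert_space set \<Rightarrow> bool"
  where "closed_csubspace K \<longleftrightarrow>
    closed K \<and> 0 \<in> K \<and> (\<forall>x\<in>K. \<forall>y\<in>K. x + y \<in> K) \<and> (\<forall>c. \<forall>x\<in>K. c *\<^sub>C x \<in> K)"

definition bounded_op ::
    "'a::complex_hilbert_space set \<Rightarrow> 'b::complex_hilbert_space set \<Rightarrow> ('a \<Rightarrow> 'b) \<Rightarrow> bool"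
  where "bounded_op K L T \<longleftrightarrow>
    (\<forall>x\<in>K. T x \<in> L) \<and>
    (\<forall>x\<in>K. \<forall>y\<in>K. T (x + y) = T x + T y) \<and>
    (\<forall>c. \<forall>x\<in>K. T (c *\<^sub>C x) = c *\<^sub>C T x) \<and>
    (\<exists>M. \<forall>x\<in>K. norm (T x) \<le> M * norm x)"

text \<open>If \<open>T\<close> is boundedly invertible on \<open>K\<close>, its inverse is \<open>inv_into K T\<close>.\<close>

definition boundedly_invertible :: "'a::complex_hilbert_space set \<Rightarrow> ('a \<Rightarrow> 'a) \<Rightarrow> bool"
  where "boundedly_invertible K T \<longleftrightarrow>
    bounded_op K K T \<and> bij_betw T K K \<and> bounded_op K K (inv_into K T)"

definition selfadjoint :: "'a::complex_hilbert_space set \<Rightarrow> ('a \<Rightarrow> 'a) \<Rightarrow> bool"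
  where "selfadjoint K T \<longleftrightarrow>
    bounded_op K K T \<and> (\<forall>x\<in>K. \<forall>y\<in>K. cinner (T x) y = cinner x (T y))"

definition positive_semidefinite :: "'a::complex_hilbert_space set \<Rightarrow> ('a \<Rightarrow> 'a) \<Rightarrow> bool"
  where "positive_semidefinite K T \<longleftrightarrow> selfadjoint K T \<and> (\<forall>x\<in>K. 0 \<le> Re (cinner (T x) x))"

definition unitary :: "'a::complex_hilbert_space set \<Rightarrow> ('a \<Rightarrow> 'a) \<Rightarrow> bool"
  where "unitary K T \<longleftrightarrow>
    bounded_op K K T \<and> T ` K = K \<and> (\<forall>x\<in>K. \<forall>y\<in>K. cinner (T x) (T y) = cinner x y)"

definition spectrum :: "('a::complex_hilbert_space \<Rightarrow> 'a) \<Rightarrow> complex set"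
  where "spectrum T = {\<mu>. \<not> boundedly_invertible UNIV (\<lambda>x. T x - \<mu> *\<^sub>C x)}"


section \<open>Holomorphic operator-valued functions\<close>

text \<open>
  The library's operators \<open>'a \<Rightarrow>\<^sub>L 'b\<close> with their operator norm are only real-linear.
  A function is holomorphic with values in \<open>L('a, 'b)\<close> if its values are complex-linear and it is
  Frechet differentiable in the operator norm with complex-linear derivative.
  The sets \<open>S\<close> below are open.
\<close>

definition holomorphic_op_on ::
    "(complex ^ 'n \<Rightarrow> 'a::complex_hilbert_space \<Rightarrow>\<^sub>L 'b::complex_hilbert_space) \<Rightarrow>
      (complex ^ 'n) set \<Rightarrow> bool"  (infix "holomorphic'_op'_on" 50)
  where "f holomorphic_op_on S \<longleftrightarrow>
    (\<forall>z\<in>S. bounded_op UNIV UNIV (blinfun_apply (f z))) \<and>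
    (\<forall>z\<in>S. \<exists>D. (f has_derivative D) (at z within S) \<and>
       (\<forall>c h x. blinfun_apply (D (c *s h)) x = c *\<^sub>C blinfun_apply (D h) x))"

definition right_halfplane :: "complex set"
  where "right_halfplane = {z. 0 < Re z}"

definition Omega :: "(complex ^ 'n) set"
  where "Omega = (\<Union>\<tau>\<in>sphere 0 1. {z. \<forall>k. z $ k \<in> (\<lambda>\<zeta>. \<tau> * \<zeta>) ` right_halfplane})"

definition polydisc :: "(complex ^ 'n) set"
  where "polydisc = {w. \<forall>k. cmod (w $ k) < 1}"


section \<open>The Bessmertnyi class and the double Cayley transform\<close>

definition pencil :: "('n::finite \<Rightarrow> 'a \<Rightarrow> 'a::complex_hilbert_space) \<Rightarrow> complex ^ 'n \<Rightarrow> 'a \<Rightarrow> 'a"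
  where "pencil A z x = (\<Sum>k\<in>UNIV. (z $ k) *\<^sub>C A k x)"

text \<open>
  \<open>bessmertnyi TYPE('v)\<close> is the class of the functions \<open>f\<close> having a representation in which the
  auxiliary Hilbert space \<open>H\<close> is a closed subspace of \<open>'v\<close>; the orthogonal sum of the space
  \<open>'u\<close> and \<open>H\<close> is \<open>UNIV \<times> H\<close>.
\<close>

definition bessmertnyi ::
    "'v::complex_hilbert_space itself \<Rightarrow>
      (complex ^ 'n \<Rightarrow> 'u::complex_hilbert_space \<Rightarrow>\<^sub>L 'u) set"
  where "bessmertnyi _ = {f. f holomorphic_op_on Omega \<and>
    (\<exists>(H :: 'v set) (A :: 'n \<Rightarrow> 'u \<times> 'v \<Rightarrow> 'u \<times> 'v).
      closed_csubspace H \<and>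
      (\<forall>k. positive_semidefinite (UNIV \<times> H) (A k)) \<and>
      (\<forall>z\<in>Omega.
        let a = (\<lambda>u. fst (pencil A z (u, 0)));
            b = (\<lambda>h. fst (pencil A z (0, h)));
            c = (\<lambda>u. snd (pencil A z (u, 0)));
            d = (\<lambda>h. snd (pencil A z (0, h)))
        in boundedly_invertible H d \<and>
           (\<forall>u. blinfun_apply (f z) u = a u - b (inv_into H d (c u)))))}"

text \<open>
  For \<open>f\<close> in the class above, the operators \<open>F(w) + I\<close> are boundedly invertible, since
  \<open>F(w)\<close> has nonnegative real part.
\<close>

definition double_cayley ::
    "(complex ^ 'n \<Rightarrow> 'u::complex_hilbert_space \<Rightarrow>\<^sub>L 'u) \<Rightarrow> complex ^ 'n \<Rightarrow> 'u \<Rightarrow> 'u"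
  where "double_cayley f w =
    (let F = blinfun_apply (f (\<chi> k. (1 + w $ k) / (1 - w $ k)))
     in (\<lambda>y. F y - y) \<circ> inv_into UNIV (\<lambda>y. F y + y))"


section \<open>Agler unitary colligations\<close>

text \<open>The external orthogonal sum of the spaces \<open>X k\<close>.\<close>

definition orthogonal_sum :: "('n::finite \<Rightarrow> 'v::complex_hilbert_space set) \<Rightarrow> ('v ^ 'n) set"
  where "orthogonal_sum X = {x. \<forall>k. x $ k \<in> X k}"

definition agler_unitary_colligation ::
    "('n::finite \<Rightarrow> 'v::complex_hilbert_space set) \<Rightarrow>
      (('v ^ 'n) \<times> 'u \<Rightarrow> ('v ^ 'n) \<times> 'u::complex_hilbert_space) \<Rightarrow> bool"
  where "agler_unitary_colligation X U \<longleftrightarrow>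
    (\<forall>k. closed_csubspace (X k)) \<and> unitary (orthogonal_sum X \<times> UNIV) U"

definition component_proj :: "'n \<Rightarrow> ('v::complex_hilbert_space) ^ 'n \<Rightarrow> 'v ^ 'n"
  where "component_proj k x = (\<chi> j. if j = k then x $ k else 0)"

definition transfer_function ::
    "('n::finite \<Rightarrow> 'v::complex_hilbert_space set) \<Rightarrow>
      (('v ^ 'n) \<times> 'u \<Rightarrow> ('v ^ 'n) \<times> 'u::complex_hilbert_space) \<Rightarrow> complex ^ 'n \<Rightarrow> 'u \<Rightarrow> 'u"
  where "transfer_function X U w u =
    (let A = (\<lambda>x. fst (U (x, 0)));
         B = (\<lambda>u. fst (U (0, u)));
         C = (\<lambda>x. snd (U (x, 0)));
         D = (\<lambda>u. snd (U (0, u)));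
         P = (\<lambda>x. \<Sum>k\<in>UNIV. (w $ k) *\<^sub>C component_proj k x)
     in D u + C (P (inv_into (orthogonal_sum X) (\<lambda>x. x - A (P x)) (B u))))"


section \<open>The ambient space of the auxiliary Hilbert spaces\<close>

text \<open>
  Given a Hilbert space \<open>'u\<close>, this Hilbert space contains copies of \<open>'u\<close> and of an arbitrary
  Hilbert space \<open>'h\<close>, and a copy of the orthogonal sum of any finitely many of its closed subspaces.
  Since \<open>'h\<close> is arbitrary, a statement about the closed subspaces of
  \<open>('u, 'h) hilbert_universe\<close> that is proved for all \<open>'h\<close> covers all Hilbert spaces.
\<close>

type_synonym ('u, 'h) hilbert_universe = "('u \<times> 'h) ell2"

end

theory Submission
  imports Defs
begin

text \<open>
  A function \<open>f\<close> of the Bessmertnyi class is a relation between vectors \<open>u\<close> and \<open>v = f(z) u\<close>: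
  there is an \<open>h\<close> with \<open>A(z) (u, h) = (v, 0)\<close>. If \<open>A k = G k* G k\<close> are the coefficients, then
  with \<open>p = G (u, h)\<close> and \<open>q k = z k p k\<close> this reads \<open>G* q = (v, 0)\<close>. The pairs \<open>(p, u)\<close> with
  \<open>p = G (u, h)\<close> and the pairs \<open>(q, - v)\<close> with \<open>G* q = (v, 0)\<close> form, up to a closure, two
  complementary orthogonal subspaces. Hence \<open>(q - p, v + u) \<mapsto> (q + p, v - u)\<close> is, up to a sign
  change on the second components, the reflection in the first of them: a selfadjoint unitary
  operator. On the other hand \<open>q k = z k p k\<close> means \<open>q k - p k = w k (q k + p k)\<close>
  for the Cayley transform \<open>w\<close> of \<open>z\<close>, so that this operator is a colligation with input
  \<open>v + u = (f(z) + 1) u\<close>, output \<open>v - u = (f(z) - 1) u\<close> and state \<open>q + p\<close>. Its transfer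
  function is therefore the double Cayley transform of \<open>f\<close>. This computation is
  \<open>transfer_function_eq_double_cayley\<close>, and both directions of the theorem rest on it.

  Given \<open>f\<close>, the factors \<open>G k\<close> come from square roots of the \<open>A k\<close>, and the reflection from the
  orthogonal projection onto a closed subspace (\<open>bessmertnyi_imp_selfadjoint_colligation\<close>).
  The value of the double Cayley transform at the origin minus \<open>1\<close> is \<open>- 2 (f(1,...,1) + 1)\<^sup>-\<^sup>1\<close>,
  which gives the spectral condition.

  Conversely, a selfadjoint unitary colligation provides the subspace of the pairs \<open>(p, u)\<close> as an
  eigenspace, and the spectral condition makes this eigenspace
  the range of a bounded map \<open>(u, h) \<mapsto> (G (u, h), u)\<close>
  (\<open>selfadjoint_colligation_imp_bessmertnyi\<close>). The Gram operators of the components of \<open>G\<close>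
  form the pencil; its lower right block is coercive at the points of \<open>Omega\<close>, up to a rotation,
  hence invertible by the Lax-Milgram lemma, and the Schur complement is holomorphic.

  The auxiliary spaces must lie in prescribed ambient spaces. A space of square-summable
  sequences contains, isometrically, its own finite powers, which leaves room for them.
\<close>

section \<open>Complex inner products and operators on subspaces\<close>

lemma cinner_add_right: "cinner x (y + z) = cinner x y + cinner x (z :: 'a::complex_inner)"
  by (metis cinner_commute cinner_add_left complex_cnj_add)

lemma cinner_scaleC_right: "cinner x (c *\<^sub>C y) = cnj c * cinner x (y :: 'a::complex_inner)"
  by (metis cinner_commute cinner_scaleC_left complex_cnj_mult)

lemma scaleC_one [simp]: "1 *\<^sub>C (x :: 'a::complex_inner) = x"
  using scaleC_of_real[of 1 x] by simp

lemma scaleC_zero_left [simp]: "0 *\<^sub>C (x :: 'a::complex_inner) = 0"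
  using scaleC_of_real[of 0 x] by simp

lemma scaleC_minus_one: "(- 1) *\<^sub>C (x :: 'a::complex_inner) = - x"
  using scaleC_of_real[of "- 1" x] by simp

lemma scaleC_zero_right [simp]: "c *\<^sub>C (0 :: 'a::complex_inner) = 0"
  by (metis add_cancel_right_right scaleC_add_right)

lemma scaleC_minus_right [simp]: "c *\<^sub>C (- x) = - (c *\<^sub>C (x :: 'a::complex_inner))"
  by (metis add.right_inverse add_eq_0_iff scaleC_add_right scaleC_zero_right)

lemma scaleC_diff_right: "c *\<^sub>C (x - y) = c *\<^sub>C x - c *\<^sub>C (y :: 'a::complex_inner)"
  by (simp only: diff_conv_add_uminus scaleC_add_right scaleC_minus_right)

lemma scaleC_diff_left: "(c - d) *\<^sub>C x = c *\<^sub>C x - d *\<^sub>C (x :: 'a::complex_inner)"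
  by (metis add_diff_cancel diff_add_cancel scaleC_add_left)

lemma scaleC_sum_right: "c *\<^sub>C sum f S = (\<Sum>i\<in>S. c *\<^sub>C (f i :: 'a::complex_inner))"
  by (induction S rule: infinite_finite_induct) (auto simp: scaleC_add_right)

lemma scaleR_conv_scaleC: "r *\<^sub>R x = complex_of_real r *\<^sub>C (x :: 'a::complex_inner)"
  by (simp add: scaleC_of_real)

lemma cinner_zero_left [simp]: "cinner 0 (y :: 'a::complex_inner) = 0"
  using cinner_scaleC_left[of 0 0 y] by simp

lemma cinner_zero_right [simp]: "cinner (x :: 'a::complex_inner) 0 = 0"
  using cinner_scaleC_right[of x 0 0] by simp

lemma cinner_minus_left [simp]: "cinner (- x) y = - cinner x (y :: 'a::complex_inner)"
  using cinner_scaleC_left[of "- 1" x y] by (simp add: scaleC_minus_one)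

lemma cinner_minus_right [simp]: "cinner x (- y) = - cinner x (y :: 'a::complex_inner)"
  using cinner_scaleC_right[of x "- 1" y] by (simp add: scaleC_minus_one)

lemma cinner_diff_left: "cinner (x - y) z = cinner x z - cinner y (z :: 'a::complex_inner)"
  by (simp only: diff_conv_add_uminus cinner_add_left cinner_minus_left)

lemma cinner_diff_right: "cinner x (y - z) = cinner x y - cinner x (z :: 'a::complex_inner)"
  by (simp only: diff_conv_add_uminus cinner_add_right cinner_minus_right)

lemma cinner_sum_left: "cinner (sum f S) (y :: 'a::complex_inner) = (\<Sum>i\<in>S. cinner (f i) y)"
  by (induction S rule: infinite_finite_induct) (auto simp: cinner_add_left)

lemma cinner_sum_right: "cinner (y :: 'a::complex_inner) (sum f S) = (\<Sum>i\<in>S. cinner y (f i))"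
  by (induction S rule: infinite_finite_induct) (auto simp: cinner_add_right)

lemma cinner_self: "cinner x (x :: 'a::complex_inner) = complex_of_real ((norm x)\<^sup>2)"
proof (rule complex_eqI)
  have "cinner x x = cnj (cinner x x)" by (rule cinner_commute)
  then show "Im (cinner x x) = Im (complex_of_real ((norm x)\<^sup>2))"
    by (metis Im_complex_of_real add.inverse_neutral cnj.simps(2) complex_cnj_complex_of_real
        equal_neg_zero)
qed (simp add: Re_cinner power2_norm_eq_inner)

lemma cinner_self_eq_zero: "cinner x (x :: 'a::complex_inner) = 0 \<Longrightarrow> x = 0"
  by (simp add: cinner_self)

lemma closed_csubspace_UNIV: "closed_csubspace UNIV"
  by (simp add: closed_csubspace_def)

lemma closed_csubspace_Times:
  "closed_csubspace K \<Longrightarrow> closed_csubspace L \<Longrightarrow> closed_csubspace (K \<times> L)"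
  by (auto simp: closed_csubspace_def closed_Times scaleC_prod_def zero_prod_def)

context
  fixes K :: "'a::complex_hilbert_space set"
  assumes K: "closed_csubspace K"
begin

lemma csubspace_zero: "0 \<in> K"
  and csubspace_add: "x \<in> K \<Longrightarrow> y \<in> K \<Longrightarrow> x + y \<in> K"
  and csubspace_scaleC: "x \<in> K \<Longrightarrow> c *\<^sub>C x \<in> K"
  and csubspace_closed: "closed K"
  using K by (auto simp: closed_csubspace_def)

lemma csubspace_scaleR: "x \<in> K \<Longrightarrow> r *\<^sub>R x \<in> K"
  by (simp add: scaleR_conv_scaleC csubspace_scaleC)

lemma csubspace_minus: "x \<in> K \<Longrightarrow> - x \<in> K"
  using csubspace_scaleC[of x "- 1"] by (simp add: scaleC_minus_one)

lemma csubspace_diff: "x \<in> K \<Longrightarrow> y \<in> K \<Longrightarrow> x - y \<in> K"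
  using csubspace_add[of x "- y"] csubspace_minus[of y] by simp

lemma csubspace_sum: "(\<And>i. i \<in> S \<Longrightarrow> f i \<in> K) \<Longrightarrow> sum f S \<in> K"
  by (induction S rule: infinite_finite_induct) (auto simp: csubspace_zero csubspace_add)

lemma csubspace_complete: "complete K"
  by (simp add: csubspace_closed complete_eq_closed)

context
  fixes L :: "'b::complex_hilbert_space set" and T :: "'a \<Rightarrow> 'b"
  assumes T: "bounded_op K L T"
begin

lemma bounded_op_in: "x \<in> K \<Longrightarrow> T x \<in> L"
  and bounded_op_add: "x \<in> K \<Longrightarrow> y \<in> K \<Longrightarrow> T (x + y) = T x + T y"
  and bounded_op_scaleC: "x \<in> K \<Longrightarrow> T (c *\<^sub>C x) = c *\<^sub>C T x"
  using T by (auto simp: bounded_op_def)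

lemma bounded_op_zero: "T 0 = 0"
  using bounded_op_scaleC[OF csubspace_zero, of 0] by simp

lemma bounded_op_minus: "x \<in> K \<Longrightarrow> T (- x) = - T x"
  using bounded_op_scaleC[of x "- 1"] by (simp add: scaleC_minus_one)

lemma bounded_op_diff: "x \<in> K \<Longrightarrow> y \<in> K \<Longrightarrow> T (x - y) = T x - T y"
  using bounded_op_add[of x "- y"] csubspace_minus[of y] bounded_op_minus[of y] by simp

lemma bounded_op_scaleR: "x \<in> K \<Longrightarrow> T (r *\<^sub>R x) = r *\<^sub>R T x"
  by (simp add: scaleR_conv_scaleC bounded_op_scaleC)

lemma bounded_op_bound: obtains M where "0 < M" "\<And>x. x \<in> K \<Longrightarrow> norm (T x) \<le> M * norm x"
proof -
  obtain M where M: "\<forall>x\<in>K. norm (T x) \<le> M * norm x"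
    using T by (auto simp: bounded_op_def)
  have "norm (T x) \<le> (\<bar>M\<bar> + 1) * norm x" if "x \<in> K" for x
  proof -
    have "norm (T x) \<le> M * norm x" using M that by blast
    also have "\<dots> \<le> (\<bar>M\<bar> + 1) * norm x" by (intro mult_right_mono) auto
    finally show ?thesis .
  qed
  then show ?thesis by (rule that[rotated]) auto
qed

end

end

lemma bounded_opI:
  assumes "\<And>x. x \<in> K \<Longrightarrow> T x \<in> L"
    and "\<And>x y. x \<in> K \<Longrightarrow> y \<in> K \<Longrightarrow> T (x + y) = T x + T y"
    and "\<And>c x. x \<in> K \<Longrightarrow> T (c *\<^sub>C x) = c *\<^sub>C T x"
    and "\<And>x. x \<in> K \<Longrightarrow> norm (T x) \<le> M * norm x"
  shows "bounded_op K L T"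
  unfolding bounded_op_def using assms by blast

lemma bounded_op_compose:
  assumes K: "closed_csubspace K" and L: "closed_csubspace L"
    and T: "bounded_op K L T" and S: "bounded_op L J S"
  shows "bounded_op K J (\<lambda>x. S (T x))"
proof -
  obtain M where M: "0 < M" "\<And>x. x \<in> K \<Longrightarrow> norm (T x) \<le> M * norm x"
    by (rule bounded_op_bound[OF K T]) blast
  obtain M' where M': "0 < M'" "\<And>x. x \<in> L \<Longrightarrow> norm (S x) \<le> M' * norm x"
    by (rule bounded_op_bound[OF L S]) blast
  show ?thesis
  proof (rule bounded_opI)
    fix x assume x: "x \<in> K"
    have "norm (S (T x)) \<le> M' * norm (T x)" using M' bounded_op_in[OF K T x] by blast
    also have "\<dots> \<le> M' * (M * norm x)" using M(2)[OF x] M'(1) by (intro mult_left_mono) auto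
    finally show "norm (S (T x)) \<le> (M' * M) * norm x" by (simp add: mult.assoc)
  qed (simp_all add: bounded_op_in[OF K T] bounded_op_in[OF L S] bounded_op_add[OF K T]
      bounded_op_add[OF L S] bounded_op_scaleC[OF K T] bounded_op_scaleC[OF L S])
qed

lemma bounded_op_lincomb:
  assumes K: "closed_csubspace K" and L: "closed_csubspace L"
    and T: "bounded_op K L T" and S: "bounded_op K L S"
  shows "bounded_op K L (\<lambda>x. a *\<^sub>C T x + b *\<^sub>C S x)"
proof -
  obtain M where M: "0 < M" "\<And>x. x \<in> K \<Longrightarrow> norm (T x) \<le> M * norm x"
    by (rule bounded_op_bound[OF K T]) blast
  obtain M' where M': "0 < M'" "\<And>x. x \<in> K \<Longrightarrow> norm (S x) \<le> M' * norm x"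
    by (rule bounded_op_bound[OF K S]) blast
  show ?thesis
  proof (rule bounded_opI)
    fix x assume x: "x \<in> K"
    have "norm (a *\<^sub>C T x + b *\<^sub>C S x) \<le> cmod a * norm (T x) + cmod b * norm (S x)"
      by (metis norm_triangle_ineq norm_scaleC)
    also have "\<dots> \<le> cmod a * (M * norm x) + cmod b * (M' * norm x)"
      using M(2)[OF x] M'(2)[OF x] by (intro add_mono mult_left_mono) auto
    finally show "norm (a *\<^sub>C T x + b *\<^sub>C S x) \<le> (cmod a * M + cmod b * M') * norm x"
      by (simp add: algebra_simps)
  qed (simp_all add: bounded_op_in[OF K T] bounded_op_in[OF K S] bounded_op_add[OF K T]
      bounded_op_add[OF K S] bounded_op_scaleC[OF K T] bounded_op_scaleC[OF K S]
      csubspace_add[OF L] csubspace_scaleC[OF L] scaleC_add_right scaleC_scaleC mult.commute)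
qed

lemma bounded_op_imp_bounded_linear: "bounded_op UNIV UNIV T \<Longrightarrow> bounded_linear T"
proof -
  assume T: "bounded_op UNIV UNIV T"
  obtain M where M: "\<And>x. x \<in> UNIV \<Longrightarrow> norm (T x) \<le> M * norm x"
    by (rule bounded_op_bound[OF closed_csubspace_UNIV T]) blast
  show ?thesis
    by (rule bounded_linear_intro[where K = M])
      (use M in \<open>auto simp: bounded_op_add[OF closed_csubspace_UNIV T]
        bounded_op_scaleR[OF closed_csubspace_UNIV T] mult.commute\<close>)
qed

lemma boundedly_invertibleI:
  assumes K: "closed_csubspace K" and T: "bounded_op K K T"
    and surj: "\<And>y. y \<in> K \<Longrightarrow> \<exists>x\<in>K. T x = y"
    and below: "\<And>x. x \<in> K \<Longrightarrow> norm x \<le> M * norm (T x)"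
  shows "boundedly_invertible K T"
proof -
  have "inj_on T K"
  proof (rule inj_onI)
    fix x y assume xy: "x \<in> K" "y \<in> K" "T x = T y"
    have "norm (x - y) \<le> M * norm (T (x - y))"
      by (rule below) (simp add: csubspace_diff[OF K] xy)
    then show "x = y" by (simp add: bounded_op_diff[OF K T] xy)
  qed
  moreover have "T ` K = K"
    using surj bounded_op_in[OF K T] by (fastforce simp: image_iff)
  ultimately have bij: "bij_betw T K K" by (simp add: bij_betw_def)
  let ?S = "inv_into K T"
  have S: "?S y \<in> K" "T (?S y) = y" if "y \<in> K" for y
    using that \<open>T ` K = K\<close> by (auto intro: inv_into_into f_inv_into_f)
  have eq: "?S y = x" if "x \<in> K" "T x = y" for x y
    using \<open>inj_on T K\<close> that by auto
  have "bounded_op K K ?S"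
  proof (rule bounded_opI)
    show "norm (?S y) \<le> M * norm y" if "y \<in> K" for y
      using below[OF S(1)[OF that]] S(2)[OF that] by simp
  qed (auto intro!: eq simp: S csubspace_add[OF K] csubspace_scaleC[OF K] bounded_op_add[OF K T]
      bounded_op_scaleC[OF K T])
  with bij T show ?thesis by (simp add: boundedly_invertible_def)
qed

lemma boundedly_invertibleD:
  assumes "boundedly_invertible K T"
  shows "bounded_op K K T" "bounded_op K K (inv_into K T)"
    "y \<in> K \<Longrightarrow> T (inv_into K T y) = y" "x \<in> K \<Longrightarrow> inv_into K T (T x) = x"
  using assms by (auto simp: boundedly_invertible_def bij_betw_def f_inv_into_f)

lemma selfadjointD:
  assumes "selfadjoint K T"
  shows "bounded_op K K T" "x \<in> K \<Longrightarrow> y \<in> K \<Longrightarrow> cinner (T x) y = cinner x (T y)"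
  using assms by (auto simp: selfadjoint_def)

lemma selfadjoint_involution_unitary:
  assumes "selfadjoint K T" and inv: "\<And>x. x \<in> K \<Longrightarrow> T (T x) = x"
  shows "unitary K T"
proof -
  have "T x \<in> K" if "x \<in> K" for x
    using assms(1) that by (auto simp: selfadjoint_def bounded_op_def)
  then show ?thesis
    using assms by (force simp: unitary_def selfadjoint_def image_iff)
qed

lemma selfadjoint_unitary_involution:
  assumes K: "closed_csubspace K" and "selfadjoint K T" "unitary K T" and x: "x \<in> K"
  shows "T (T x) = x"
proof -
  have T: "bounded_op K K T" and sym: "\<And>x y. x \<in> K \<Longrightarrow> y \<in> K \<Longrightarrow> cinner (T x) y = cinner x (T y)"
    and iso: "\<And>x y. x \<in> K \<Longrightarrow> y \<in> K \<Longrightarrow> cinner (T x) (T y) = cinner x y"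
    using assms by (auto simp: selfadjoint_def unitary_def)
  have mem: "T (T x) \<in> K" by (intro bounded_op_in[OF K T] x)
  have "cinner (T (T x) - x) y = 0" if "y \<in> K" for y
    using sym[OF bounded_op_in[OF K T x] that] iso[OF x that] by (simp add: cinner_diff_left)
  then have "cinner (T (T x) - x) (T (T x) - x) = 0"
    using csubspace_diff[OF K mem x] by blast
  then show ?thesis using cinner_self_eq_zero by fastforce
qed

lemma unitary_norm: "unitary K T \<Longrightarrow> x \<in> K \<Longrightarrow> norm (T x) = norm x"
  by (auto simp: unitary_def norm_eq_sqrt_inner simp flip: Re_cinner)

section \<open>Orthogonal projections\<close>

lemma csubspace_convex: "closed_csubspace M \<Longrightarrow> convex M"
  by (rule convexI) (simp add: csubspace_add csubspace_scaleR)

lemma parallelogram_law: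
  "(norm (x + y))\<^sup>2 + (norm (x - y))\<^sup>2 = 2 * (norm x)\<^sup>2 + 2 * (norm (y :: 'a::real_inner))\<^sup>2"
  by (simp add: power2_norm_eq_inner inner_add_left inner_add_right inner_diff_left
      inner_diff_right inner_commute)

lemma norm_diff_scaleR_square:
  "(norm (x - r *\<^sub>R y))\<^sup>2 = (norm x)\<^sup>2 - 2 * r * inner y x + r\<^sup>2 * (norm (y :: 'a::real_inner))\<^sup>2"
  unfolding power2_norm_eq_inner
  by (simp add: inner_diff_left inner_diff_right inner_commute[of x y] power2_eq_square algebra_simps)

text \<open>
  A minimizing sequence is Cauchy by the parallelogram law, since the midpoint of two of its
  members is no closer to \<open>x\<close> than the infimum.
\<close>

lemma closest_point_exists:
  fixes M :: "'a::{real_inner, complete_space} set"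
  assumes "convex M" "closed M" "M \<noteq> {}"
  shows "\<exists>y\<in>M. \<forall>z\<in>M. dist x y \<le> dist x z"
proof -
  define d where "d = Inf ((\<lambda>y. (norm (x - y))\<^sup>2) ` M)"
  have bdd: "bdd_below ((\<lambda>y. (norm (x - y))\<^sup>2) ` M)"
    by (rule bdd_belowI[of _ 0]) auto
  have d_le: "d \<le> (norm (x - y))\<^sup>2" if "y \<in> M" for y
    unfolding d_def by (intro cInf_lower bdd imageI that)
  have "\<exists>y\<in>M. (norm (x - y))\<^sup>2 < d + 1 / Suc n" for n
  proof -
    have "Inf ((\<lambda>y. (norm (x - y))\<^sup>2) ` M) < d + 1 / Suc n"
      by (simp add: d_def)
    then show ?thesis
      using cInf_lessD[of "(\<lambda>y. (norm (x - y))\<^sup>2) ` M"] \<open>M \<noteq> {}\<close> by blast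
  qed
  then obtain y where y: "\<And>n. y n \<in> M" "\<And>n. (norm (x - y n))\<^sup>2 < d + 1 / Suc n"
    by metis
  have close: "(norm (y n - y k))\<^sup>2 \<le> 4 / Suc k" if "k \<le> n" for n k
  proof -
    have mid: "(1/2) *\<^sub>R y n + (1/2) *\<^sub>R y k \<in> M"
      by (rule convexD[OF \<open>convex M\<close>]) (auto simp: y)
    have "norm ((x - y n) + (x - y k)) = norm (2 *\<^sub>R (x - ((1/2) *\<^sub>R y n + (1/2) *\<^sub>R y k)))"
      by (simp add: algebra_simps scaleR_2)
    also have "\<dots> = 2 * norm (x - ((1/2) *\<^sub>R y n + (1/2) *\<^sub>R y k))"
      by (simp only: norm_scaleR)
    finally have "(norm ((x - y n) + (x - y k)))\<^sup>2 \<ge> 4 * d"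
      using d_le[OF mid] by (simp add: power_mult_distrib)
    moreover have "(norm ((x - y n) - (x - y k)))\<^sup>2 = (norm (y n - y k))\<^sup>2"
      by (simp add: norm_minus_commute)
    ultimately have "(norm (y n - y k))\<^sup>2 \<le> 2 * (1 / Suc n) + 2 * (1 / Suc k)"
      using parallelogram_law[of "x - y n" "x - y k"] y(2)[of n] y(2)[of k] by linarith
    moreover have "1 / real (Suc n) \<le> 1 / real (Suc k)"
      using that by (simp add: frac_le)
    ultimately show ?thesis by linarith
  qed
  have "Cauchy y"
    unfolding Cauchy_altdef2
  proof (intro allI impI)
    fix e :: real assume "e > 0"
    then obtain k where k: "4 / e\<^sup>2 < real k"
      using reals_Archimedean2 by blast
    have "dist (y n) (y k) < e" if "n \<ge> k" for n
    proof -
      have "4 / real (Suc k) < e\<^sup>2"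
        using k \<open>e > 0\<close> by (simp add: field_simps) (smt (verit) zero_less_power2)
      then have "(norm (y n - y k))\<^sup>2 < e\<^sup>2" using close[OF that] by linarith
      then show ?thesis
        using \<open>e > 0\<close> by (simp add: dist_norm power_less_imp_less_base)
    qed
    then show "\<exists>k. \<forall>n\<ge>k. dist (y n) (y k) < e" by blast
  qed
  then obtain l where l: "y \<longlonglongrightarrow> l"
    using Cauchy_convergent convergent_def by blast
  have "l \<in> M"
    using closed_sequentially[OF \<open>closed M\<close> y(1) l] .
  have "(\<lambda>n. (norm (x - y n))\<^sup>2) \<longlonglongrightarrow> (norm (x - l))\<^sup>2"
    by (intro tendsto_intros l)
  moreover have "(\<lambda>n. d + 1 / real (Suc n)) \<longlonglongrightarrow> d + 0"
    by (intro tendsto_intros LIMSEQ_Suc[OF lim_1_over_n])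
  ultimately have "(norm (x - l))\<^sup>2 \<le> d + 0"
    by (rule LIMSEQ_le) (use y(2) in \<open>blast intro: less_imp_le\<close>)
  then have le: "(norm (x - l))\<^sup>2 \<le> d" by simp
  have "dist x l \<le> dist x z" if "z \<in> M" for z
    unfolding dist_norm by (rule power2_le_imp_le[OF order_trans[OF le d_le[OF that]] norm_ge_zero])
  with \<open>l \<in> M\<close> show ?thesis by blast
qed

definition orthogonal_projection :: "'a::complex_hilbert_space set \<Rightarrow> 'a \<Rightarrow> 'a"
  where "orthogonal_projection M x = (SOME y. y \<in> M \<and> (\<forall>m\<in>M. cinner (x - y) m = 0))"

lemma orthogonal_projection:
  fixes M :: "'a::complex_hilbert_space set"
  assumes M: "closed_csubspace M"
  shows orthogonal_projection_in: "orthogonal_projection M x \<in> M"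
    and orthogonal_projection_orthogonal: "m \<in> M \<Longrightarrow> cinner (x - orthogonal_projection M x) m = 0"
proof -
  obtain y where y: "y \<in> M" "\<forall>z\<in>M. dist x y \<le> dist x z"
    using closest_point_exists[OF csubspace_convex[OF M] csubspace_closed[OF M]]
      csubspace_zero[OF M] by blast
  have le: "inner (x - y) m \<le> 0" if "m \<in> M" for m
    using any_closest_point_dot[OF csubspace_convex[OF M] csubspace_closed[OF M] y(1)
        csubspace_add[OF M y(1) that] y(2)] by simp
  have eq: "inner (x - y) m = 0" if "m \<in> M" for m
    using le[OF that] le[OF csubspace_minus[OF M that]] by simp
  have "cinner (x - y) m = 0" if "m \<in> M" for m
    by (rule complex_eqI)
      (simp_all add: Re_cinner Im_cinner eq that csubspace_scaleC[OF M])
  with y have "\<exists>y. y \<in> M \<and> (\<forall>m\<in>M. cinner (x - y) m = 0)" by blast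
  from someI_ex[OF this] show "orthogonal_projection M x \<in> M"
    "m \<in> M \<Longrightarrow> cinner (x - orthogonal_projection M x) m = 0"
    unfolding orthogonal_projection_def by blast+
qed

context
  fixes M :: "'a::complex_hilbert_space set"
  assumes M: "closed_csubspace M"
begin

lemma orthogonal_projection_eqI:
  assumes "y \<in> M" "\<And>m. m \<in> M \<Longrightarrow> cinner (x - y) m = 0"
  shows "orthogonal_projection M x = y"
proof -
  let ?p = "orthogonal_projection M x"
  have mem: "y - ?p \<in> M"
    by (intro csubspace_diff[OF M] assms orthogonal_projection_in M)
  have "cinner (y - ?p) (y - ?p) = cinner (x - ?p) (y - ?p) - cinner (x - y) (y - ?p)"
    by (simp add: cinner_diff_left)
  also have "\<dots> = 0"
    by (simp add: mem assms(2) orthogonal_projection_orthogonal[OF M])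
  finally show ?thesis using cinner_self_eq_zero by fastforce
qed

lemma orthogonal_projection_cinner:
  "m \<in> M \<Longrightarrow> cinner (orthogonal_projection M x) m = cinner x m"
  using orthogonal_projection_orthogonal[OF M, of m x] by (simp add: cinner_diff_left)

lemma orthogonal_projection_idem: "m \<in> M \<Longrightarrow> orthogonal_projection M m = m"
  by (rule orthogonal_projection_eqI) auto

lemma selfadjoint_orthogonal_projection: "selfadjoint UNIV (orthogonal_projection M)"
proof -
  let ?P = "orthogonal_projection M"
  have "cinner (?P x) y = cinner x (?P y)" for x y
  proof -
    have "cinner (?P x) y = cnj (cinner y (?P x))" by (rule cinner_commute)
    also have "\<dots> = cnj (cinner (?P y) (?P x))"
      by (simp add: orthogonal_projection_cinner orthogonal_projection_in[OF M])
    also have "\<dots> = cinner (?P x) (?P y)" by (rule cinner_commute[symmetric])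
    also have "\<dots> = cinner x (?P y)"
      by (simp add: orthogonal_projection_cinner orthogonal_projection_in[OF M])
    finally show ?thesis .
  qed
  moreover have "bounded_op UNIV UNIV ?P"
  proof (rule bounded_opI)
    fix x y :: 'a and c
    show "?P (x + y) = ?P x + ?P y"
      by (rule orthogonal_projection_eqI)
        (simp_all add: csubspace_add[OF M] orthogonal_projection_in[OF M] cinner_diff_left
          cinner_add_left orthogonal_projection_cinner)
    show "?P (c *\<^sub>C x) = c *\<^sub>C ?P x"
      by (rule orthogonal_projection_eqI)
        (simp_all add: csubspace_scaleC[OF M] orthogonal_projection_in[OF M] cinner_diff_left
          cinner_scaleC_left orthogonal_projection_cinner)
    have "(norm (?P x))\<^sup>2 = inner x (?P x)"
      using arg_cong[OF orthogonal_projection_cinner[OF orthogonal_projection_in[OF M], of x], of Re]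
      by (simp add: Re_cinner power2_norm_eq_inner)
    also have "\<dots> \<le> norm x * norm (?P x)" by (rule norm_cauchy_schwarz)
    finally show "norm (?P x) \<le> 1 * norm x"
      by (cases "norm (?P x) = 0") (auto simp: power2_eq_square)
  qed simp
  ultimately show ?thesis by (simp add: selfadjoint_def)
qed

end

section \<open>Coercive operators\<close>

text \<open>
  The Lax-Milgram lemma. For small positive \<open>r\<close> the map \<open>h \<mapsto> h - r c (T h - g)\<close> is a
  contraction, because \<open>norm (h - r c T h)^2 \<le> (1 - 2 r \<delta> + r^2 K^2) norm h^2\<close>
  if \<open>K\<close> bounds \<open>c T\<close>; its fixed point solves \<open>T h = g\<close>.
\<close>

lemma coercive_boundedly_invertible:
  fixes T :: "'a::complex_hilbert_space \<Rightarrow> 'a"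
  assumes H: "closed_csubspace H" and T: "bounded_op H H T" and "0 < \<delta>"
    and coercive: "\<And>h. h \<in> H \<Longrightarrow> \<delta> * (norm h)\<^sup>2 \<le> Re (c * cinner (T h) h)"
  shows "boundedly_invertible H T"
proof (cases "H \<subseteq> {0}")
  case True
  then have "H = {0}" using csubspace_zero[OF H] by blast
  then show ?thesis
    by (intro boundedly_invertibleI[OF H T, of 0]) (use bounded_op_zero[OF H T] in auto)
next
  case False
  then obtain h0 where h0: "h0 \<in> H" "h0 \<noteq> 0" by blast
  have "c \<noteq> 0"
  proof
    assume "c = 0"
    then have "\<delta> * (norm h0)\<^sup>2 \<le> 0" using coercive[OF h0(1)] by simp
    moreover have "0 < \<delta> * (norm h0)\<^sup>2" using h0(2) \<open>0 < \<delta>\<close> by simp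
    ultimately show False by linarith
  qed
  have inner_eq: "Re (c * cinner (T h) h) = inner (c *\<^sub>C T h) h" for h
    by (simp add: cinner_scaleC_left flip: Re_cinner)
  have le: "\<delta> * (norm h)\<^sup>2 \<le> norm (c *\<^sub>C T h) * norm h" if "h \<in> H" for h
    using coercive[OF that] inner_eq[of h] norm_cauchy_schwarz[of "c *\<^sub>C T h" h] by linarith
  have below: "norm h \<le> cmod c / \<delta> * norm (T h)" if "h \<in> H" for h
  proof (cases "h = 0")
    case False
    then have "\<delta> * norm h \<le> norm (c *\<^sub>C T h)"
      using le[OF that] by (simp add: power2_eq_square flip: mult.assoc)
    then show ?thesis
      using \<open>0 < \<delta>\<close> by (simp add: norm_scaleC field_simps)
  qed (use \<open>0 < \<delta>\<close> in simp)
  obtain M where M: "0 < M" "\<And>h. h \<in> H \<Longrightarrow> norm (T h) \<le> M * norm h"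
    by (rule bounded_op_bound[OF H T]) blast
  define K where "K = cmod c * M + \<delta>"
  have K: "0 < K" "norm (c *\<^sub>C T h) \<le> K * norm h" if "h \<in> H" for h
  proof -
    show "0 < K" using M(1) \<open>0 < \<delta>\<close> by (simp add: K_def add_nonneg_pos)
    have "norm (c *\<^sub>C T h) \<le> cmod c * (M * norm h)"
      using M(2)[OF that] by (simp add: norm_scaleC mult_left_mono)
    also have "\<dots> \<le> K * norm h" using \<open>0 < \<delta>\<close> by (simp add: K_def algebra_simps)
    finally show "norm (c *\<^sub>C T h) \<le> K * norm h" .
  qed
  have "0 < K" using K(1)[OF h0(1)] .
  have "\<delta> \<le> K" using M(1) by (simp add: K_def)
  (* The value r = \<delta> / K^2 minimises 1 - 2 r \<delta> + r^2 K^2. *)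
  define r where "r = \<delta> / K\<^sup>2"
  define q where "q = sqrt (1 - \<delta>\<^sup>2 / K\<^sup>2)"
  have "0 < r" using \<open>0 < \<delta>\<close> \<open>0 < K\<close> by (simp add: r_def)
  have ratio: "0 < \<delta>\<^sup>2 / K\<^sup>2" "\<delta>\<^sup>2 / K\<^sup>2 \<le> 1"
    using \<open>0 < \<delta>\<close> \<open>0 < K\<close> \<open>\<delta> \<le> K\<close> by (simp_all add: power_mono)
  have q: "0 \<le> q" "q < 1"
    using ratio by (simp_all add: q_def)
  have contraction: "norm (h - r *\<^sub>R (c *\<^sub>C T h)) \<le> q * norm h" if "h \<in> H" for h
  proof -
    have "(norm (h - r *\<^sub>R (c *\<^sub>C T h)))\<^sup>2
        = (norm h)\<^sup>2 - 2 * r * inner (c *\<^sub>C T h) h + r\<^sup>2 * (norm (c *\<^sub>C T h))\<^sup>2"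
      by (rule norm_diff_scaleR_square)
    also have "\<dots> \<le> (norm h)\<^sup>2 - 2 * r * (\<delta> * (norm h)\<^sup>2) + r\<^sup>2 * (K * norm h)\<^sup>2"
      using coercive[OF that] K(2)[OF that] \<open>0 < r\<close> unfolding inner_eq
      by (intro add_mono diff_mono mult_left_mono power_mono) auto
    also have "\<dots> = (1 - 2 * (r * \<delta>) + r\<^sup>2 * K\<^sup>2) * (norm h)\<^sup>2"
      by (simp add: algebra_simps power_mult_distrib)
    also have "1 - 2 * (r * \<delta>) + r\<^sup>2 * K\<^sup>2 = 1 - \<delta>\<^sup>2 / K\<^sup>2"
      using \<open>0 < K\<close> by (simp add: r_def field_simps power2_eq_square)
    also have "\<dots> = q\<^sup>2" using ratio by (simp add: q_def)
    finally have "(norm (h - r *\<^sub>R (c *\<^sub>C T h)))\<^sup>2 \<le> (q * norm h)\<^sup>2"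
      by (simp add: power_mult_distrib)
    then show ?thesis by (rule power2_le_imp_le) (use q in simp)
  qed
  show ?thesis
  proof (rule boundedly_invertibleI[OF H T _ below])
    fix g assume g: "g \<in> H"
    let ?F = "\<lambda>h. h - r *\<^sub>R (c *\<^sub>C (T h - g))"
    have "\<exists>!h\<in>H. ?F h = h"
    proof (rule Banach_fix[OF csubspace_complete[OF H] _ q])
      show "?F ` H \<subseteq> H"
        using g by (auto intro!: csubspace_diff[OF H] csubspace_scaleC[OF H] csubspace_scaleR[OF H]
            bounded_op_in[OF H T])
      fix x y assume xy: "x \<in> H" "y \<in> H"
      have "?F x - ?F y = (x - y) - r *\<^sub>R (c *\<^sub>C T (x - y))"
        by (simp add: bounded_op_diff[OF H T] xy scaleC_diff_right algebra_simps)
      then show "dist (?F x) (?F y) \<le> q * dist x y"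
        unfolding dist_norm using contraction[OF csubspace_diff[OF H xy]] by (simp only:)
    qed (use g in auto)
    then obtain h where h: "h \<in> H" "?F h = h" by blast
    then have "c *\<^sub>C (T h - g) = 0" using \<open>0 < r\<close> by simp
    then have "inverse c *\<^sub>C c *\<^sub>C (T h - g) = 0" by simp
    then have "T h - g = 0" unfolding scaleC_scaleC using \<open>c \<noteq> 0\<close> by simp
    with h(1) show "\<exists>h\<in>H. T h = g" by auto
  qed
qed

section \<open>Square roots of positive operators\<close>

lemma tendsto_scaleC:
  "(f \<longlongrightarrow> x) F \<Longrightarrow> ((\<lambda>i. c *\<^sub>C f i) \<longlongrightarrow> c *\<^sub>C (x :: 'a::complex_inner)) F"
  by (rule bounded_linear.tendsto[of "\<lambda>x. c *\<^sub>C x"],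
      rule bounded_linear_intro[of _ "cmod c"])
    (simp_all add: scaleC_add_right norm_scaleC scaleR_conv_scaleC scaleC_scaleC mult.commute)

lemma positive_semidefiniteD:
  assumes "positive_semidefinite K A"
  shows "bounded_op K K A" "x \<in> K \<Longrightarrow> y \<in> K \<Longrightarrow> cinner (A x) y = cinner x (A y)"
    "x \<in> K \<Longrightarrow> 0 \<le> Re (cinner (A x) x)"
  using assms by (auto simp: positive_semidefinite_def selfadjoint_def)

text \<open>
  The form \<open>\<langle>A x, y\<rangle>\<close> is a semi-inner product, so it obeys a Cauchy-Schwarz inequality;
  applied to \<open>x\<close> and \<open>A x\<close> this gives \<open>norm (A x)^2 \<le> M \<langle>A x, x\<rangle>\<close>.
  Here it is read off from \<open>0 \<le> \<langle>A (x - A x / M), x - A x / M\<rangle>\<close>.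
\<close>

lemma positive_semidefinite_norm_le:
  assumes K: "closed_csubspace K" and A: "positive_semidefinite K A"
    and "0 < M" and M: "\<forall>x\<in>K. norm (A x) \<le> M * norm x" and x: "x \<in> K"
  shows "(norm (A x))\<^sup>2 \<le> M * inner (A x) x"
proof -
  note A' = positive_semidefiniteD[OF A]
  have Ax: "A x \<in> K" "A (A x) \<in> K" by (simp_all add: bounded_op_in[OF K A'(1)] x)
  let ?y = "x - (1 / M) *\<^sub>R A x"
  have y: "?y \<in> K" by (simp add: csubspace_diff[OF K] csubspace_scaleR[OF K] x Ax)
  have sym: "inner (A u) v = inner u (A v)" if "u \<in> K" "v \<in> K" for u v
    using arg_cong[OF A'(2)[OF that], of Re] by (simp add: Re_cinner)
  have Ay: "A ?y = A x - (1 / M) *\<^sub>R A (A x)"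
    by (simp add: bounded_op_diff[OF K A'(1)] bounded_op_scaleR[OF K A'(1)] csubspace_scaleR[OF K]
        x Ax)
  have "inner (A ?y) ?y
      = inner (A x) x - 2 / M * (norm (A x))\<^sup>2 + (1 / M)\<^sup>2 * inner (A (A x)) (A x)"
    using sym[OF Ax(1) x] unfolding power2_norm_eq_inner Ay
    by (simp add: inner_diff_left inner_diff_right power2_eq_square algebra_simps)
  moreover have "0 \<le> inner (A ?y) ?y"
    using A'(3)[OF y] by (simp add: Re_cinner)
  moreover have "inner (A (A x)) (A x) \<le> M * (norm (A x))\<^sup>2"
  proof -
    have "inner (A (A x)) (A x) \<le> norm (A (A x)) * norm (A x)" by (rule norm_cauchy_schwarz)
    also have "\<dots> \<le> (M * norm (A x)) * norm (A x)" by (intro mult_right_mono M[rule_format] Ax) auto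
    finally show ?thesis by (simp add: power2_eq_square)
  qed
  then have "(1 / M)\<^sup>2 * inner (A (A x)) (A x) \<le> (1 / M)\<^sup>2 * (M * (norm (A x))\<^sup>2)"
    by (intro mult_left_mono) auto
  then have "(1 / M)\<^sup>2 * inner (A (A x)) (A x) \<le> 1 / M * (norm (A x))\<^sup>2"
    using \<open>0 < M\<close> by (simp add: power2_eq_square)
  ultimately have "1 / M * (norm (A x))\<^sup>2 \<le> inner (A x) x" by (simp add: algebra_simps)
  then show ?thesis using \<open>0 < M\<close> by (simp add: field_simps)
qed

text \<open>
  The scalar model of the iteration for the square root: \<open>1 - sqrt (1 - b)\<close> is the limit of
  \<open>y := (b + y^2) / 2\<close> started at \<open>0\<close>, here with the extremal value \<open>b = 1\<close>.
\<close>

primrec sqrt_majorant :: "nat \<Rightarrow> real" where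
  "sqrt_majorant 0 = 0"
| "sqrt_majorant (Suc m) = (1 + (sqrt_majorant m)\<^sup>2) / 2"

lemma sqrt_majorant_bounds: "0 \<le> sqrt_majorant m" "sqrt_majorant m \<le> 1"
proof (induction m)
  case (Suc m)
  show "0 \<le> sqrt_majorant (Suc m)" by simp
  have "(sqrt_majorant m)\<^sup>2 \<le> 1" using Suc by (simp add: power_le_one)
  then show "sqrt_majorant (Suc m) \<le> 1" by simp
qed auto

lemma sqrt_majorant_incseq: "incseq sqrt_majorant"
proof (rule incseq_SucI)
  fix m
  have "0 \<le> (1 - sqrt_majorant m)\<^sup>2" by simp
  then show "sqrt_majorant m \<le> sqrt_majorant (Suc m)" by (simp add: power2_diff)
qed

primrec sqrt_iterate :: "('a \<Rightarrow> 'a::real_vector) \<Rightarrow> nat \<Rightarrow> 'a \<Rightarrow> 'a" where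
  "sqrt_iterate B 0 x = 0"
| "sqrt_iterate B (Suc m) x = (1 / 2) *\<^sub>R (B x + sqrt_iterate B m (sqrt_iterate B m x))"

text \<open>
  For a selfadjoint contraction \<open>B\<close> the operator iteration \<open>Y := (B + Y^2) / 2\<close> is dominated by
  the scalar one: since \<open>Y'^2 - Y^2 = Y' (Y' - Y) + (Y' - Y) Y\<close>, the norms of the increments are
  at most the scalar increments. Hence it converges in norm, to a \<open>Z\<close> with \<open>(1 - Z)^2 = 1 - B\<close>.
\<close>

lemma sqrt_iterate:
  assumes K: "closed_csubspace K" and B: "selfadjoint K B"
    and contr: "\<forall>x\<in>K. norm (B x) \<le> norm x"
  shows sqrt_iterate_selfadjoint: "selfadjoint K (sqrt_iterate B m)"
    and sqrt_iterate_norm: "x \<in> K \<Longrightarrow> norm (sqrt_iterate B m x) \<le> sqrt_majorant m * norm x"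
    and sqrt_iterate_increment: "x \<in> K \<Longrightarrow> norm (sqrt_iterate B (Suc m) x - sqrt_iterate B m x)
      \<le> (sqrt_majorant (Suc m) - sqrt_majorant m) * norm x"
proof -
  note B' = selfadjointD[OF B]
  let ?Y = "sqrt_iterate B" and ?y = sqrt_majorant
  have both: "selfadjoint K (?Y m) \<and> (\<forall>x\<in>K. norm (?Y m x) \<le> ?y m * norm x)" for m
  proof (induction m)
    case 0
    show ?case by (auto simp: selfadjoint_def csubspace_zero[OF K] intro!: bounded_opI[where M = 0])
  next
    case (Suc m)
    then have Y: "selfadjoint K (?Y m)" and norm_Y: "\<And>x. x \<in> K \<Longrightarrow> norm (?Y m x) \<le> ?y m * norm x"
      by auto
    note Y' = selfadjointD[OF Y]
    have mem: "?Y m x \<in> K" "B x \<in> K" if "x \<in> K" for x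
      by (auto intro: bounded_op_in[OF K Y'(1)] bounded_op_in[OF K B'(1)] that)
    have norm_Suc: "norm (?Y (Suc m) x) \<le> ?y (Suc m) * norm x" if x: "x \<in> K" for x
    proof -
      have "norm (?Y m (?Y m x)) \<le> ?y m * norm (?Y m x)" by (rule norm_Y) (rule mem x)+
      also have "\<dots> \<le> ?y m * (?y m * norm x)"
        by (intro mult_left_mono norm_Y x sqrt_majorant_bounds)
      finally have "norm (?Y m (?Y m x)) \<le> (?y m)\<^sup>2 * norm x" by (simp add: power2_eq_square)
      then have "norm (B x + ?Y m (?Y m x)) \<le> norm x + (?y m)\<^sup>2 * norm x"
        by (intro norm_triangle_le add_mono contr[rule_format] x)
      then show ?thesis
        by (simp only: sqrt_iterate.simps sqrt_majorant.simps norm_scaleR) (simp add: algebra_simps)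
    qed
    have eq: "?Y (Suc m) = (\<lambda>x. complex_of_real (1/2) *\<^sub>C B x + complex_of_real (1/2) *\<^sub>C ?Y m (?Y m x))"
      by (rule ext) (simp only: sqrt_iterate.simps scaleR_add_right scaleC_of_real)
    have "bounded_op K K (?Y (Suc m))"
      unfolding eq by (rule bounded_op_lincomb[OF K K B'(1) bounded_op_compose[OF K K Y'(1) Y'(1)]])
    moreover have "cinner (?Y (Suc m) x) z = cinner x (?Y (Suc m) z)" if "x \<in> K" "z \<in> K" for x z
      unfolding eq by (simp add: cinner_add_left cinner_add_right cinner_scaleC_left
          cinner_scaleC_right B'(2) Y'(2) that mem)
    ultimately have "selfadjoint K (?Y (Suc m))" by (simp add: selfadjoint_def)
    with norm_Suc show ?case by blast
  qed
  then show "selfadjoint K (?Y m)" "x \<in> K \<Longrightarrow> norm (?Y m x) \<le> ?y m * norm x" by auto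
  have Y: "bounded_op K K (?Y m)" and norm_Y: "x \<in> K \<Longrightarrow> norm (?Y m x) \<le> ?y m * norm x" for m x
    using both[of m] by (auto simp: selfadjoint_def)
  have mem: "?Y m x \<in> K" if "x \<in> K" for m x
    by (rule bounded_op_in[OF K Y that])
  show "x \<in> K \<Longrightarrow> norm (?Y (Suc m) x - ?Y m x) \<le> (?y (Suc m) - ?y m) * norm x"
  proof (induction m arbitrary: x)
    case 0
    then show ?case using contr by simp
  next
    case (Suc m)
    let ?d = "\<lambda>x. ?Y (Suc m) x - ?Y m x" and ?e = "?y (Suc m) - ?y m"
    have d: "?d x \<in> K" by (intro csubspace_diff[OF K] mem Suc.prems)
    have "?e \<ge> 0" using incseq_SucD[OF sqrt_majorant_incseq] by simp
    have "?Y (Suc m) (?d x) + ?d (?Y m x)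
        = ?Y (Suc m) (?Y (Suc m) x) - ?Y m (?Y m x)"
      by (simp only: bounded_op_diff[OF K Y] mem Suc.prems) simp
    then have "?Y (Suc (Suc m)) x - ?Y (Suc m) x = (1/2) *\<^sub>R (?Y (Suc m) (?d x) + ?d (?Y m x))"
      by (subst (1 2) sqrt_iterate.simps(2))
        (simp only: scaleR_add_right scaleR_diff_right add_diff_cancel_left)
    then have "norm (?Y (Suc (Suc m)) x - ?Y (Suc m) x) = norm (?Y (Suc m) (?d x) + ?d (?Y m x)) / 2"
      by (simp only: norm_scaleR)
    also have "\<dots> \<le> (?y (Suc m) * (?e * norm x) + ?e * (?y m * norm x)) / 2"
    proof (intro divide_right_mono norm_triangle_le add_mono)
      show "norm (?Y (Suc m) (?d x)) \<le> ?y (Suc m) * (?e * norm x)"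
        using norm_Y[OF d] mult_left_mono[OF Suc.IH[OF Suc.prems] sqrt_majorant_bounds(1)]
        by (rule order_trans)
      show "norm (?d (?Y m x)) \<le> ?e * (?y m * norm x)"
        using Suc.IH[OF mem[OF Suc.prems]] mult_left_mono[OF norm_Y[OF Suc.prems] \<open>?e \<ge> 0\<close>]
        by (rule order_trans)
    qed simp
    also have "\<dots> = ((?y (Suc m))\<^sup>2 - (?y m)\<^sup>2) / 2 * norm x"
      by (simp add: power2_eq_square field_simps del: sqrt_majorant.simps)
    also have "((?y (Suc m))\<^sup>2 - (?y m)\<^sup>2) / 2 = ?y (Suc (Suc m)) - ?y (Suc m)"
      by (subst (2 3) sqrt_majorant.simps(2)) (simp only: diff_divide_distrib[symmetric], simp)
    finally show ?case .
  qed
qed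

lemma sqrt_iterate_difference:
  assumes K: "closed_csubspace K" and B: "selfadjoint K B"
    and contr: "\<forall>x\<in>K. norm (B x) \<le> norm x" and x: "x \<in> K" and "m \<le> n"
  shows "norm (sqrt_iterate B n x - sqrt_iterate B m x)
    \<le> (sqrt_majorant n - sqrt_majorant m) * norm x"
  using \<open>m \<le> n\<close>
proof (induction n rule: dec_induct)
  case (step n)
  have "sqrt_iterate B (Suc n) x - sqrt_iterate B m x
      = (sqrt_iterate B (Suc n) x - sqrt_iterate B n x) + (sqrt_iterate B n x - sqrt_iterate B m x)"
    by simp
  also have "norm \<dots> \<le> (sqrt_majorant (Suc n) - sqrt_majorant n) * norm x
      + (sqrt_majorant n - sqrt_majorant m) * norm x"
    by (intro norm_triangle_le add_mono sqrt_iterate_increment[OF K B contr x] step.IH)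
  finally show ?case by (simp only: algebra_simps)
qed simp

text \<open>
  If \<open>M\<close> bounds \<open>A\<close>, then \<open>B = 1 - A / M\<close> is a contraction, and the limit \<open>Z\<close> of the iteration
  for \<open>B\<close> gives the root \<open>sqrt M (1 - Z)\<close>.
\<close>

lemma positive_semidefinite_sqrt:
  fixes K :: "'a::complex_hilbert_space set"
  assumes K: "closed_csubspace K" and A: "positive_semidefinite K A"
  obtains S where "selfadjoint K S" "\<And>x. x \<in> K \<Longrightarrow> S (S x) = A x"
proof -
  note A' = positive_semidefiniteD[OF A]
  obtain M where M: "0 < M" "\<And>x. x \<in> K \<Longrightarrow> norm (A x) \<le> M * norm x"
    by (rule bounded_op_bound[OF K A'(1)]) blast
  define B where "B = (\<lambda>x. 1 *\<^sub>C x + complex_of_real (- (1 / M)) *\<^sub>C A x)"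
  have id: "bounded_op K K (\<lambda>x. x)" by (rule bounded_opI[where M = 1]) auto
  have "bounded_op K K B"
    unfolding B_def by (rule bounded_op_lincomb[OF K K id A'(1)])
  then have B: "selfadjoint K B"
    by (auto simp: selfadjoint_def B_def cinner_add_left cinner_add_right cinner_scaleC_left
        cinner_scaleC_right A'(2))
  have B_eq: "B x = x - (1 / M) *\<^sub>R A x" for x
    by (simp only: B_def scaleC_of_real) simp
  have contr: "\<forall>x\<in>K. norm (B x) \<le> norm x"
  proof
    fix x assume that: "x \<in> K"
    have "(norm (B x))\<^sup>2 = (norm x)\<^sup>2 - 2 / M * inner (A x) x + (1 / M)\<^sup>2 * (norm (A x))\<^sup>2"
      unfolding B_eq by (subst norm_diff_scaleR_square) simp
    also have "\<dots> \<le> (norm x)\<^sup>2 - 2 / M * inner (A x) x + (1 / M)\<^sup>2 * (M * inner (A x) x)"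
      using positive_semidefinite_norm_le[OF K A M(1) _ that] M(2) by (intro add_mono mult_left_mono) auto
    also have "\<dots> = (norm x)\<^sup>2 - 1 / M * inner (A x) x"
      using M(1) by (simp add: power2_eq_square field_simps)
    also have "\<dots> \<le> (norm x)\<^sup>2"
      using A'(3)[OF that] M(1) by (simp add: Re_cinner)
    finally show "norm (B x) \<le> norm x" by (rule power2_le_imp_le) simp
  qed
  let ?Y = "sqrt_iterate B"
  note Y = selfadjointD[OF sqrt_iterate_selfadjoint[OF K B contr]]
  have mem: "?Y m x \<in> K" if "x \<in> K" for m x
    by (rule bounded_op_in[OF K Y(1) that])
  have norm_Y: "norm (?Y m x) \<le> norm x" if "x \<in> K" for m x
    using sqrt_iterate_norm[OF K B contr that, of m]
      mult_right_mono[OF sqrt_majorant_bounds(2)[of m] norm_ge_zero[of x]] by simp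
  have "convergent (\<lambda>m. ?Y m x)" if x: "x \<in> K" for x
  proof -
    have conv: "convergent (\<lambda>m. sqrt_majorant m * norm x)"
      using incseq_convergent[OF sqrt_majorant_incseq, of 1] sqrt_majorant_bounds(2)
      by (metis convergent_def tendsto_mult_right)
    have "Cauchy (\<lambda>m. ?Y m x)"
      unfolding Cauchy_altdef2
    proof (intro allI impI)
      fix e :: real assume "e > 0"
      with convergent_Cauchy[OF conv] obtain N
        where N: "\<forall>n\<ge>N. dist (sqrt_majorant n * norm x) (sqrt_majorant N * norm x) < e"
        unfolding Cauchy_altdef2 by blast
      have "dist (?Y n x) (?Y N x) < e" if "n \<ge> N" for n
        using sqrt_iterate_difference[OF K B contr x that] N[rule_format, OF that]
        by (simp add: dist_norm algebra_simps)
      then show "\<exists>N. \<forall>n\<ge>N. dist (?Y n x) (?Y N x) < e" by blast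
    qed
    then show ?thesis by (rule Cauchy_convergent)
  qed
  then obtain Z where Z: "(\<lambda>m. ?Y m x) \<longlonglongrightarrow> Z x" if "x \<in> K" for x
    unfolding convergent_def by metis
  have Z_mem: "Z x \<in> K" if "x \<in> K" for x
    by (rule closed_sequentially[OF csubspace_closed[OF K] mem[OF that] Z[OF that]])
  have Z_op: "bounded_op K K Z"
  proof (rule bounded_opI)
    show "Z (x + y) = Z x + Z y" if "x \<in> K" "y \<in> K" for x y
    proof (rule LIMSEQ_unique[OF Z])
      show "(\<lambda>m. ?Y m (x + y)) \<longlonglongrightarrow> Z x + Z y"
        by (simp only: bounded_op_add[OF K Y(1)] that) (intro tendsto_add Z that)
    qed (simp add: csubspace_add[OF K] that)
    show "Z (c *\<^sub>C x) = c *\<^sub>C Z x" if "x \<in> K" for c x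
    proof (rule LIMSEQ_unique[OF Z])
      show "(\<lambda>m. ?Y m (c *\<^sub>C x)) \<longlonglongrightarrow> c *\<^sub>C Z x"
        by (simp only: bounded_op_scaleC[OF K Y(1)] that) (intro tendsto_scaleC Z that)
    qed (simp add: csubspace_scaleC[OF K] that)
    show "norm (Z x) \<le> 1 * norm x" if "x \<in> K" for x
      using LIMSEQ_le_const2[OF tendsto_norm[OF Z[OF that]], of "norm x"] norm_Y[OF that] by auto
  qed (rule Z_mem)
  have Z_sym: "inner (Z x) y = inner x (Z y)" if "x \<in> K" "y \<in> K" for x y
  proof (rule LIMSEQ_unique)
    show "(\<lambda>m. inner (?Y m x) y) \<longlonglongrightarrow> inner (Z x) y"
      by (intro tendsto_inner Z tendsto_const that)
    have "inner (?Y m x) y = inner x (?Y m y)" for m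
      using arg_cong[OF Y(2)[OF that], of Re] by (simp add: Re_cinner)
    then show "(\<lambda>m. inner (?Y m x) y) \<longlonglongrightarrow> inner x (Z y)"
      by (simp, intro tendsto_inner Z tendsto_const that)
  qed
  have Z_cinner: "cinner (Z x) y = cinner x (Z y)" if "x \<in> K" "y \<in> K" for x y
    by (rule complex_eqI)
      (simp_all add: Re_cinner Im_cinner Z_sym that csubspace_scaleC[OF K]
        bounded_op_scaleC[OF K Z_op])
  have Z_eq: "2 *\<^sub>R Z x = B x + Z (Z x)" if x: "x \<in> K" for x
  proof (rule LIMSEQ_unique)
    show "(\<lambda>m. 2 *\<^sub>R ?Y (Suc m) x) \<longlonglongrightarrow> 2 *\<^sub>R Z x"
      by (intro tendsto_intros LIMSEQ_Suc[OF Z[OF x]])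
    have "(\<lambda>m. ?Y m (?Y m x - Z x)) \<longlonglongrightarrow> 0"
    proof (rule tendsto_norm_zero_cancel, rule tendsto_sandwich[OF _ _ tendsto_const])
      show "\<forall>\<^sub>F m in sequentially. norm (?Y m (?Y m x - Z x)) \<le> norm (?Y m x - Z x)"
        by (intro always_eventually allI norm_Y csubspace_diff[OF K] mem Z_mem x)
      show "(\<lambda>m. norm (?Y m x - Z x)) \<longlonglongrightarrow> 0"
        by (intro tendsto_norm_zero LIM_zero Z x)
    qed simp
    then have "(\<lambda>m. ?Y m (?Y m x - Z x) + ?Y m (Z x)) \<longlonglongrightarrow> 0 + Z (Z x)"
      by (intro tendsto_add Z Z_mem x)
    then have "(\<lambda>m. ?Y m (?Y m x)) \<longlonglongrightarrow> Z (Z x)"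
      by (simp add: bounded_op_diff[OF K Y(1)] mem Z_mem x)
    then have "(\<lambda>m. B x + ?Y m (?Y m x)) \<longlonglongrightarrow> B x + Z (Z x)"
      by (intro tendsto_intros)
    then show "(\<lambda>m. 2 *\<^sub>R ?Y (Suc m) x) \<longlonglongrightarrow> B x + Z (Z x)" by simp
  qed
  define S where "S = (\<lambda>x. complex_of_real (sqrt M) *\<^sub>C x + complex_of_real (- sqrt M) *\<^sub>C Z x)"
  have S_eq: "S x = sqrt M *\<^sub>R (x - Z x)" for x
    by (simp only: S_def scaleC_of_real scaleR_diff_right scaleR_minus_left) simp
  show ?thesis
  proof (rule that)
    have "bounded_op K K S"
      unfolding S_def by (rule bounded_op_lincomb[OF K K id Z_op])
    then show "selfadjoint K S"
      by (auto simp: selfadjoint_def S_def cinner_add_left cinner_add_right cinner_scaleC_left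
          cinner_scaleC_right Z_cinner)
    fix x assume x: "x \<in> K"
    have "Z (S x) = sqrt M *\<^sub>R (Z x - Z (Z x))"
      by (simp add: S_eq bounded_op_scaleR[OF K Z_op] bounded_op_diff[OF K Z_op] x Z_mem
          csubspace_diff[OF K])
    then have "S (S x) = sqrt M *\<^sub>R (sqrt M *\<^sub>R (x - Z x) - sqrt M *\<^sub>R (Z x - Z (Z x)))"
      by (simp only: S_eq)
    also have "\<dots> = (sqrt M * sqrt M) *\<^sub>R (x - 2 *\<^sub>R Z x + Z (Z x))"
      by (simp add: scaleR_2 algebra_simps)
    also have "\<dots> = M *\<^sub>R (x - B x)" using M(1) by (simp add: Z_eq[OF x])
    also have "\<dots> = A x" using M(1) by (simp add: B_eq)
    finally show "S (S x) = A x" .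
  qed
qed

section \<open>Isometries of the space of square-summable sequences\<close>

text \<open>
  The isometries \<open>ell2_embed j\<close> have pairwise orthogonal ranges: \<open>ell2_embed j\<close> writes a sequence
  into the positions \<open>prod_encode (j, n)\<close>. They turn finite orthogonal sums of copies of
  the sequence space into subspaces of it.
\<close>

lemma strict_mono_prod_encode: "strict_mono (\<lambda>n. prod_encode (j, n))"
  by (simp add: strict_mono_Suc_iff prod_encode_def)

lemma fst_prod_decode_neq: "m \<notin> range (\<lambda>n. prod_encode (j, n)) \<Longrightarrow> fst (prod_decode m) \<noteq> j"
  by (metis prod.collapse prod_decode_inverse rangeI)

lift_definition ell2_embed :: "nat \<Rightarrow> 'a::real_inner ell2 \<Rightarrow> 'a ell2"
  is "\<lambda>j f m. if fst (prod_decode m) = j then f (snd (prod_decode m)) else 0"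
proof -
  fix j and f :: "nat \<Rightarrow> 'a" assume f: "summable (\<lambda>n. (norm (f n))\<^sup>2)"
  let ?g = "\<lambda>m. (norm (if fst (prod_decode m) = j then f (snd (prod_decode m)) else 0))\<^sup>2"
  have "summable (\<lambda>n. ?g (prod_encode (j, n))) \<longleftrightarrow> summable ?g"
    by (rule summable_mono_reindex[OF strict_mono_prod_encode]) (auto dest: fst_prod_decode_neq)
  with f show "summable ?g" by simp
qed

lemma cinner_ell2_embed:
  fixes f g :: "'a::complex_inner ell2"
  shows "cinner (ell2_embed i f) (ell2_embed j g) = (if i = j then cinner f g else 0)"
proof (cases "i = j")
  case True
  let ?h = "\<lambda>m. cinner (ell2_nth (ell2_embed j f) m) (ell2_nth (ell2_embed j g) m)"
  have "(\<Sum>n. ?h (prod_encode (j, n))) = (\<Sum>m. ?h m)"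
    by (rule suminf_mono_reindex[OF strict_mono_prod_encode])
      (auto dest: fst_prod_decode_neq simp: ell2_embed.rep_eq)
  then show ?thesis
    using True by (simp add: cinner_ell2_def ell2_embed.rep_eq)
next
  case False
  then have "cinner (ell2_nth (ell2_embed i f) m) (ell2_nth (ell2_embed j g) m) = 0" for m
    by (simp add: ell2_embed.rep_eq)
  with False show ?thesis by (simp add: cinner_ell2_def)
qed

lemma ell2_embed_add: "ell2_embed j (f + g) = ell2_embed j f + ell2_embed j g"
  by (rule ell2_eqI) (simp add: ell2_embed.rep_eq plus_ell2.rep_eq)

lemma ell2_embed_scaleC:
  "ell2_embed j (c *\<^sub>C f) = c *\<^sub>C ell2_embed j (f :: 'a::complex_inner ell2)"
  by (rule ell2_eqI) (simp add: ell2_embed.rep_eq scaleC_ell2.rep_eq)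

lift_definition ell2_single :: "'a::real_inner \<Rightarrow> 'a ell2"
  is "\<lambda>x n. if n = 0 then x else 0"
  by (rule summable_finite[of "{0}"]) auto

lemma cinner_ell2_single: "cinner (ell2_single x) (ell2_single y) = cinner x (y :: 'a::complex_inner)"
  unfolding cinner_ell2_def by (subst suminf_finite[of "{0}"]) (auto simp: ell2_single.rep_eq)

lemma ell2_single_add: "ell2_single (x + y) = ell2_single x + ell2_single y"
  by (rule ell2_eqI) (simp add: ell2_single.rep_eq plus_ell2.rep_eq)

lemma ell2_single_scaleC: "ell2_single (c *\<^sub>C x) = c *\<^sub>C ell2_single (x :: 'a::complex_inner)"
  by (rule ell2_eqI) (simp add: ell2_single.rep_eq scaleC_ell2.rep_eq)

definition isometry :: "('a::complex_hilbert_space \<Rightarrow> 'b::complex_hilbert_space) \<Rightarrow> bool"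
  where "isometry T \<longleftrightarrow> (\<forall>x y. T (x + y) = T x + T y) \<and> (\<forall>c x. T (c *\<^sub>C x) = c *\<^sub>C T x) \<and>
    (\<forall>x y. cinner (T x) (T y) = cinner x y)"

lemma isometry_cinner: "isometry T \<Longrightarrow> cinner (T x) (T y) = cinner x y"
  by (simp add: isometry_def)

lemma isometry_norm: "isometry T \<Longrightarrow> norm (T x) = norm x"
  by (simp add: isometry_def norm_eq_sqrt_inner flip: Re_cinner)

lemma isometry_bounded_op: "isometry T \<Longrightarrow> bounded_op UNIV UNIV T"
  by (rule bounded_opI[where M = 1]) (auto simp: isometry_norm, auto simp: isometry_def)

lemma isometry_inj: "isometry T \<Longrightarrow> inj T"
proof (rule injI)
  fix x y assume T: "isometry T" and eq: "T x = T y"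
  have "norm (x - y) = norm (T (x - y))" by (simp add: isometry_norm[OF T])
  also have "\<dots> = 0"
    by (simp add: bounded_op_diff[OF closed_csubspace_UNIV isometry_bounded_op[OF T]] eq)
  finally show "x = y" by simp
qed

lemma isometry_of_power:
  obtains T :: "('a::complex_hilbert_space ell2) ^ 'n \<Rightarrow> 'a ell2" where "isometry T"
proof -
  obtain i :: "'n \<Rightarrow> nat" where i: "inj i"
    using finite_imp_inj_to_nat_seg[OF finite_class.finite_UNIV] by blast
  let ?T = "\<lambda>x :: ('a ell2) ^ 'n. \<Sum>k\<in>UNIV. ell2_embed (i k) (x $ k)"
  have "isometry ?T"
    unfolding isometry_def
  proof (intro conjI allI)
    fix x y :: "('a ell2) ^ 'n" and c
    show "?T (x + y) = ?T x + ?T y"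
      by (simp add: ell2_embed_add sum.distrib)
    show "?T (c *\<^sub>C x) = c *\<^sub>C ?T x"
      by (simp add: scaleC_vec_def ell2_embed_scaleC scaleC_sum_right)
    show "cinner (?T x) (?T y) = cinner x y"
      using i by (simp add: cinner_sum_left cinner_sum_right cinner_ell2_embed cinner_vec_def
          inj_eq if_distrib cong: if_cong)
  qed
  then show ?thesis by (rule that)
qed

lemma isometry_of_sum:
  obtains T :: "'u::complex_hilbert_space \<times> ('u \<times> 'h::complex_hilbert_space) ell2 \<Rightarrow> ('u \<times> 'h) ell2"
  where "isometry T"
proof -
  let ?T = "\<lambda>x :: 'u \<times> ('u \<times> 'h) ell2.
    ell2_embed 0 (ell2_single (fst x, 0)) + ell2_embed 1 (snd x)"
  have "isometry ?T"
    unfolding isometry_def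
  proof (intro conjI allI)
    fix x y :: "'u \<times> ('u \<times> 'h) ell2" and c
    have "ell2_single (fst (x + y), 0 :: 'h) = ell2_single (fst x, 0) + ell2_single (fst y, 0)"
      by (simp flip: ell2_single_add)
    then show "?T (x + y) = ?T x + ?T y"
      by (simp add: ell2_embed_add)
    have "ell2_single (fst (c *\<^sub>C x), 0 :: 'h) = c *\<^sub>C ell2_single (fst x, 0)"
      by (simp add: scaleC_prod_def flip: ell2_single_scaleC)
    then show "?T (c *\<^sub>C x) = c *\<^sub>C ?T x"
      by (simp add: ell2_embed_scaleC scaleC_add_right) (simp add: scaleC_prod_def ell2_embed_scaleC)
    show "cinner (?T x) (?T y) = cinner x y"
      by (simp add: cinner_add_left cinner_add_right cinner_ell2_embed cinner_ell2_single)
        (simp add: cinner_prod_def)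
  qed
  then show ?thesis by (rule that)
qed

section \<open>Schur complements of operator pencils\<close>

lemma norm_fst_snd_le: "norm (fst x) \<le> norm x" "norm (snd x) \<le> norm x"
  using norm_fst_le[of "fst x" "snd x"] norm_snd_le[of "snd x" "fst x"] by simp_all

lemma bounded_op_fst: "bounded_op (K \<times> L) K fst"
  by (rule bounded_opI[where M = 1]) (auto simp: scaleC_prod_def norm_fst_snd_le)

lemma bounded_op_snd: "bounded_op (K \<times> L) L snd"
  by (rule bounded_opI[where M = 1]) (auto simp: scaleC_prod_def norm_fst_snd_le)

lemma bounded_op_Pair:
  assumes K: "closed_csubspace K" and S: "bounded_op K L S" and T: "bounded_op K J T"
  shows "bounded_op K (L \<times> J) (\<lambda>x. (S x, T x))"
proof -
  obtain M where M: "0 < M" "\<And>x. x \<in> K \<Longrightarrow> norm (S x) \<le> M * norm x"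
    by (rule bounded_op_bound[OF K S]) blast
  obtain M' where M': "0 < M'" "\<And>x. x \<in> K \<Longrightarrow> norm (T x) \<le> M' * norm x"
    by (rule bounded_op_bound[OF K T]) blast
  show ?thesis
  proof (rule bounded_opI)
    fix x assume x: "x \<in> K"
    have "norm (S x, T x) \<le> norm (S x) + norm (T x)"
      by (simp add: norm_Pair sqrt_sum_squares_le_sum)
    also have "\<dots> \<le> M * norm x + M' * norm x" by (intro add_mono M M' x)
    finally show "norm (S x, T x) \<le> (M + M') * norm x" by (simp add: algebra_simps)
  qed (simp_all add: bounded_op_in[OF K S] bounded_op_in[OF K T] bounded_op_add[OF K S]
      bounded_op_add[OF K T] bounded_op_scaleC[OF K S] bounded_op_scaleC[OF K T] scaleC_prod_def)
qed

lemma bounded_op_ident: "bounded_op K K (\<lambda>x. x)"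
  by (rule bounded_opI[where M = 1]) auto

lemma bounded_op_const_zero: "closed_csubspace L \<Longrightarrow> bounded_op K L (\<lambda>_. 0)"
  by (rule bounded_opI[where M = 0]) (auto simp: csubspace_zero)

lemma bounded_op_minus_op:
  "closed_csubspace K \<Longrightarrow> closed_csubspace L \<Longrightarrow> bounded_op K L S \<Longrightarrow> bounded_op K L T \<Longrightarrow>
    bounded_op K L (\<lambda>x. S x - T x)"
  using bounded_op_lincomb[of K L S T 1 "- 1"] by (simp add: scaleC_minus_one)

lemma pencil_add_left: "pencil A (z + w) x = pencil A z x + pencil A w x"
  by (simp add: pencil_def scaleC_add_left sum.distrib)

lemma pencil_diff_left: "pencil A (z - w) x = pencil A z x - pencil A w x"
  by (simp add: pencil_def scaleC_diff_left sum_subtractf)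

lemma pencil_scaleC_left: "pencil A (c *s z) x = c *\<^sub>C pencil A z x"
  by (simp add: pencil_def scaleC_sum_right scaleC_scaleC)

text \<open>
  With \<open>d = state_block A z\<close>, the map \<open>schur_row\<close> is the block row \<open>(1, - b d\<^sup>-\<^sup>1)\<close>, which
  annihilates the second block column of \<open>A z\<close>, and \<open>schur_vector\<close> is the block column with
  the entries \<open>1\<close> and \<open>- d\<^sup>-\<^sup>1 c\<close>, which is annihilated by the second block row of \<open>A z\<close>.
  Hence the Schur complement can be read off from \<open>A z (u, h)\<close> for any \<open>h\<close> by applying
  \<open>schur_row\<close>, and \<open>A z\<close> maps \<open>schur_vector\<close> to the Schur complement with second entry \<open>0\<close>.
\<close>

definition state_block ::
    "('n::finite \<Rightarrow> 'u::complex_hilbert_space \<times> 'v::complex_hilbert_space \<Rightarrow> 'u \<times> 'v) \<Rightarrow>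
      complex ^ 'n \<Rightarrow> 'v \<Rightarrow> 'v"
  where "state_block A z h = snd (pencil A z (0, h))"

definition schur_row ::
    "'v::complex_hilbert_space set \<Rightarrow> ('n::finite \<Rightarrow> 'u::complex_hilbert_space \<times> 'v \<Rightarrow> 'u \<times> 'v) \<Rightarrow>
      complex ^ 'n \<Rightarrow> 'u \<times> 'v \<Rightarrow> 'u"
  where "schur_row H A z y = fst y - fst (pencil A z (0, inv_into H (state_block A z) (snd y)))"

definition schur_vector ::
    "'v::complex_hilbert_space set \<Rightarrow> ('n::finite \<Rightarrow> 'u::complex_hilbert_space \<times> 'v \<Rightarrow> 'u \<times> 'v) \<Rightarrow>
      complex ^ 'n \<Rightarrow> 'u \<Rightarrow> 'u \<times> 'v"
  where "schur_vector H A z u = (u, - inv_into H (state_block A z) (snd (pencil A z (u, 0))))"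

definition schur_complement ::
    "'v::complex_hilbert_space set \<Rightarrow> ('n::finite \<Rightarrow> 'u::complex_hilbert_space \<times> 'v \<Rightarrow> 'u \<times> 'v) \<Rightarrow>
      complex ^ 'n \<Rightarrow> 'u \<Rightarrow> 'u"
  where "schur_complement H A z u = schur_row H A z (pencil A z (u, 0))"

lemma bessmertnyi_iff:
  fixes f :: "complex ^ 'n \<Rightarrow> 'u::complex_hilbert_space \<Rightarrow>\<^sub>L 'u"
  shows "f \<in> bessmertnyi TYPE('v::complex_hilbert_space) \<longleftrightarrow> f holomorphic_op_on Omega \<and>
    (\<exists>(H :: 'v set) A. closed_csubspace H \<and> (\<forall>k. positive_semidefinite (UNIV \<times> H) (A k)) \<and>
      (\<forall>z\<in>Omega. boundedly_invertible H (state_block A z) \<and>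
        (\<forall>u. blinfun_apply (f z) u = schur_complement H A z u)))"
  unfolding bessmertnyi_def state_block_def[abs_def] schur_complement_def schur_row_def Let_def
  by simp

lemma bounded_op_state_embed: "closed_csubspace H \<Longrightarrow> bounded_op H (UNIV \<times> H) (\<lambda>h. (0, h))"
  by (intro bounded_op_Pair bounded_op_ident bounded_op_const_zero closed_csubspace_UNIV)

lemma bounded_op_input_embed: "closed_csubspace H \<Longrightarrow> bounded_op UNIV (UNIV \<times> H) (\<lambda>u. (u, 0))"
  by (intro bounded_op_Pair bounded_op_ident bounded_op_const_zero closed_csubspace_UNIV)

context
  fixes H :: "'v::complex_hilbert_space set"
    and A :: "'n::finite \<Rightarrow> 'u::complex_hilbert_space \<times> 'v \<Rightarrow> 'u \<times> 'v"
  assumes H: "closed_csubspace H" and A: "\<forall>k. bounded_op (UNIV \<times> H) (UNIV \<times> H) (A k)"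
begin

private lemma K: "closed_csubspace (UNIV \<times> H :: ('u \<times> 'v) set)"
  by (intro closed_csubspace_Times closed_csubspace_UNIV H)

lemma pencil_bound:
  obtains C where "0 < C"
    "\<And>z x. x \<in> UNIV \<times> H \<Longrightarrow> norm (pencil A z x) \<le> C * norm z * norm x"
proof -
  have "\<exists>M>0. \<forall>x\<in>UNIV \<times> H. norm (A k x) \<le> M * norm x" for k
    using bounded_op_bound[OF K A[rule_format], of k] by metis
  then obtain M where M: "\<And>k. 0 < M k" "\<And>k x. x \<in> UNIV \<times> H \<Longrightarrow> norm (A k x) \<le> M k * norm x"
    by metis
  show ?thesis
  proof (rule that)
    show "0 < (\<Sum>k\<in>UNIV. M k)" by (intro sum_pos M) auto
    fix z :: "complex ^ 'n" and x :: "'u \<times> 'v" assume x: "x \<in> UNIV \<times> H"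
    have "norm (pencil A z x) \<le> (\<Sum>k\<in>UNIV. cmod (z $ k) * norm (A k x))"
      unfolding pencil_def by (rule order_trans[OF norm_sum]) (simp add: norm_scaleC)
    also have "\<dots> \<le> (\<Sum>k\<in>UNIV. norm z * (M k * norm x))"
      using M(2)[OF x] by (intro sum_mono mult_mono Finite_Cartesian_Product.norm_nth_le) auto
    finally show "norm (pencil A z x) \<le> (\<Sum>k\<in>UNIV. M k) * norm z * norm x"
      by (simp add: sum_distrib_left sum_distrib_right mult_ac)
  qed
qed

lemma pencil_bounded_op: "bounded_op (UNIV \<times> H) (UNIV \<times> H) (pencil A z)"
proof -
  obtain C where C: "0 < C"
    "\<And>z x. x \<in> UNIV \<times> H \<Longrightarrow> norm (pencil A z x) \<le> C * norm z * norm x"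
    by (rule pencil_bound) blast
  show ?thesis
  proof (rule bounded_opI)
    show "pencil A z x \<in> UNIV \<times> H" if "x \<in> UNIV \<times> H" for x
      unfolding pencil_def
      by (intro csubspace_sum[OF K] csubspace_scaleC[OF K] bounded_op_in[OF K A[rule_format]] that)
    show "pencil A z (x + y) = pencil A z x + pencil A z y" if "x \<in> UNIV \<times> H" "y \<in> UNIV \<times> H" for x y
      by (simp only: pencil_def bounded_op_add[OF K A[rule_format]] that scaleC_add_right sum.distrib)
    show "pencil A z (c *\<^sub>C x) = c *\<^sub>C pencil A z x" if "x \<in> UNIV \<times> H" for c x
      by (simp only: pencil_def bounded_op_scaleC[OF K A[rule_format]] that scaleC_sum_right
          scaleC_scaleC mult.commute)
  qed (rule C)
qed

lemma state_block_bounded_op: "bounded_op H H (state_block A z)"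
  unfolding state_block_def[abs_def]
  by (intro bounded_op_compose[OF H K _ bounded_op_snd]
      bounded_op_compose[OF H K bounded_op_state_embed[OF H] pencil_bounded_op])

context
  fixes z :: "complex ^ 'n"
  assumes inv: "boundedly_invertible H (state_block A z)"
begin

lemma schur_row_bounded_op: "bounded_op (UNIV \<times> H) UNIV (schur_row H A z)"
  unfolding schur_row_def[abs_def]
  by (intro bounded_op_minus_op K closed_csubspace_UNIV bounded_op_fst
      bounded_op_compose[OF K K _ bounded_op_fst] bounded_op_compose[OF K K _ pencil_bounded_op]
      bounded_op_compose[OF K H _ bounded_op_state_embed[OF H]]
      bounded_op_compose[OF K H bounded_op_snd boundedly_invertibleD(2)[OF inv]])

lemma schur_row_input: "schur_row H A z (v, 0) = v"
  using bounded_op_zero[OF H boundedly_invertibleD(2)[OF inv]] bounded_op_zero[OF K pencil_bounded_op]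
  by (simp add: schur_row_def flip: zero_prod_def)

lemma schur_row_pencil:
  assumes "h \<in> H"
  shows "schur_row H A z (pencil A z (u, h)) = schur_complement H A z u"
proof -
  have mem: "(u, 0) \<in> UNIV \<times> H" "(0, h) \<in> UNIV \<times> H"
    using assms csubspace_zero[OF H] by auto
  have "pencil A z (u, h) = pencil A z (u, 0) + pencil A z (0, h)"
    using bounded_op_add[OF K pencil_bounded_op mem] by simp
  then have "schur_row H A z (pencil A z (u, h))
      = schur_complement H A z u + schur_row H A z (pencil A z (0, h))"
    using bounded_op_add[OF K schur_row_bounded_op bounded_op_in[OF K pencil_bounded_op mem(1)]
        bounded_op_in[OF K pencil_bounded_op mem(2)]]
    by (simp add: schur_complement_def)
  also have "schur_row H A z (pencil A z (0, h)) = 0"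
    using boundedly_invertibleD(4)[OF inv assms] by (simp add: schur_row_def state_block_def)
  finally show ?thesis by simp
qed

lemma schur_vector_bounded_op: "bounded_op UNIV (UNIV \<times> H) (schur_vector H A z)"
proof -
  have "bounded_op UNIV H (\<lambda>u. inv_into H (state_block A z) (snd (pencil A z (u, 0))))"
    by (intro bounded_op_compose[OF closed_csubspace_UNIV H _ boundedly_invertibleD(2)[OF inv]]
        bounded_op_compose[OF closed_csubspace_UNIV K _ bounded_op_snd]
        bounded_op_compose[OF closed_csubspace_UNIV K bounded_op_input_embed[OF H] pencil_bounded_op])
  from bounded_op_minus_op[OF closed_csubspace_UNIV H bounded_op_const_zero[OF H] this]
  show ?thesis
    unfolding schur_vector_def[abs_def]
    by (intro bounded_op_Pair closed_csubspace_UNIV bounded_op_ident) simp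
qed

lemma pencil_schur_vector: "pencil A z (schur_vector H A z u) = (schur_complement H A z u, 0)"
proof -
  let ?h = "inv_into H (state_block A z) (snd (pencil A z (u, 0)))"
  have c: "snd (pencil A z (u, 0)) \<in> H"
    using bounded_op_in[OF K pencil_bounded_op, of "(u, 0)" z] csubspace_zero[OF H]
    by (auto simp: mem_Times_iff)
  have h: "?h \<in> H" "- ?h \<in> H"
    using bounded_op_in[OF H boundedly_invertibleD(2)[OF inv] c] csubspace_minus[OF H] by auto
  have "pencil A z (u, - ?h) = pencil A z (u, 0) - pencil A z (0, ?h)"
    using bounded_op_diff[OF K pencil_bounded_op, of "(u, 0)" "(0, ?h)" z] h csubspace_zero[OF H]
    by simp
  then have "snd (pencil A z (schur_vector H A z u)) = 0"
    using boundedly_invertibleD(3)[OF inv c] by (simp add: schur_vector_def state_block_def)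
  then have eq: "pencil A z (schur_vector H A z u) = (fst (pencil A z (schur_vector H A z u)), 0)"
    by (metis prod.collapse)
  have "schur_row H A z (pencil A z (schur_vector H A z u)) = schur_complement H A z u"
    unfolding schur_vector_def by (rule schur_row_pencil[OF h(2)])
  then show ?thesis by (metis eq schur_row_input)
qed

end

end

section \<open>Transfer functions of selfadjoint unitary colligations\<close>

definition diag_scale :: "complex ^ 'n \<Rightarrow> 'v::complex_hilbert_space ^ 'n \<Rightarrow> 'v ^ 'n"
  where "diag_scale z x = (\<chi> k. (z $ k) *\<^sub>C (x $ k))"

lemma norm_diag_scale_le:
  assumes "\<And>k. cmod (z $ k) \<le> r"
  shows "norm (diag_scale z x) \<le> r * norm (x :: 'v::complex_hilbert_space ^ 'n)"
proof -
  have "0 \<le> r" using assms norm_ge_zero order_trans by blast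
  have "norm (diag_scale z x) \<le> L2_set (\<lambda>k. r * norm (x $ k)) UNIV"
    unfolding norm_vec_def diag_scale_def
    by (rule L2_set_mono) (auto simp: norm_scaleC intro: mult_right_mono assms)
  also have "\<dots> = r * norm x"
    unfolding norm_vec_def by (rule L2_set_right_distrib[symmetric, OF \<open>0 \<le> r\<close>])
  finally show ?thesis .
qed

lemma diag_scale_diff: "diag_scale z (x - y) = diag_scale z x - diag_scale z y"
  by (simp add: diag_scale_def vec_eq_iff scaleC_diff_right)

lemma component_proj_sum:
  "(\<Sum>k\<in>UNIV. (w $ k) *\<^sub>C component_proj k x) = diag_scale w (x :: 'v::complex_hilbert_space ^ 'n)"
proof -
  have "(\<Sum>k\<in>UNIV. (w $ k) *\<^sub>C (if j = k then x $ k else 0)) = (w $ j) *\<^sub>C (x $ j)" for j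
    by (simp add: if_distrib cong: if_cong)
  then show ?thesis
    by (simp add: vec_eq_iff diag_scale_def component_proj_def scaleC_vec_def)
qed

lemma closed_csubspace_orthogonal_sum:
  assumes "\<forall>k. closed_csubspace (X k)"
  shows "closed_csubspace (orthogonal_sum X)"
proof -
  have "orthogonal_sum X = (\<Inter>k. (\<lambda>x. x $ k) -` X k)"
    by (auto simp: orthogonal_sum_def)
  moreover have "closed ((\<lambda>x. x $ k) -` X k)" for k
    using assms by (intro closed_vimage continuous_intros) (auto simp: csubspace_closed)
  ultimately have "closed (orthogonal_sum X)" by auto
  with assms show ?thesis
    by (auto simp: closed_csubspace_def orthogonal_sum_def scaleC_vec_def)
qed

text \<open>
  The state \<open>\<xi>\<close> solving \<open>\<xi> = A P(w) \<xi> + B e\<close> exists because \<open>A\<close> is a contraction and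
  \<open>P(w)\<close> a strict one.
\<close>

lemma transfer_function_solution:
  fixes X :: "'n::finite \<Rightarrow> 'v::complex_hilbert_space set"
    and U :: "('v ^ 'n) \<times> 'u::complex_hilbert_space \<Rightarrow> ('v ^ 'n) \<times> 'u"
  assumes col: "agler_unitary_colligation X U" and w: "w \<in> polydisc"
  obtains \<xi> where "\<xi> \<in> orthogonal_sum X"
    "U (diag_scale w \<xi>, e) = (\<xi>, transfer_function X U w e)"
proof -
  have sub: "\<forall>k. closed_csubspace (X k)" and U: "unitary (orthogonal_sum X \<times> UNIV) U"
    using col by (auto simp: agler_unitary_colligation_def)
  note X = closed_csubspace_orthogonal_sum[OF sub]
  have K: "closed_csubspace (orthogonal_sum X \<times> UNIV :: (('v ^ 'n) \<times> 'u) set)"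
    by (intro closed_csubspace_Times X closed_csubspace_UNIV)
  have U_op: "bounded_op (orthogonal_sum X \<times> UNIV) (orthogonal_sum X \<times> UNIV) U"
    using U by (simp add: unitary_def)
  define r where "r = Max (range (\<lambda>k. cmod (w $ k)))"
  have r: "cmod (w $ k) \<le> r" for k
    by (simp add: r_def)
  have "r \<in> range (\<lambda>k. cmod (w $ k))" unfolding r_def by (rule Max_in) auto
  then have r01: "0 \<le> r" "r < 1" using w by (auto simp: polydisc_def)
  have P_in: "diag_scale w x \<in> orthogonal_sum X" if "x \<in> orthogonal_sum X" for x
    using that sub by (auto simp: orthogonal_sum_def diag_scale_def csubspace_scaleC)
  have mem: "(diag_scale w x, u) \<in> orthogonal_sum X \<times> UNIV" if "x \<in> orthogonal_sum X" for x and u :: 'u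
    using P_in[OF that] by simp
  have mem0: "(0, u) \<in> orthogonal_sum X \<times> UNIV" for u :: 'u
    using csubspace_zero[OF X] by simp
  define S where "S x = x - fst (U (diag_scale w x, 0))" for x
  let ?B = "fst (U (0, e))"
  have "\<exists>!x\<in>orthogonal_sum X. fst (U (diag_scale w x, 0)) + ?B = x"
  proof (rule Banach_fix[OF csubspace_complete[OF X] _ r01])
    show "(\<lambda>x. fst (U (diag_scale w x, 0)) + ?B) ` orthogonal_sum X \<subseteq> orthogonal_sum X"
      using bounded_op_in[OF K U_op mem] bounded_op_in[OF K U_op mem0]
      by (auto intro!: csubspace_add[OF X] simp: mem_Times_iff)
    fix x y assume xy: "x \<in> orthogonal_sum X" "y \<in> orthogonal_sum X"
    have "U (diag_scale w x, 0) - U (diag_scale w y, 0) = U (diag_scale w (x - y), 0)"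
      using bounded_op_diff[OF K U_op mem[OF xy(1)] mem[OF xy(2)], of 0 0]
      by (simp add: diag_scale_diff)
    from arg_cong[OF this, of fst]
    have "fst (U (diag_scale w x, 0)) - fst (U (diag_scale w y, 0))
        = fst (U (diag_scale w (x - y), 0))"
      by (simp only: fst_diff)
    then have "norm (fst (U (diag_scale w x, 0)) - fst (U (diag_scale w y, 0)))
        \<le> norm (U (diag_scale w (x - y), 0))"
      by (simp only: norm_fst_snd_le)
    also have "\<dots> = norm (diag_scale w (x - y))"
      using unitary_norm[OF U mem[OF csubspace_diff[OF X xy]]] by (simp add: norm_Pair)
    also have "\<dots> \<le> r * norm (x - y)" by (rule norm_diag_scale_le) (rule r)
    finally show "dist (fst (U (diag_scale w x, 0)) + ?B) (fst (U (diag_scale w y, 0)) + ?B)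
        \<le> r * dist x y"
      by (simp add: dist_norm)
  qed (use csubspace_zero[OF X] in auto)
  then obtain x where "x \<in> orthogonal_sum X" "fst (U (diag_scale w x, 0)) + ?B = x" by blast
  then have B: "?B \<in> S ` orthogonal_sum X"
    by (intro image_eqI[of _ _ x]) (auto simp: S_def algebra_simps)
  define \<xi> where "\<xi> = inv_into (orthogonal_sum X) S ?B"
  have \<xi>: "\<xi> \<in> orthogonal_sum X" "S \<xi> = ?B"
    unfolding \<xi>_def by (rule inv_into_into[OF B], rule f_inv_into_f[OF B])
  have "U (diag_scale w \<xi>, e) = U (diag_scale w \<xi>, 0) + U (0, e)"
    using bounded_op_add[OF K U_op mem[OF \<xi>(1)] mem0, of 0 e] by simp
  moreover have "transfer_function X U w e = snd (U (0, e)) + snd (U (diag_scale w \<xi>, 0))"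
    by (simp add: transfer_function_def Let_def component_proj_sum \<xi>_def S_def[abs_def])
  ultimately have "U (diag_scale w \<xi>, e) = (\<xi>, transfer_function X U w e)"
    using \<xi>(2) by (auto simp: S_def prod_eq_iff algebra_simps)
  with \<xi>(1) show ?thesis by (rule that)
qed

lemma cayley_Re_pos:
  assumes "cmod w < 1"
  shows "0 < Re ((1 + w) / (1 - w))"
proof -
  have "(cmod w)\<^sup>2 < 1" using assms by (simp add: power_less_one_iff abs_square_less_1)
  then have "(Re w)\<^sup>2 + (Im w)\<^sup>2 < 1" by (simp only: cmod_power2)
  then have "0 < Re ((1 + w) * cnj (1 - w))"
    by (simp add: algebra_simps power2_eq_square)
  then show ?thesis by (simp only: Re_complex_div_gt_0)
qed

definition cayley_point :: "complex ^ 'n \<Rightarrow> complex ^ 'n"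
  where "cayley_point w = (\<chi> k. (1 + w $ k) / (1 - w $ k))"

lemma cayley_point_Omega:
  assumes "w \<in> polydisc"
  shows "cayley_point w \<in> Omega"
proof -
  have "cayley_point w $ k \<in> (\<lambda>\<zeta>. 1 * \<zeta>) ` right_halfplane" for k
    using assms cayley_Re_pos[of "w $ k"]
    by (auto simp: cayley_point_def polydisc_def right_halfplane_def)
  then show ?thesis unfolding Omega_def by (intro UN_I[of 1]) auto
qed

text \<open>
  Let \<open>A k\<close> be the Gram operators of \<open>G\<close>, and suppose that \<open>U\<close> maps
  \<open>(q - p, v + u)\<close> to \<open>(q + p, v - u)\<close> where \<open>(p, u)\<close> is a limit of pairs \<open>(G \<kappa>, fst \<kappa>)\<close>
  and \<open>G* q = (v, 0)\<close>. A state \<open>\<xi>\<close> of the colligation at \<open>w\<close> has \<open>\<xi> = q + p\<close> and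
  \<open>P(w) \<xi> = q - p\<close>, so that \<open>q = z p\<close> componentwise with the Cayley transform \<open>z\<close> of \<open>w\<close>.
  Then \<open>(v, 0) = G* z p\<close> is the limit of \<open>G* z G \<kappa> = A(z) \<kappa>\<close>, which says \<open>v = f(z) u\<close>:
  the input \<open>v + u\<close> of the colligation is \<open>(f(z) + 1) u\<close> and its output \<open>v - u\<close> is
  \<open>(f(z) - 1) u\<close>. In the two conditions on \<open>U\<close>, and in the
  proof, all these vectors appear multiplied by \<open>2\<close>.
\<close>

lemma transfer_function_eq_double_cayley:
  fixes X :: "'n::finite \<Rightarrow> 'x::complex_hilbert_space set"
    and U :: "('x ^ 'n) \<times> 'u::complex_hilbert_space \<Rightarrow> ('x ^ 'n) \<times> 'u"
    and G :: "'u \<times> 'v::complex_hilbert_space \<Rightarrow> 'x ^ 'n"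
    and f :: "complex ^ 'n \<Rightarrow> 'u \<Rightarrow>\<^sub>L 'u"
  assumes H: "closed_csubspace H" and A: "\<forall>k. bounded_op (UNIV \<times> H) (UNIV \<times> H) (A k)"
    and G: "bounded_op (UNIV \<times> H) (orthogonal_sum X) G"
    and gram: "\<And>k x y. x \<in> UNIV \<times> H \<Longrightarrow> y \<in> UNIV \<times> H \<Longrightarrow>
      cinner (A k x) y = cinner (G x $ k) (G y $ k)"
    and col: "agler_unitary_colligation X U"
    and minus_space: "\<And>x e x' y. x \<in> orthogonal_sum X \<Longrightarrow> U (x, e) = (x', y) \<Longrightarrow>
      (x' - x, e - y) \<in> closure ((\<lambda>\<kappa>. (G \<kappa>, fst \<kappa>)) ` (UNIV \<times> H))"
    and plus_space: "\<And>x e x' y \<kappa>. x \<in> orthogonal_sum X \<Longrightarrow> U (x, e) = (x', y) \<Longrightarrow> \<kappa> \<in> UNIV \<times> H \<Longrightarrow>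
      cinner (x' + x) (G \<kappa>) = cinner (e + y) (fst \<kappa>)"
    and rep: "\<forall>z\<in>Omega. boundedly_invertible H (state_block A z) \<and>
      (\<forall>u. blinfun_apply (f z) u = schur_complement H A z u)"
    and w: "w \<in> polydisc"
  shows "double_cayley f w = transfer_function X U w"
    and "bij (\<lambda>u. blinfun_apply (f (cayley_point w)) u + u)"
proof -
  let ?K = "UNIV \<times> H :: ('u \<times> 'v) set"
  let ?z = "cayley_point w" and ?S = "transfer_function X U w"
  let ?F = "blinfun_apply (f ?z)"
  have K: "closed_csubspace ?K"
    by (intro closed_csubspace_Times closed_csubspace_UNIV H)
  note pencil = pencil_bounded_op[OF H A]
  have inv: "boundedly_invertible H (state_block A ?z)"
    and F: "?F u = schur_complement H A ?z u" for u
    using rep cayley_point_Omega[OF w] by auto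
  have pencil_gram: "cinner (pencil A ?z x) y = cinner (diag_scale ?z (G x)) (G y)"
    if "x \<in> ?K" "y \<in> ?K" for x y
    by (simp only: pencil_def cinner_sum_left cinner_scaleC_left gram[OF that] cinner_vec_def
        diag_scale_def vec_lambda_beta)
  have solution: "?F (e - ?S e) = e + ?S e" for e
  proof (rule ccontr)
    assume neq: "?F (e - ?S e) \<noteq> e + ?S e"
    obtain \<xi> where \<xi>: "\<xi> \<in> orthogonal_sum X" "U (diag_scale w \<xi>, e) = (\<xi>, ?S e)"
      by (rule transfer_function_solution[OF col w])
    let ?u = "e - ?S e" and ?v = "e + ?S e"
      and ?p = "\<xi> - diag_scale w \<xi>" and ?q = "\<xi> + diag_scale w \<xi>"
    have P\<xi>: "diag_scale w \<xi> \<in> orthogonal_sum X"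
      using \<xi>(1) col by (auto simp: orthogonal_sum_def diag_scale_def agler_unitary_colligation_def
          csubspace_scaleC)
    have q: "?q = diag_scale ?z ?p"
    proof -
      have "(1 + w $ k) *\<^sub>C x = ((1 + w $ k) / (1 - w $ k)) *\<^sub>C (1 - w $ k) *\<^sub>C x" for k and x :: 'x
      proof -
        have "w $ k \<noteq> 1" using w by (auto simp: polydisc_def) (metis norm_one less_irrefl)
        then show ?thesis by (simp add: scaleC_scaleC)
      qed
      then show ?thesis
        by (simp add: vec_eq_iff diag_scale_def cayley_point_def scaleC_add_left scaleC_diff_left)
    qed
    obtain Mg where Mg: "0 < Mg" "\<And>x. x \<in> ?K \<Longrightarrow> norm (G x) \<le> Mg * norm x"
      by (rule bounded_op_bound[OF K G]) blast
    obtain Mr where Mr: "0 < Mr" "\<And>x. x \<in> ?K \<Longrightarrow> norm (schur_row H A ?z x) \<le> Mr * norm x"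
      by (rule bounded_op_bound[OF K schur_row_bounded_op[OF H A inv]]) blast
    define C where "C = norm (f ?z) + Mr * (norm ?z * Mg) + 1"
    have "0 < C" using Mg(1) Mr(1) by (simp add: C_def add_nonneg_pos)
    (* For \<kappa> within \<epsilon> of (p, u), the vector A(z) \<kappa> is within a multiple of \<epsilon> of (v, 0). This is
       tested against the difference itself; schur_row then turns it into F (fst \<kappa>) near v. *)
    have bound: "norm (?F ?u - ?v) \<le> C * \<epsilon>" if "0 < \<epsilon>" for \<epsilon>
    proof -
      have "(?p, ?u) \<in> closure ((\<lambda>\<kappa>. (G \<kappa>, fst \<kappa>)) ` ?K)"
        using minus_space[OF P\<xi> \<xi>(2)] .
      then obtain \<kappa> where \<kappa>: "\<kappa> \<in> ?K" and close: "dist (G \<kappa>, fst \<kappa>) (?p, ?u) < \<epsilon>"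
        using \<open>0 < \<epsilon>\<close> unfolding closure_approachable by blast
      let ?s = "pencil A ?z \<kappa> - (?v, 0)"
      have v: "(?v, 0) \<in> ?K" using csubspace_zero[OF H] by simp
      have s: "?s \<in> ?K" by (intro csubspace_diff[OF K] bounded_op_in[OF K pencil] \<kappa> v)
      have dist_p: "norm (G \<kappa> - ?p) \<le> \<epsilon>" and dist_u: "norm (fst \<kappa> - ?u) \<le> \<epsilon>"
        using close norm_fst_snd_le[of "(G \<kappa>, fst \<kappa>) - (?p, ?u)"] by (simp_all add: dist_norm)
      have "cinner ?s t = cinner (diag_scale ?z (G \<kappa> - ?p)) (G t)" if "t \<in> ?K" for t
      proof -
        have "cinner (?v, 0) t = cinner ?v (fst t)" by (simp add: cinner_prod_def)
        also have "\<dots> = cinner ?q (G t)" by (rule plus_space[OF P\<xi> \<xi>(2) that, symmetric])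
        finally show ?thesis
          by (simp only: cinner_diff_left pencil_gram[OF \<kappa> that] q diag_scale_diff)
      qed
      then have "inner ?s ?s = inner (diag_scale ?z (G \<kappa> - ?p)) (G ?s)"
        using s by (simp flip: Re_cinner)
      then have "norm ?s * norm ?s \<le> norm (diag_scale ?z (G \<kappa> - ?p)) * norm (G ?s)"
        using norm_cauchy_schwarz[of "diag_scale ?z (G \<kappa> - ?p)" "G ?s"]
        by (simp only: power2_eq_square[symmetric] power2_norm_eq_inner)
      also have "\<dots> \<le> (norm ?z * \<epsilon>) * (Mg * norm ?s)"
      proof (intro mult_mono Mg s)
        have "norm (diag_scale ?z (G \<kappa> - ?p)) \<le> norm ?z * norm (G \<kappa> - ?p)"
          by (rule norm_diag_scale_le) (rule Finite_Cartesian_Product.norm_nth_le)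
        also have "\<dots> \<le> norm ?z * \<epsilon>" by (intro mult_left_mono dist_p) auto
        finally show "norm (diag_scale ?z (G \<kappa> - ?p)) \<le> norm ?z * \<epsilon>" .
      qed (use \<open>0 < \<epsilon>\<close> in auto)
      finally have "norm ?s * norm ?s \<le> (norm ?z * Mg * \<epsilon>) * norm ?s" by (simp add: mult_ac)
      then have norm_s: "norm ?s \<le> norm ?z * Mg * \<epsilon>"
        using Mg(1) \<open>0 < \<epsilon>\<close> by (cases "norm ?s = 0") auto
      have "?F (fst \<kappa>) = schur_row H A ?z (pencil A ?z (fst \<kappa>, snd \<kappa>))"
        unfolding F using \<kappa> by (intro schur_row_pencil[OF H A inv, symmetric]) auto
      then have "?F (fst \<kappa>) - ?v = schur_row H A ?z ?s"
        using bounded_op_diff[OF K schur_row_bounded_op[OF H A inv] bounded_op_in[OF K pencil \<kappa>] v]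
        by (simp add: schur_row_input[OF H A inv])
      then have "norm (?F (fst \<kappa>) - ?v) \<le> Mr * (norm ?z * Mg * \<epsilon>)"
        using order_trans[OF Mr(2)[OF s] mult_left_mono[OF norm_s less_imp_le[OF Mr(1)]]]
        by (simp only:)
      moreover have "norm (?F ?u - ?F (fst \<kappa>)) \<le> norm (f ?z) * \<epsilon>"
      proof -
        have "norm (?F ?u - ?F (fst \<kappa>)) \<le> norm (f ?z) * norm (?u - fst \<kappa>)"
          by (simp only: blinfun.diff_right[symmetric] norm_blinfun)
        also have "\<dots> \<le> norm (f ?z) * \<epsilon>"
          using dist_u by (intro mult_left_mono) (simp_all add: norm_minus_commute)
        finally show ?thesis .
      qed
      ultimately have "norm ((?F ?u - ?F (fst \<kappa>)) + (?F (fst \<kappa>) - ?v))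
          \<le> norm (f ?z) * \<epsilon> + Mr * (norm ?z * Mg * \<epsilon>)"
        by (intro norm_triangle_le) linarith
      moreover have "(?F ?u - ?F (fst \<kappa>)) + (?F (fst \<kappa>) - ?v) = ?F ?u - ?v" by simp
      ultimately have "norm (?F ?u - ?v) \<le> norm (f ?z) * \<epsilon> + Mr * (norm ?z * Mg * \<epsilon>)"
        by (simp only:)
      also have "\<dots> \<le> C * \<epsilon>" using \<open>0 < \<epsilon>\<close> by (simp add: C_def algebra_simps)
      finally show ?thesis .
    qed
    let ?n = "norm (?F ?u - ?v)"
    have "0 < ?n" using neq by simp
    then have "?n \<le> C * (?n / (2 * C))" using \<open>0 < C\<close> by (intro bound) simp
    also have "\<dots> = ?n / 2" using \<open>0 < C\<close> by simp
    finally show False using \<open>0 < ?n\<close> by simp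
  qed
  (* F is accretive, because \<langle>F u, u\<rangle> = \<Sum> z_k norm (G \<kappa>)_k^2 with Re z_k > 0. *)
  have inj: "inj (\<lambda>u. ?F u + u)"
  proof (rule injI)
    fix x y assume "?F x + x = ?F y + y"
    then have eq: "?F (x - y) = - (x - y)" by (simp add: blinfun.diff_right algebra_simps)
    let ?\<kappa> = "schur_vector H A ?z (x - y)"
    have \<kappa>: "?\<kappa> \<in> ?K" by (rule bounded_op_in[OF closed_csubspace_UNIV schur_vector_bounded_op[OF H A inv] UNIV_I])
    have "cinner (?F (x - y)) (x - y) = cinner (pencil A ?z ?\<kappa>) ?\<kappa>"
      unfolding pencil_schur_vector[OF H A inv] F by (simp add: cinner_prod_def schur_vector_def)
    also have "\<dots> = (\<Sum>k\<in>UNIV. ?z $ k * complex_of_real ((norm (G ?\<kappa> $ k))\<^sup>2))"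
      by (simp only: pencil_gram[OF \<kappa> \<kappa>] cinner_vec_def diag_scale_def vec_lambda_beta
          cinner_scaleC_left cinner_self)
    also have "Re \<dots> = (\<Sum>k\<in>UNIV. Re (?z $ k) * (norm (G ?\<kappa> $ k))\<^sup>2)" by simp
    also have "\<dots> \<ge> 0"
      using w cayley_Re_pos by (intro sum_nonneg mult_nonneg_nonneg)
        (auto simp: cayley_point_def polydisc_def less_imp_le)
    finally have "norm (x - y) = 0"
      unfolding eq cinner_minus_left cinner_self by simp
    then show "x = y" by simp
  qed
  have half: "?F ((1/2) *\<^sub>R (e - ?S e)) = (1/2) *\<^sub>R (e + ?S e)" for e
    by (simp only: blinfun.scaleR_right solution)
  have plus: "?F ((1/2) *\<^sub>R (e - ?S e)) + (1/2) *\<^sub>R (e - ?S e) = e" for e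
  proof -
    have "?F ((1/2) *\<^sub>R (e - ?S e)) + (1/2) *\<^sub>R (e - ?S e) = (1/2) *\<^sub>R (e + e)"
      unfolding half by (simp add: algebra_simps)
    then show ?thesis by (simp flip: scaleR_2)
  qed
  have minus: "?F ((1/2) *\<^sub>R (e - ?S e)) - (1/2) *\<^sub>R (e - ?S e) = ?S e" for e
  proof -
    have "?F ((1/2) *\<^sub>R (e - ?S e)) - (1/2) *\<^sub>R (e - ?S e) = (1/2) *\<^sub>R (?S e + ?S e)"
      unfolding half by (simp add: algebra_simps)
    then show ?thesis by (simp flip: scaleR_2)
  qed
  show "bij (\<lambda>u. ?F u + u)"
    using inj plus by (intro bijI surjI)
  have "inv_into UNIV (\<lambda>u. ?F u + u) e = (1/2) *\<^sub>R (e - ?S e)" for e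
    by (rule inv_f_eq[OF inj]) (rule plus)
  then show "double_cayley f w = ?S"
    by (rule_tac ext) (simp only: double_cayley_def Let_def cayley_point_def[symmetric] o_def minus)
qed

section \<open>Holomorphy of Schur complements\<close>

text \<open>
  Since \<open>schur_row\<close> at \<open>z\<close> annihilates the second block column of \<open>A z\<close>, and \<open>A z'\<close> maps the
  vector \<open>schur_vector\<close> at \<open>z'\<close> to \<open>(f(z') u, 0)\<close>, the difference \<open>f(z') - f(z)\<close> is the
  product of the row at \<open>z\<close>, of \<open>A (z' - z)\<close>, and of the vector at \<open>z'\<close>. The derivative at \<open>z\<close>
  is obtained by replacing the vector at \<open>z'\<close> by that at \<open>z\<close>; the two differ by
  \<open>O(norm (z' - z))\<close>.
\<close>

lemma schur_complement_holomorphic: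
  fixes H :: "'v::complex_hilbert_space set"
    and A :: "'n::finite \<Rightarrow> 'u::complex_hilbert_space \<times> 'v \<Rightarrow> 'u \<times> 'v"
  assumes H: "closed_csubspace H" and A: "\<forall>k. bounded_op (UNIV \<times> H) (UNIV \<times> H) (A k)"
    and rep: "\<forall>z\<in>S. boundedly_invertible H (state_block A z) \<and>
      (\<forall>u. blinfun_apply (f z) u = schur_complement H A z u)"
  shows "f holomorphic_op_on S"
proof -
  let ?K = "UNIV \<times> H :: ('u \<times> 'v) set"
  let ?L = "schur_row H A" and ?\<psi> = "schur_vector H A"
  have K: "closed_csubspace ?K"
    by (intro closed_csubspace_Times closed_csubspace_UNIV H)
  note P = pencil_bounded_op[OF H A]
  obtain C where C: "0 < C" "\<And>z x. x \<in> ?K \<Longrightarrow> norm (pencil A z x) \<le> C * norm z * norm x"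
    by (rule pencil_bound[OF H A]) blast
  have inv: "boundedly_invertible H (state_block A z)"
    and f: "blinfun_apply (f z) u = schur_complement H A z u" if "z \<in> S" for z u
    using rep that by auto
  note L = schur_row_bounded_op[OF H A inv] and \<psi> = schur_vector_bounded_op[OF H A inv]
  note \<psi>_in = bounded_op_in[OF closed_csubspace_UNIV \<psi> UNIV_I]
  have f_row: "blinfun_apply (f z) u = ?L z (pencil A z (?\<psi> y u))" if "z \<in> S" "y \<in> S" for z y u
    unfolding f[OF that(1)] schur_vector_def
    by (rule schur_row_pencil[OF H A inv[OF that(1)], symmetric])
      (use \<psi>_in[OF that(2), of u] in \<open>simp add: schur_vector_def\<close>)
  have f_col: "pencil A y (?\<psi> y u) = (blinfun_apply (f y) u, 0)" if "y \<in> S" for y u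
    by (simp add: pencil_schur_vector[OF H A inv[OF that]] f[OF that])
  have f_op: "bounded_op UNIV UNIV (blinfun_apply (f z))" if "z \<in> S" for z
  proof -
    have "bounded_op UNIV UNIV (\<lambda>u. ?L z (pencil A z (?\<psi> z u)))"
      by (intro bounded_op_compose[OF closed_csubspace_UNIV K _ L[OF that]]
          bounded_op_compose[OF closed_csubspace_UNIV K \<psi>[OF that] P])
    then show ?thesis by (simp add: f_row[OF that that, symmetric])
  qed
  have "\<exists>D. (f has_derivative D) (at z within S) \<and>
      (\<forall>c h x. blinfun_apply (D (c *s h)) x = c *\<^sub>C blinfun_apply (D h) x)" if z: "z \<in> S" for z
  proof -
    define T where "T h u = ?L z (pencil A h (?\<psi> z u))" for h u
    define D where "D h = Blinfun (T h)" for h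
    have T: "bounded_op UNIV UNIV (T h)" for h
      unfolding T_def by (intro bounded_op_compose[OF closed_csubspace_UNIV K _ L[OF z]]
          bounded_op_compose[OF closed_csubspace_UNIV K \<psi>[OF z] P])
    have D: "blinfun_apply (D h) u = T h u" for h u
      unfolding D_def
      by (simp add: bounded_linear_Blinfun_apply bounded_op_imp_bounded_linear[OF T])
    obtain Mr where Mr: "0 < Mr" "\<And>x. x \<in> ?K \<Longrightarrow> norm (?L z x) \<le> Mr * norm x"
      by (rule bounded_op_bound[OF K L[OF z]]) blast
    obtain M\<psi> where M\<psi>: "0 < M\<psi>" "\<And>u. u \<in> UNIV \<Longrightarrow> norm (?\<psi> z u) \<le> M\<psi> * norm u"
      by (rule bounded_op_bound[OF closed_csubspace_UNIV \<psi>[OF z]]) blast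
    obtain Mi where Mi: "0 < Mi"
      "\<And>h. h \<in> H \<Longrightarrow> norm (inv_into H (state_block A z) h) \<le> Mi * norm h"
      by (rule bounded_op_bound[OF H boundedly_invertibleD(2)[OF inv[OF z]]]) blast
    have row_bound: "norm (?L z (pencil A h x)) \<le> Mr * (C * norm h * norm x)" if "x \<in> ?K" for h x
      using Mr(2)[OF bounded_op_in[OF K P that]] mult_left_mono[OF C(2)[OF that] less_imp_le[OF Mr(1)]]
      by (rule order_trans)
    have T_scale: "T (c *s h) u = c *\<^sub>C T h u" for c h u
      by (simp add: T_def pencil_scaleC_left bounded_op_scaleC[OF K L[OF z]]
          bounded_op_in[OF K P] \<psi>_in[OF z])
    have D_linear: "bounded_linear D"
    proof (rule bounded_linear_intro)
      show "D (x + y) = D x + D y" for x y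
        by (rule blinfun_eqI) (simp add: D blinfun.add_left T_def pencil_add_left
            bounded_op_add[OF K L[OF z] bounded_op_in[OF K P \<psi>_in[OF z]]
              bounded_op_in[OF K P \<psi>_in[OF z]]])
      have "r *\<^sub>R x = complex_of_real r *s x" for r and x :: "complex ^ 'n"
        by (simp add: vec_eq_iff) (simp add: scaleR_conv_of_real)
      then show "D (r *\<^sub>R x) = r *\<^sub>R D x" for r x
        by (intro blinfun_eqI) (simp only: D blinfun.scaleR_left T_scale scaleC_of_real)
      show "norm (D x) \<le> norm x * (Mr * C * M\<psi>)" for x
      proof (rule norm_blinfun_bound)
        show "0 \<le> norm x * (Mr * C * M\<psi>)" using Mr(1) C(1) M\<psi>(1) by simp
        fix u
        have "norm (T x u) \<le> Mr * (C * norm x * norm (?\<psi> z u))"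
          unfolding T_def by (rule row_bound[OF \<psi>_in[OF z]])
        also have "\<dots> \<le> Mr * (C * norm x * (M\<psi> * norm u))"
          using Mr(1) C(1) M\<psi>(2)[of u] by (intro mult_left_mono) auto
        finally show "norm (blinfun_apply (D x) u) \<le> norm x * (Mr * C * M\<psi>) * norm u"
          by (simp add: D mult_ac)
      qed
    qed
    define E where "E = 2 * Mr * C * (Mi * C * M\<psi>)"
    have "0 < E" using Mr(1) C(1) M\<psi>(1) Mi(1) by (simp add: E_def)
    have remainder: "norm (f y - f z - D (y - z)) \<le> E * norm (y - z) * norm (y - z)"
      if y: "y \<in> S" and small: "norm (y - z) \<le> 1 / (2 * Mi * C)" for y
    proof (rule norm_blinfun_bound)
      show "0 \<le> E * norm (y - z) * norm (y - z)" using \<open>0 < E\<close> by simp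
      fix u
      let ?h = "y - z" and ?d = "?\<psi> y u - ?\<psi> z u"
      have d: "?d \<in> ?K" by (rule csubspace_diff[OF K \<psi>_in[OF y] \<psi>_in[OF z]])
      define \<eta> where "\<eta> = snd ?d"
      have \<eta>: "\<eta> \<in> H" "?d = (0, \<eta>)" "norm ?d = norm \<eta>"
        using d by (auto simp: \<eta>_def schur_vector_def norm_Pair mem_Times_iff)
      have "pencil A z ?d = pencil A z (?\<psi> y u) - pencil A z (?\<psi> z u)"
        by (rule bounded_op_diff[OF K P \<psi>_in[OF y] \<psi>_in[OF z]])
      also have "pencil A z (?\<psi> y u) = pencil A y (?\<psi> y u) - pencil A ?h (?\<psi> y u)"
        by (simp add: pencil_diff_left)
      finally have "state_block A z \<eta> = - snd (pencil A ?h (?\<psi> y u))"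
        unfolding \<eta>(2) state_block_def by (simp add: f_col[OF y] f_col[OF z])
      then have "\<eta> = inv_into H (state_block A z) (- snd (pencil A ?h (?\<psi> y u)))"
        by (metis boundedly_invertibleD(4)[OF inv[OF z] \<eta>(1)])
      then have "norm \<eta> \<le> Mi * norm (snd (pencil A ?h (?\<psi> y u)))"
        using Mi(2)[of "- snd (pencil A ?h (?\<psi> y u))"]
          bounded_op_in[OF K P \<psi>_in[OF y, of u], of ?h] csubspace_minus[OF H]
        by (simp add: mem_Times_iff)
      also have "\<dots> \<le> Mi * (C * norm ?h * norm (?\<psi> y u))"
        using norm_fst_snd_le(2) C(2)[OF \<psi>_in[OF y]] Mi(1) by (intro mult_left_mono) (blast intro: order_trans, simp)
      also have "\<dots> \<le> Mi * (C * norm ?h * (M\<psi> * norm u + norm \<eta>))"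
      proof -
        have "norm (?\<psi> y u) \<le> norm (?\<psi> z u) + norm ?d"
          using norm_triangle_ineq[of "?\<psi> z u" ?d] by simp
        also have "\<dots> \<le> M\<psi> * norm u + norm \<eta>" using M\<psi>(2)[of u] by (simp add: \<eta>(3))
        finally show ?thesis using Mi(1) C(1) by (intro mult_left_mono) auto
      qed
      also have "\<dots> = (Mi * C * norm ?h) * (M\<psi> * norm u) + (Mi * C * norm ?h) * norm \<eta>"
        by (simp add: algebra_simps)
      also have "(Mi * C * norm ?h) * norm \<eta> \<le> 1 / 2 * norm \<eta>"
        using small Mi(1) C(1) by (intro mult_right_mono) (auto simp: field_simps)
      finally have "norm \<eta> \<le> 2 * ((Mi * C * norm ?h) * (M\<psi> * norm u))" by simp
      then have norm_d: "norm ?d \<le> 2 * ((Mi * C * norm ?h) * (M\<psi> * norm u))" by (simp only: \<eta>(3))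
      have "blinfun_apply (f y) u - blinfun_apply (f z) u = ?L z (pencil A ?h (?\<psi> y u))"
      proof -
        have "blinfun_apply (f y) u = ?L z (pencil A y (?\<psi> y u))"
          unfolding f_col[OF y] by (rule schur_row_input[OF H A inv[OF z], symmetric])
        moreover have "pencil A y (?\<psi> y u) = pencil A z (?\<psi> y u) + pencil A ?h (?\<psi> y u)"
          by (simp add: pencil_diff_left)
        ultimately show ?thesis
          using bounded_op_add[OF K L[OF z] bounded_op_in[OF K P \<psi>_in[OF y]]
              bounded_op_in[OF K P \<psi>_in[OF y]], of z u ?h u]
          by (simp add: f_row[OF z y])
      qed
      then have "blinfun_apply (f y - f z - D ?h) u = ?L z (pencil A ?h ?d)"
        using bounded_op_diff[OF K P \<psi>_in[OF y] \<psi>_in[OF z], of ?h u u]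
          bounded_op_diff[OF K L[OF z] bounded_op_in[OF K P \<psi>_in[OF y]]
            bounded_op_in[OF K P \<psi>_in[OF z]], of ?h u ?h u]
        by (simp add: blinfun.diff_left D T_def)
      then have "norm (blinfun_apply (f y - f z - D ?h) u) \<le> Mr * (C * norm ?h * norm ?d)"
        using row_bound[OF d, of ?h] by (simp only:)
      also have "\<dots> \<le> Mr * (C * norm ?h * (2 * ((Mi * C * norm ?h) * (M\<psi> * norm u))))"
        using Mr(1) C(1) by (intro mult_left_mono norm_d) auto
      finally show "norm (blinfun_apply (f y - f z - D ?h) u) \<le> E * norm ?h * norm ?h * norm u"
        by (simp add: E_def mult_ac)
    qed
    have "(f has_derivative D) (at z within S)"
      unfolding has_derivative_within_alt
    proof (intro conjI D_linear allI impI)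
      fix e :: real assume "0 < e"
      let ?\<delta> = "min (1 / (2 * Mi * C)) (e / E)"
      have "0 < ?\<delta>" using \<open>0 < e\<close> \<open>0 < E\<close> Mi(1) C(1) by simp
      moreover have "norm (f y - f z - D (y - z)) \<le> e * norm (y - z)"
        if "y \<in> S" "norm (y - z) < ?\<delta>" for y
      proof -
        have "E * norm (y - z) \<le> e" using that(2) \<open>0 < E\<close> by (simp add: field_simps)
        then have "E * norm (y - z) * norm (y - z) \<le> e * norm (y - z)"
          by (rule mult_right_mono) simp
        with remainder[OF that(1)] that(2) show ?thesis by simp
      qed
      ultimately show "\<exists>d>0. \<forall>y\<in>S. norm (y - z) < d \<longrightarrow>
          norm (f y - f z - D (y - z)) \<le> e * norm (y - z)"
        by blast
    qed
    then show ?thesis using T_scale by (intro exI[of _ D]) (simp add: D)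
  qed
  with f_op show ?thesis by (simp add: holomorphic_op_on_def)
qed

section \<open>From Bessmertnyi functions to selfadjoint colligations\<close>

lemma closed_csubspace_closure_image:
  assumes K: "closed_csubspace K" and T: "bounded_op K UNIV T"
  shows "closed_csubspace (closure (T ` K))"
  unfolding closed_csubspace_def
proof (intro conjI ballI allI)
  show "0 \<in> closure (T ` K)"
    using csubspace_zero[OF K] bounded_op_zero[OF K T] by (metis closure_subset image_eqI subsetD)
  fix x y assume x: "x \<in> closure (T ` K)" and "y \<in> closure (T ` K)"
  then obtain f g where "\<forall>n. f n \<in> T ` K" "f \<longlonglongrightarrow> x" "\<forall>n. g n \<in> T ` K" "g \<longlonglongrightarrow> y"
    unfolding closure_sequential by blast
  moreover have "a + b \<in> T ` K" if "a \<in> T ` K" "b \<in> T ` K" for a b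
    using that by (auto simp: bounded_op_add[OF K T, symmetric] intro!: imageI csubspace_add[OF K])
  ultimately have "\<forall>n. f n + g n \<in> T ` K" "(\<lambda>n. f n + g n) \<longlonglongrightarrow> x + y"
    by (blast intro: tendsto_add)+
  then show "x + y \<in> closure (T ` K)"
    unfolding closure_sequential by (intro exI[of _ "\<lambda>n. f n + g n"] conjI)
next
  fix c x assume x: "x \<in> closure (T ` K)"
  then obtain f where "\<forall>n. f n \<in> T ` K" "f \<longlonglongrightarrow> x"
    unfolding closure_sequential by blast
  moreover have "c *\<^sub>C a \<in> T ` K" if "a \<in> T ` K" for a
    using that
    by (auto simp: bounded_op_scaleC[OF K T, symmetric] intro!: imageI csubspace_scaleC[OF K])
  ultimately have "\<forall>n. c *\<^sub>C f n \<in> T ` K" "(\<lambda>n. c *\<^sub>C f n) \<longlonglongrightarrow> c *\<^sub>C x"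
    by (blast intro: tendsto_scaleC)+
  then show "c *\<^sub>C x \<in> closure (T ` K)"
    unfolding closure_sequential by (intro exI[of _ "\<lambda>n. c *\<^sub>C f n"] conjI)
qed simp

definition flip_sign :: "'a::complex_hilbert_space \<times> 'b::complex_hilbert_space \<Rightarrow> 'a \<times> 'b"
  where "flip_sign s = (fst s, - snd s)"

lemma flip_sign_involution: "flip_sign (flip_sign s) = s"
  by (simp add: flip_sign_def)

lemma selfadjoint_flip_sign: "selfadjoint UNIV flip_sign"
proof -
  have "bounded_op UNIV UNIV (flip_sign :: 'a \<times> 'b \<Rightarrow> 'a \<times> 'b)"
    by (rule bounded_opI[where M = 1])
      (auto simp: flip_sign_def scaleC_prod_def norm_prod_def)
  then show ?thesis by (simp add: selfadjoint_def flip_sign_def cinner_prod_def)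
qed

text \<open>
  The reflection \<open>1 - 2 P\<close> in a closed subspace, conjugated by the sign change on the second
  summand, so that \<open>flip_sign\<close> maps its \<open>-1\<close>-eigenspace onto \<open>M\<close>.
\<close>

definition flipped_reflection ::
    "('a::complex_hilbert_space \<times> 'b::complex_hilbert_space) set \<Rightarrow> 'a \<times> 'b \<Rightarrow> 'a \<times> 'b"
  where "flipped_reflection M s = s - 2 *\<^sub>R flip_sign (orthogonal_projection M (flip_sign s))"

lemma flipped_reflection:
  assumes M: "closed_csubspace M"
  shows selfadjoint_flipped_reflection: "selfadjoint UNIV (flipped_reflection M)"
    and flipped_reflection_involution: "flipped_reflection M (flipped_reflection M s) = s"
proof -
  note J = selfadjointD[OF selfadjoint_flip_sign]
  note P = selfadjointD[OF selfadjoint_orthogonal_projection[OF M]]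
  note U = closed_csubspace_UNIV
  let ?J = flip_sign and ?P = "orthogonal_projection M"
  let ?R = "\<lambda>s. ?J (?P (?J s))"
  have R: "bounded_op UNIV UNIV ?R"
    by (intro bounded_op_compose[OF U U _ J(1)] bounded_op_compose[OF U U _ P(1)] J(1))
  have eq: "flipped_reflection M = (\<lambda>s. 1 *\<^sub>C s + complex_of_real (- 2) *\<^sub>C ?R s)"
    by (rule ext) (simp only: flipped_reflection_def scaleC_of_real scaleC_one, simp)
  have "bounded_op UNIV UNIV (flipped_reflection M)"
    unfolding eq by (rule bounded_op_lincomb[OF U U bounded_op_ident R])
  moreover have "cinner (?R s) t = cinner s (?R t)" for s t
    by (simp add: J(2) P(2))
  ultimately show "selfadjoint UNIV (flipped_reflection M)"
    unfolding selfadjoint_def eq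
    by (simp add: cinner_add_left cinner_add_right cinner_scaleC_left cinner_scaleC_right)
  let ?m = "?P (?J s)"
  have "?J (flipped_reflection M s) = ?J s - 2 *\<^sub>R ?m"
    unfolding flipped_reflection_def
    by (simp add: bounded_op_diff[OF U J(1)] bounded_op_scaleR[OF U J(1)] flip_sign_involution)
  then have "?P (?J (flipped_reflection M s)) = - ?m"
    by (simp only: bounded_op_diff[OF U P(1) UNIV_I UNIV_I] bounded_op_scaleR[OF U P(1) UNIV_I]
        orthogonal_projection_idem[OF M orthogonal_projection_in[OF M]]) (simp add: scaleR_2)
  then show "flipped_reflection M (flipped_reflection M s) = s"
    by (simp add: flipped_reflection_def[of M "flipped_reflection M s"] bounded_op_minus[OF U J(1)])
      (simp add: flipped_reflection_def)
qed

lemma bounded_op_vec: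
  fixes T :: "'n::finite \<Rightarrow> 'a::complex_hilbert_space \<Rightarrow> 'b::complex_hilbert_space"
  assumes K: "closed_csubspace K" and T: "\<And>k. bounded_op K UNIV (T k)"
  shows "bounded_op K UNIV (\<lambda>x. \<chi> k. T k x)"
proof -
  have "\<exists>M>0. \<forall>x\<in>K. norm (T k x) \<le> M * norm x" for k
    using bounded_op_bound[OF K T[of k]] by metis
  then obtain M where M: "\<And>k x. x \<in> K \<Longrightarrow> norm (T k x) \<le> M k * norm x"
    by metis
  show ?thesis
  proof (rule bounded_opI)
    fix x assume x: "x \<in> K"
    have "norm (\<chi> k. T k x) \<le> (\<Sum>k\<in>UNIV. norm (T k x))"
      unfolding norm_vec_def by (rule order_trans[OF L2_set_le_sum]) auto
    also have "\<dots> \<le> (\<Sum>k\<in>UNIV. M k * norm x)" by (intro sum_mono M x)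
    finally show "norm (\<chi> k. T k x) \<le> (\<Sum>k\<in>UNIV. M k) * norm x" by (simp add: sum_distrib_right)
  qed (simp_all add: vec_eq_iff scaleC_vec_def bounded_op_add[OF K T] bounded_op_scaleC[OF K T])
qed

lemma orthogonal_sum_UNIV: "orthogonal_sum (\<lambda>_. UNIV) = UNIV"
  by (simp add: orthogonal_sum_def)

text \<open>
  Put \<open>G k = T (sqrt (A k))\<close>, so that \<open>A k\<close> is the Gram operator of \<open>G k\<close>, and let \<open>M\<close> be the
  closure of the space of all pairs \<open>(G \<kappa>, fst \<kappa>)\<close>. The flipped reflection in \<open>M\<close> maps
  \<open>(q - p, v + u)\<close> to \<open>(q + p, v - u)\<close> whenever \<open>(p, u) \<in> M\<close> and \<open>(q, - v)\<close> is orthogonal to \<open>M\<close>.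
  The orthogonality says \<open>G* q = (v, 0)\<close>. The isometry \<open>T\<close> serves to
  embed the space on which the \<open>A k\<close> act into the prescribed state space.
\<close>

lemma bessmertnyi_imp_selfadjoint_colligation:
  fixes H :: "'v::complex_hilbert_space set" and f :: "complex ^ 'n \<Rightarrow> 'u::complex_hilbert_space \<Rightarrow>\<^sub>L 'u"
    and T :: "'u \<times> 'v \<Rightarrow> 'x::complex_hilbert_space"
  assumes H: "closed_csubspace H" and A: "\<forall>k. positive_semidefinite (UNIV \<times> H) (A k)"
    and rep: "\<forall>z\<in>Omega. boundedly_invertible H (state_block A z) \<and>
      (\<forall>u. blinfun_apply (f z) u = schur_complement H A z u)"
    and iso: "isometry T"
  obtains U where "agler_unitary_colligation (\<lambda>_ :: 'n. UNIV :: 'x set) U"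
    "selfadjoint (orthogonal_sum (\<lambda>_ :: 'n. UNIV :: 'x set) \<times> UNIV) U"
    "\<And>w. w \<in> polydisc \<Longrightarrow> double_cayley f w = transfer_function (\<lambda>_. UNIV) U w"
    "\<And>w. w \<in> polydisc \<Longrightarrow> bij (\<lambda>u. blinfun_apply (f (cayley_point w)) u + u)"
proof -
  let ?K = "UNIV \<times> H :: ('u \<times> 'v) set" and ?X = "\<lambda>_ :: 'n. UNIV :: 'x set"
  have K: "closed_csubspace ?K"
    by (intro closed_csubspace_Times closed_csubspace_UNIV H)
  have "\<exists>S. selfadjoint ?K S \<and> (\<forall>x\<in>?K. S (S x) = A k x)" for k
    using positive_semidefinite_sqrt[OF K A[rule_format, of k]] by metis
  then obtain S where S: "\<And>k. selfadjoint ?K (S k)" "\<And>k x. x \<in> ?K \<Longrightarrow> S k (S k x) = A k x"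
    by metis
  note S' = selfadjointD[OF S(1)]
  define G where "G x = (\<chi> k. T (S k x))" for x
  have "bounded_op ?K UNIV G"
    unfolding G_def[abs_def]
    by (intro bounded_op_vec K bounded_op_compose[OF K closed_csubspace_UNIV _ isometry_bounded_op[OF iso]])
      (use S'(1) in \<open>auto simp: bounded_op_def\<close>)
  then have G: "bounded_op ?K (orthogonal_sum ?X) G" by (simp add: orthogonal_sum_UNIV)
  have gram: "cinner (A k x) y = cinner (G x $ k) (G y $ k)" if "x \<in> ?K" "y \<in> ?K" for k x y
    by (simp only: G_def vec_lambda_beta isometry_cinner[OF iso] S(2)[symmetric, OF that(1)]
        S'(2)[OF bounded_op_in[OF K S'(1) that(1)] that(2)])
  define M where "M = closure ((\<lambda>\<kappa>. (G \<kappa>, fst \<kappa>)) ` ?K)"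
  have "bounded_op ?K UNIV (\<lambda>\<kappa>. (G \<kappa>, fst \<kappa>))"
    using bounded_op_Pair[OF K \<open>bounded_op ?K UNIV G\<close> bounded_op_fst] by simp
  then have M: "closed_csubspace M"
    unfolding M_def by (rule closed_csubspace_closure_image[OF K])
  define U where "U = flipped_reflection M"
  have sa: "selfadjoint (orthogonal_sum ?X \<times> UNIV) U"
    using selfadjoint_flipped_reflection[OF M] by (simp add: U_def orthogonal_sum_UNIV)
  have col: "agler_unitary_colligation ?X U"
    unfolding agler_unitary_colligation_def
    using selfadjoint_involution_unitary[OF sa] flipped_reflection_involution[OF M]
    by (simp add: U_def closed_csubspace_UNIV)
  have A_op: "\<forall>k. bounded_op ?K ?K (A k)"
    using A by (auto simp: positive_semidefinite_def selfadjoint_def)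
  have U_eq: "U (x, e) = (x - 2 *\<^sub>R fst (orthogonal_projection M (x, - e)),
      e + 2 *\<^sub>R snd (orthogonal_projection M (x, - e)))" for x e
    by (simp add: U_def flipped_reflection_def flip_sign_def prod_eq_iff)
  have minus_space: "(x' - x, e - y) \<in> closure ((\<lambda>\<kappa>. (G \<kappa>, fst \<kappa>)) ` ?K)"
    if "U (x, e) = (x', y)" for x e x' y
  proof -
    have "(x' - x, e - y) = (- 2) *\<^sub>R orthogonal_projection M (x, - e)"
      using that unfolding U_eq by (auto simp: prod_eq_iff)
    also have "\<dots> \<in> M"
      by (intro csubspace_scaleR[OF M] orthogonal_projection_in[OF M])
    finally show ?thesis by (simp only: M_def)
  qed
  have plus_space: "cinner (x' + x) (G \<kappa>) = cinner (e + y) (fst \<kappa>)"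
    if "U (x, e) = (x', y)" "\<kappa> \<in> ?K" for x e x' y \<kappa>
  proof -
    let ?m = "orthogonal_projection M (x, - e)"
    have "(G \<kappa>, fst \<kappa>) \<in> M"
      unfolding M_def by (intro subsetD[OF closure_subset] imageI that(2))
    then have "cinner ((x, - e) - ?m) (G \<kappa>, fst \<kappa>) = 0"
      by (rule orthogonal_projection_orthogonal[OF M])
    then have "cinner (2 *\<^sub>R (x - fst ?m)) (G \<kappa>) = cinner (2 *\<^sub>R (e + snd ?m)) (fst \<kappa>)"
      unfolding scaleR_conv_scaleC
      by (simp add: cinner_prod_def cinner_scaleC_left cinner_diff_left cinner_add_left algebra_simps)
    moreover have "x' + x = 2 *\<^sub>R (x - fst ?m)" "e + y = 2 *\<^sub>R (e + snd ?m)"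
      using that(1) unfolding U_eq by (auto simp: scaleR_2 algebra_simps)
    ultimately show ?thesis by (simp only:)
  qed
  show ?thesis
  proof (rule that[OF col sa])
    fix w :: "complex ^ 'n" assume w: "w \<in> polydisc"
    note core = transfer_function_eq_double_cayley[OF H A_op G gram col minus_space plus_space rep w]
    show "double_cayley f w = transfer_function ?X U w"
      by (rule core(1))
    show "bij (\<lambda>u. blinfun_apply (f (cayley_point w)) u + u)"
      by (rule core(2))
  qed
qed

text \<open>
  With \<open>F = f (cayley_point w)\<close>, the double Cayley transform minus \<open>1\<close> is \<open>- 2 (F + 1)\<^sup>-\<^sup>1\<close>, whose
  inverse \<open>- (F + 1) / 2\<close> is bounded.
\<close>

lemma spectrum_double_cayley:
  fixes f :: "complex ^ 'n \<Rightarrow> 'u::complex_hilbert_space \<Rightarrow>\<^sub>L 'u"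
  assumes F: "bounded_op UNIV UNIV (blinfun_apply (f (cayley_point w)))"
    and T: "bounded_op UNIV UNIV T" and eq: "T = double_cayley f w"
    and bij: "bij (\<lambda>u. blinfun_apply (f (cayley_point w)) u + u)"
  shows "1 \<notin> spectrum T"
proof -
  let ?F = "blinfun_apply (f (cayley_point w))"
  note U = closed_csubspace_UNIV
  have T_plus: "T (?F u + u) = ?F u - u" for u
    unfolding eq double_cayley_def Let_def cayley_point_def[symmetric] o_def
    using inv_f_f[OF bij_is_inj[OF bij]] by simp
  have S: "bounded_op UNIV UNIV (\<lambda>x. T x - 1 *\<^sub>C x)"
    using bounded_op_minus_op[OF U U T bounded_op_ident] by simp
  have S_plus: "T (?F u + u) - 1 *\<^sub>C (?F u + u) = - (2 *\<^sub>R u)" for u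
    by (simp add: T_plus scaleR_2)
  obtain M where M: "0 < M" "\<And>u. u \<in> UNIV \<Longrightarrow> norm (?F u) \<le> M * norm u"
    by (rule bounded_op_bound[OF U F]) blast
  have "boundedly_invertible UNIV (\<lambda>x. T x - 1 *\<^sub>C x)"
  proof (rule boundedly_invertibleI[OF U S])
    fix y :: 'u
    have "T (?F ((-1/2) *\<^sub>R y) + (-1/2) *\<^sub>R y) - 1 *\<^sub>C (?F ((-1/2) *\<^sub>R y) + (-1/2) *\<^sub>R y) = y"
      by (simp only: S_plus) simp
    then show "\<exists>x\<in>UNIV. T x - 1 *\<^sub>C x = y" by (rule bexI[OF _ UNIV_I])
  next
    fix x :: 'u
    obtain u where u: "x = ?F u + u" using surjD[OF bij_is_surj[OF bij], of x] by blast
    have "norm x \<le> norm (?F u) + norm u" unfolding u by (rule norm_triangle_ineq)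
    also have "\<dots> \<le> M * norm u + norm u" using M(2)[of u] by simp
    also have "\<dots> = (M + 1) / 2 * norm (- (2 *\<^sub>R u))" by (simp add: algebra_simps)
    also have "- (2 *\<^sub>R u) = T x - 1 *\<^sub>C x" unfolding u by (rule S_plus[symmetric])
    finally show "norm x \<le> (M + 1) / 2 * norm (T x - 1 *\<^sub>C x)" .
  qed
  then show ?thesis by (simp add: spectrum_def)
qed

section \<open>From selfadjoint colligations to Bessmertnyi functions\<close>

lemma closed_csubspace_kernel:
  assumes K: "closed_csubspace K" and T: "bounded_op K UNIV T"
  shows "closed_csubspace {x \<in> K. T x = 0}"
proof -
  obtain M where M: "0 < M" "\<And>x. x \<in> K \<Longrightarrow> norm (T x) \<le> M * norm x"
    by (rule bounded_op_bound[OF K T]) blast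
  have "closed {x \<in> K. T x = 0}"
    unfolding closed_sequential_limits
  proof (intro allI impI)
    fix f l assume f: "(\<forall>n. f n \<in> {x \<in> K. T x = 0}) \<and> f \<longlonglongrightarrow> l"
    then have lim: "f \<longlonglongrightarrow> l" and f_mem: "f n \<in> K" and f_zero: "T (f n) = 0" for n by auto
    have l: "l \<in> K" by (rule closed_sequentially[OF csubspace_closed[OF K] f_mem lim])
    have "(\<lambda>n. M * norm (l - f n)) \<longlonglongrightarrow> M * norm (l - l)"
      by (intro tendsto_intros lim)
    moreover have "norm (T l) \<le> M * norm (l - f n)" for n
      using M(2)[OF csubspace_diff[OF K l f_mem[of n]]] bounded_op_diff[OF K T l f_mem[of n]]
      by (simp add: f_zero)
    ultimately have "norm (T l) \<le> M * norm (l - l)"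
      by (intro LIMSEQ_le_const) auto
    with l show "l \<in> {x \<in> K. T x = 0}" by simp
  qed
  then show ?thesis
    unfolding closed_csubspace_def
    by (auto simp: csubspace_zero[OF K] bounded_op_zero[OF K T] csubspace_add[OF K]
        csubspace_scaleC[OF K] bounded_op_add[OF K T] bounded_op_scaleC[OF K T])
qed

lemma closed_csubspace_isometry_image:
  assumes H: "closed_csubspace H" and T: "isometry T"
  shows "closed_csubspace (T ` H)"
proof -
  have add: "T (x + y) = T x + T y" and scale: "T (c *\<^sub>C x) = c *\<^sub>C T x" for c x y
    using T by (auto simp: isometry_def)
  have "subspace H"
    by (simp add: subspace_def csubspace_zero[OF H] csubspace_add[OF H] csubspace_scaleR[OF H])
  then have "complete (T ` H)"
    by (intro complete_isometric_image[of 1] bounded_op_imp_bounded_linear isometry_bounded_op T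
        csubspace_complete H) (auto simp: isometry_norm[OF T])
  then have "closed (T ` H)" by (rule complete_imp_closed)
  moreover have "T 0 = 0" by (rule bounded_op_zero[OF closed_csubspace_UNIV isometry_bounded_op[OF T]])
  ultimately show ?thesis
    unfolding closed_csubspace_def
    by (auto simp: add[symmetric] scale[symmetric] csubspace_add[OF H] csubspace_scaleC[OF H]
        intro!: imageI image_eqI[of 0 T 0] csubspace_zero[OF H])
qed

lemma bounded_op_isometry_inverse:
  assumes T: "isometry T"
  shows "bounded_op (T ` H) H (inv T)"
proof -
  note inv = inv_f_f[OF isometry_inj[OF T]]
  have add: "T x + T y = T (x + y)" and scale: "c *\<^sub>C T x = T (c *\<^sub>C x)" for c x y
    using T by (auto simp: isometry_def)
  show ?thesis
    by (rule bounded_opI[where M = 1]) (auto simp: inv add scale isometry_norm[OF T])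
qed

lemma bounded_op_mono:
  "bounded_op K L T \<Longrightarrow> L \<subseteq> L' \<Longrightarrow> bounded_op K L' T"
  by (auto simp: bounded_op_def)

text \<open>
  A rotation brings all coordinates of a point of \<open>Omega\<close> into the right half-plane;
  \<open>\<delta>\<close> is the least of their real parts.
\<close>

lemma diag_scale_coercive:
  assumes "z \<in> Omega"
  obtains c \<delta> where "0 < \<delta>"
    "\<And>x :: 'v::complex_hilbert_space ^ 'n. \<delta> * (norm x)\<^sup>2 \<le> Re (c * cinner (diag_scale z x) x)"
proof -
  obtain \<tau> where \<tau>: "cmod \<tau> = 1" "\<And>k. z $ k \<in> (\<lambda>\<zeta>. \<tau> * \<zeta>) ` right_halfplane"
    using assms by (auto simp: Omega_def)
  have rotated: "0 < Re (cnj \<tau> * z $ k)" for k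
  proof -
    obtain \<zeta> where "z $ k = \<tau> * \<zeta>" "0 < Re \<zeta>"
      using \<tau>(2)[of k] by (auto simp: right_halfplane_def)
    moreover have "cnj \<tau> * \<tau> = 1"
      using complex_norm_square[of \<tau>] \<tau>(1) by (simp add: mult.commute)
    ultimately show ?thesis by (simp flip: mult.assoc)
  qed
  define \<delta> where "\<delta> = Min (range (\<lambda>k. Re (cnj \<tau> * z $ k)))"
  have "\<delta> \<in> range (\<lambda>k. Re (cnj \<tau> * z $ k))" unfolding \<delta>_def by (rule Min_in) auto
  then have "0 < \<delta>" using rotated by auto
  have \<delta>: "\<delta> \<le> Re (cnj \<tau> * z $ k)" for k by (simp add: \<delta>_def)
  show ?thesis
  proof (rule that[OF \<open>0 < \<delta>\<close>])
    fix x :: "'v ^ 'n"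
    have "(norm x)\<^sup>2 = (\<Sum>k\<in>UNIV. (norm (x $ k))\<^sup>2)"
      by (simp add: norm_vec_def L2_set_def sum_nonneg)
    then have "\<delta> * (norm x)\<^sup>2 = (\<Sum>k\<in>UNIV. \<delta> * (norm (x $ k))\<^sup>2)"
      by (simp only: sum_distrib_left)
    also have "\<dots> \<le> (\<Sum>k\<in>UNIV. Re (cnj \<tau> * z $ k) * (norm (x $ k))\<^sup>2)"
      by (intro sum_mono mult_right_mono \<delta>) simp
    also have "\<dots> = Re (\<Sum>k\<in>UNIV. (cnj \<tau> * z $ k) * complex_of_real ((norm (x $ k))\<^sup>2))"
      unfolding Re_sum by (rule sum.cong[OF refl]) (simp only: Re_complex_of_real Im_complex_of_real times_complex.sel mult_zero_right diff_zero)
    also have "\<dots> = Re (cnj \<tau> * cinner (diag_scale z x) x)"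
      by (simp only: cinner_vec_def diag_scale_def vec_lambda_beta cinner_scaleC_left cinner_self
          sum_distrib_left mult.assoc)
    finally show "\<delta> * (norm x)\<^sup>2 \<le> Re (cnj \<tau> * cinner (diag_scale z x) x)" .
  qed
qed

lemma transfer_function_at_zero:
  assumes "closed_csubspace (orthogonal_sum X)"
    and "bounded_op (orthogonal_sum X \<times> UNIV) (orthogonal_sum X \<times> UNIV) U"
  shows "transfer_function X U 0 u = snd (U (0, u))"
proof -
  have K: "closed_csubspace (orthogonal_sum X \<times> UNIV)"
    by (intro closed_csubspace_Times assms(1) closed_csubspace_UNIV)
  have "U (0, 0) = 0"
    using bounded_op_zero[OF K assms(2)] by (simp add: zero_prod_def)
  then show ?thesis by (simp add: transfer_function_def Let_def)
qed

text \<open>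
  The involution \<open>U\<close> determines the closed subspace \<open>M\<close> of all
  \<open>(p, u)\<close> with \<open>U (p, - u) = (- p, u)\<close>. It contains \<open>(B a, a - D a)\<close> for every \<open>a\<close>, so the
  invertibility of \<open>1 - D\<close>, where \<open>D\<close> is the value of the transfer function at \<open>0\<close>, makes \<open>M\<close> the range
  of \<open>\<kappa> \<mapsto> (G \<kappa>, fst \<kappa>)\<close> with \<open>G (u, p) = B (1 - D)\<^sup>-\<^sup>1 u + p\<close>, where \<open>p\<close> runs over
  the space \<open>H\<close> of all \<open>p\<close> with \<open>(p, 0) \<in> M\<close>. The Gram operators \<open>A k\<close> of the
  components of \<open>G\<close> represent the function. The state block of \<open>A z\<close> is
  the compression of \<open>diag_scale z\<close> to \<open>H\<close>, hence coercive. An isometry \<open>\<iota>\<close> serves to place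
  \<open>H\<close> in the ambient space of the auxiliary spaces.
\<close>

lemma selfadjoint_colligation_imp_bessmertnyi:
  fixes X :: "'n::finite \<Rightarrow> 'x::complex_hilbert_space set"
    and U :: "('x ^ 'n) \<times> 'u::complex_hilbert_space \<Rightarrow> ('x ^ 'n) \<times> 'u"
    and \<iota> :: "'x ^ 'n \<Rightarrow> 'v::complex_hilbert_space"
  assumes col: "agler_unitary_colligation X U"
    and sa: "selfadjoint (orthogonal_sum X \<times> UNIV) U"
    and spec: "1 \<notin> spectrum (transfer_function X U 0)"
    and iso: "isometry \<iota>"
  obtains f :: "complex ^ 'n \<Rightarrow> 'u \<Rightarrow>\<^sub>L 'u" where "f \<in> bessmertnyi TYPE('v)"
    "\<And>w. w \<in> polydisc \<Longrightarrow> double_cayley f w = transfer_function X U w"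
proof -
  let ?X = "orthogonal_sum X" and ?XU = "orthogonal_sum X \<times> UNIV :: (('x ^ 'n) \<times> 'u) set"
  note UU = closed_csubspace_UNIV
  have sub: "\<forall>k. closed_csubspace (X k)" and unit: "unitary ?XU U"
    using col by (auto simp: agler_unitary_colligation_def)
  note X = closed_csubspace_orthogonal_sum[OF sub]
  note XU = closed_csubspace_Times[OF X UU]
  note U = selfadjointD[OF sa]
  note invol = selfadjoint_unitary_involution[OF XU sa unit]
  have mem: "(p, u) \<in> ?XU" if "p \<in> ?X" for p and u :: 'u using that by simp
  note mem0 = mem[OF csubspace_zero[OF X]]
  note U_in = bounded_op_in[OF XU U(1)]
  have U_fst_in: "fst (U (p, u)) \<in> ?X" if "p \<in> ?X" for p u
    using U_in[OF mem[OF that]] by (simp add: mem_Times_iff)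
  have proj_in: "component_proj k x \<in> ?X" if "x \<in> ?X" for k x
    using that sub by (auto simp: orthogonal_sum_def component_proj_def csubspace_zero)
  have emb_x: "bounded_op ?X ?XU (\<lambda>x. (x, 0))" and emb_u: "bounded_op UNIV ?XU (\<lambda>u. (0, u))"
    by (intro bounded_op_Pair X UU bounded_op_ident bounded_op_const_zero)+

  (* The value D at 0 is a selfadjoint operator, and so is T = (D - 1)^-1. *)
  define D where "D u = snd (U (0, u))" for u
  have D_op: "bounded_op UNIV UNIV D"
    unfolding D_def[abs_def]
    by (intro bounded_op_compose[OF UU XU _ bounded_op_snd] bounded_op_compose[OF UU XU emb_u U(1)])
  have D_sym: "cinner (D u) v = cinner u (D v)" for u v
    using U(2)[OF mem0 mem0, of u v] by (simp add: cinner_prod_def D_def)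
  have "transfer_function X U 0 = D"
    by (rule ext) (simp add: transfer_function_at_zero[OF X U(1)] D_def)
  then have D_inv: "boundedly_invertible UNIV (\<lambda>u. D u - u)"
    using spec by (simp add: spectrum_def)
  define T where "T = inv_into UNIV (\<lambda>u. D u - u)"
  have T_op: "bounded_op UNIV UNIV T" and T: "D (T u) - T u = u" for u
    using boundedly_invertibleD(2)[OF D_inv] boundedly_invertibleD(3)[OF D_inv, of u]
    by (simp_all add: T_def)
  have T_sym: "cinner (T u) v = cinner u (T v)" for u v
  proof -
    have "cinner (T u) v = cinner (T u) (D (T v) - T v)" by (simp only: T)
    also have "\<dots> = cinner (D (T u) - T u) (T v)"
      by (simp add: cinner_diff_left cinner_diff_right D_sym)
    finally show ?thesis by (simp only: T)
  qed

  define H where "H = {p \<in> ?X. U (p, 0) + (p, 0) = 0}"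
  have "bounded_op ?X UNIV (\<lambda>p. U (p, 0) + (p, 0))"
    using bounded_op_mono[OF bounded_op_lincomb[OF X XU bounded_op_compose[OF X XU emb_x U(1)] emb_x,
          of 1 1] subset_UNIV] by simp
  then have H: "closed_csubspace H"
    unfolding H_def by (rule closed_csubspace_kernel[OF X])
  have H_X: "H \<subseteq> ?X" by (auto simp: H_def)
  have U_H: "U (p, 0) = (- p, 0)" if "p \<in> H" for p
    using that by (auto simp: H_def eq_neg_iff_add_eq_0 prod_eq_iff)
  let ?H = "\<iota> ` H"
  let ?K = "UNIV \<times> ?H :: ('u \<times> 'v) set"
  note H' = closed_csubspace_isometry_image[OF H iso]
  note K = closed_csubspace_Times[OF UU H']
  have inv_\<iota>: "inv \<iota> (\<iota> p) = p" for p
    by (rule inv_f_f[OF isometry_inj[OF iso]])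

  (* G0 = B (1 - D)^-1, where B u = fst (U (0, u)) and (1 - D)^-1 = - T. *)
  define G0 where "G0 u = - fst (U (0, T u))" for u
  define G where "G \<kappa> = G0 (fst \<kappa>) + inv \<iota> (snd \<kappa>)" for \<kappa>
  define G' where "G' x = (- T (snd (U (x, 0))), \<iota> (orthogonal_projection H x))" for x
  define A where "A k \<kappa> = G' (component_proj k (G \<kappa>))" for k \<kappa>
  have G0_op: "bounded_op UNIV ?X G0"
  proof -
    have "bounded_op UNIV ?X (\<lambda>u. fst (U (0, T u)))"
      by (intro bounded_op_compose[OF UU XU _ bounded_op_fst] bounded_op_compose[OF UU XU _ U(1)]
          bounded_op_compose[OF UU UU T_op emb_u])
    from bounded_op_minus_op[OF UU X bounded_op_const_zero[OF X] this]
    show ?thesis by (simp add: G0_def[abs_def])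
  qed
  have G_op: "bounded_op ?K ?X G"
  proof -
    have "bounded_op ?K ?X (\<lambda>\<kappa>. G0 (fst \<kappa>))"
      by (rule bounded_op_compose[OF K UU bounded_op_fst G0_op])
    moreover have "bounded_op ?K ?X (\<lambda>\<kappa>. inv \<iota> (snd \<kappa>))"
      by (rule bounded_op_compose[OF K H' bounded_op_snd
            bounded_op_mono[OF bounded_op_isometry_inverse[OF iso] H_X]])
    ultimately show ?thesis
      using bounded_op_lincomb[OF K X, of _ _ 1 1] by (simp add: G_def[abs_def])
  qed
  have G'_op: "bounded_op ?X ?K G'"
  proof -
    have "bounded_op ?X UNIV (\<lambda>x. T (snd (U (x, 0))))"
      by (intro bounded_op_compose[OF X UU _ T_op] bounded_op_compose[OF X XU _ bounded_op_snd]
          bounded_op_compose[OF X XU emb_x U(1)])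
    from bounded_op_minus_op[OF X UU bounded_op_const_zero[OF UU] this]
    have "bounded_op ?X UNIV (\<lambda>x. - T (snd (U (x, 0))))" by simp
    moreover have "bounded_op ?X ?H (\<lambda>x. \<iota> (orthogonal_projection H x))"
    proof -
      have "bounded_op ?X UNIV (\<lambda>x. \<iota> (orthogonal_projection H x))"
        using bounded_op_compose[OF UU UU selfadjointD(1)[OF selfadjoint_orthogonal_projection[OF H]]
            isometry_bounded_op[OF iso]]
        by (auto simp: bounded_op_def)
      then show ?thesis
        using orthogonal_projection_in[OF H] by (auto simp: bounded_op_def)
    qed
    ultimately show ?thesis
      unfolding G'_def[abs_def] by (rule bounded_op_Pair[OF X])
  qed
  have adjoint: "cinner (G' x) \<kappa> = cinner x (G \<kappa>)" if x: "x \<in> ?X" and \<kappa>: "\<kappa> \<in> ?K" for x \<kappa>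
  proof -
    obtain p where p: "p \<in> H" "snd \<kappa> = \<iota> p" using \<kappa> by auto
    have "cinner (snd (U (x, 0))) v = cinner x (fst (U (0, v)))" for v
      using U(2)[OF mem[OF x] mem0, of 0 v] by (simp add: cinner_prod_def)
    then show ?thesis
      by (simp add: cinner_prod_def G'_def G_def p(2) inv_\<iota> isometry_cinner[OF iso]
          orthogonal_projection_cinner[OF H p(1)] T_sym G0_def cinner_add_right cinner_diff_right)
  qed
  have gram: "cinner (A k x) y = cinner (G x $ k) (G y $ k)" if "x \<in> ?K" "y \<in> ?K" for k x y
  proof -
    have "cinner (A k x) y = cinner (component_proj k (G x)) (G y)"
      unfolding A_def by (intro adjoint proj_in bounded_op_in[OF K G_op] that)
    also have "\<dots> = (\<Sum>j\<in>UNIV. if j = k then cinner (G x $ k) (G y $ k) else 0)"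
      unfolding cinner_vec_def component_proj_def by (rule sum.cong) auto
    finally show ?thesis by simp
  qed
  have proj_op: "bounded_op ?X ?X (component_proj k)" for k
  proof (rule bounded_opI[where M = 1])
    fix x :: "'x ^ 'n"
    have "component_proj k x = diag_scale (\<chi> j. if j = k then 1 else 0) x"
      by (simp add: vec_eq_iff component_proj_def diag_scale_def)
    then show "norm (component_proj k x) \<le> 1 * norm x"
      using norm_diag_scale_le[of "\<chi> j. if j = k then 1 else 0" 1 x] by simp
  qed (auto simp: proj_in, auto simp: vec_eq_iff component_proj_def scaleC_vec_def)
  have A_op: "\<forall>k. bounded_op ?K ?K (A k)"
    unfolding A_def[abs_def]
    by (intro allI bounded_op_compose[OF K X _ G'_op] bounded_op_compose[OF K X G_op proj_op])
  have A_psd: "\<forall>k. positive_semidefinite ?K (A k)"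
  proof
    fix k
    have "cinner (A k x) y = cinner x (A k y)" if "x \<in> ?K" "y \<in> ?K" for x y
    proof -
      have "cinner x (A k y) = cnj (cinner (A k y) x)" by (rule cinner_commute)
      also have "\<dots> = cnj (cinner (G y $ k) (G x $ k))" by (simp only: gram[OF that(2,1)])
      also have "\<dots> = cinner (G x $ k) (G y $ k)" by (rule cinner_commute[symmetric])
      finally show ?thesis by (simp only: gram[OF that])
    qed
    moreover have "0 \<le> Re (cinner (A k x) x)" if "x \<in> ?K" for x
      by (simp only: gram[OF that that] cinner_self Re_complex_of_real zero_le_power2)
    ultimately show "positive_semidefinite ?K (A k)"
      using A_op unfolding positive_semidefinite_def selfadjoint_def by blast
  qed

  have state_inv: "boundedly_invertible ?H (state_block A z)" if z: "z \<in> Omega" for z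
  proof -
    obtain c \<delta> where \<delta>: "0 < \<delta>"
      "\<And>x :: 'x ^ 'n. \<delta> * (norm x)\<^sup>2 \<le> Re (c * cinner (diag_scale z x) x)"
      by (rule diag_scale_coercive[OF z]) blast
    show ?thesis
    proof (rule coercive_boundedly_invertible[OF H' state_block_bounded_op[OF H' A_op] \<delta>(1)])
      fix h assume h: "h \<in> ?H"
      then have 0: "(0, h) \<in> ?K" by simp
      obtain p where p: "h = \<iota> p" using h by blast
      have G_state: "G (0, \<iota> p) = p"
        by (simp add: G_def inv_\<iota> bounded_op_zero[OF UU G0_op])
      have "cinner (state_block A z h) h = cinner (pencil A z (0, h)) (0, h)"
        by (simp add: state_block_def cinner_prod_def)
      also have "\<dots> = cinner (diag_scale z (G (0, h))) (G (0, h))"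
        by (simp only: pencil_def cinner_sum_left cinner_scaleC_left gram[OF 0 0] cinner_vec_def
            diag_scale_def vec_lambda_beta)
      finally show "\<delta> * (norm h)\<^sup>2 \<le> Re (c * cinner (state_block A z h) h)"
        using \<delta>(2)[of p] by (simp only: G_state p isometry_norm[OF iso])
    qed
  qed
  define f where "f z = Blinfun (schur_complement ?H A z)" for z
  have f: "blinfun_apply (f z) u = schur_complement ?H A z u" if z: "z \<in> Omega" for z u
  proof -
    have "bounded_op UNIV UNIV (schur_complement ?H A z)"
      unfolding schur_complement_def[abs_def]
      by (intro bounded_op_compose[OF UU K _ schur_row_bounded_op[OF H' A_op state_inv[OF z]]]
          bounded_op_compose[OF UU K bounded_op_input_embed[OF H'] pencil_bounded_op[OF H' A_op]])
    then show ?thesis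
      unfolding f_def by (simp add: bounded_linear_Blinfun_apply bounded_op_imp_bounded_linear)
  qed
  have rep: "\<forall>z\<in>Omega. boundedly_invertible ?H (state_block A z) \<and>
      (\<forall>u. blinfun_apply (f z) u = schur_complement ?H A z u)"
    using state_inv f by blast
  have f_in: "f \<in> bessmertnyi TYPE('v)"
    unfolding bessmertnyi_iff
    using schur_complement_holomorphic[OF H' A_op rep] H' A_psd rep by blast

  have U_G0: "U (G0 u, - u) = (- G0 u, u)" for u
  proof -
    have eq: "(G0 u, - u) = (0, T u) - U (0, T u)"
      using T[of u] by (simp add: prod_eq_iff G0_def D_def algebra_simps)
    have "U (G0 u, - u) = U (0, T u) - U (U (0, T u))"
      unfolding eq by (rule bounded_op_diff[OF XU U(1) mem0 U_in[OF mem0]])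
    also have "\<dots> = - ((0, T u) - U (0, T u))" by (simp only: invol[OF mem0] minus_diff_eq)
    also have "\<dots> = (- G0 u, u)" unfolding eq[symmetric] by simp
    finally show ?thesis .
  qed
  have G0_in: "(G0 u, v) \<in> ?XU" for u v
    by (rule mem[OF bounded_op_in[OF UU G0_op UNIV_I]])
  have minus_space: "(x' - x, e - y) \<in> closure ((\<lambda>\<kappa>. (G \<kappa>, fst \<kappa>)) ` ?K)"
    if x: "x \<in> ?X" and Ux: "U (x, e) = (x', y)" for x e x' y
  proof -
    let ?u = "e - y" and ?p = "x' - x"
    have x': "x' \<in> ?X" using U_fst_in[OF x, of e] Ux by simp
    have p: "?p \<in> ?X" by (rule csubspace_diff[OF X x' x])
    have "U (x', y) = (x, e)" using invol[OF mem[OF x, of e]] by (simp only: Ux)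
    then have Up: "U (?p, - ?u) = (- ?p, ?u)"
      using bounded_op_diff[OF XU U(1) mem[OF x', of y] mem[OF x, of e]] by (simp add: Ux)
    have "U (?p - G0 ?u, 0) = (- (?p - G0 ?u), 0)"
      using bounded_op_diff[OF XU U(1) mem[OF p, of "- ?u"] G0_in[of ?u "- ?u"]]
      unfolding Up U_G0 by (simp add: algebra_simps)
    then have "?p - G0 ?u \<in> H"
      using csubspace_diff[OF X p bounded_op_in[OF UU G0_op UNIV_I]]
      by (simp add: H_def zero_prod_def)
    then have "(?u, \<iota> (?p - G0 ?u)) \<in> ?K" by simp
    moreover have "G (?u, \<iota> (?p - G0 ?u)) = ?p" by (simp add: G_def inv_\<iota>)
    ultimately have "(?p, ?u) \<in> (\<lambda>\<kappa>. (G \<kappa>, fst \<kappa>)) ` ?K"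
      by (intro image_eqI[of _ _ "(?u, \<iota> (?p - G0 ?u))"]) simp_all
    then show ?thesis by (rule subsetD[OF closure_subset])
  qed
  have plus_space: "cinner (x' + x) (G \<kappa>) = cinner (e + y) (fst \<kappa>)"
    if x: "x \<in> ?X" and Ux: "U (x, e) = (x', y)" and \<kappa>: "\<kappa> \<in> ?K" for x e x' y \<kappa>
  proof -
    let ?s = "(x', y) + (x, e)" and ?t = "(G \<kappa>, - fst \<kappa>)"
    have x': "x' \<in> ?X" using U_fst_in[OF x, of e] Ux by simp
    have s: "?s \<in> ?XU" by (rule csubspace_add[OF XU mem[OF x'] mem[OF x]])
    have t: "?t \<in> ?XU" by (rule mem[OF bounded_op_in[OF K G_op \<kappa>]])
    have "U (x', y) = (x, e)" using invol[OF mem[OF x, of e]] by (simp only: Ux)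
    then have Us: "U ?s = ?s"
      using bounded_op_add[OF XU U(1) mem[OF x', of y] mem[OF x, of e]]
      by (simp add: Ux add.commute)
    obtain p where p: "p \<in> H" "snd \<kappa> = \<iota> p" using \<kappa> by auto
    have "?t = (G0 (fst \<kappa>), - fst \<kappa>) + (p, 0)" by (simp add: G_def p(2) inv_\<iota>)
    then have "U ?t = (- G0 (fst \<kappa>), fst \<kappa>) + (- p, 0)"
      using bounded_op_add[OF XU U(1) G0_in[of "fst \<kappa>" "- fst \<kappa>"] mem[OF subsetD[OF H_X p(1)], of 0]]
      by (simp only: U_G0 U_H[OF p(1)])
    also have "\<dots> = - ?t" by (simp add: G_def p(2) inv_\<iota>)
    finally have Ut: "U ?t = - ?t" .
    have "cinner ?s ?t = - cinner ?s ?t"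
      using U(2)[OF s t] unfolding Us Ut cinner_minus_right .
    then have "cinner ?s ?t = 0" by simp
    then show ?thesis by (simp add: cinner_prod_def add.commute)
  qed
  show ?thesis
  proof (rule that[OF f_in])
    fix w :: "complex ^ 'n" assume w: "w \<in> polydisc"
    show "double_cayley f w = transfer_function X U w"
      by (rule transfer_function_eq_double_cayley(1)[OF H' A_op G_op gram col minus_space plus_space
            rep w])
  qed
qed

theorem theorem4p2:
  fixes \<F> :: "complex ^ 'n \<Rightarrow> 'u::complex_hilbert_space \<Rightarrow>\<^sub>L 'u"
  assumes "\<F> holomorphic_op_on polydisc"
  shows
    "(\<exists>f \<in> bessmertnyi TYPE(('u, 'h::complex_hilbert_space) hilbert_universe).
        \<forall>w\<in>polydisc. blinfun_apply (\<F> w) = double_cayley f w)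
     \<longleftrightarrow>
     (\<exists>(X :: 'n \<Rightarrow> ('u, 'h) hilbert_universe set) U.
        agler_unitary_colligation X U \<and>
        selfadjoint (orthogonal_sum X \<times> UNIV) U \<and>
        (\<forall>w\<in>polydisc. blinfun_apply (\<F> w) = transfer_function X U w)) \<and>
     1 \<notin> spectrum (blinfun_apply (\<F> 0))"
  (is "?bessmertnyi \<longleftrightarrow> ?colligation \<and> ?regular")
proof
  have zero: "0 \<in> (polydisc :: (complex ^ 'n) set)" by (simp add: polydisc_def)
  assume ?bessmertnyi
  then obtain f where f: "f \<in> bessmertnyi TYPE(('u, 'h) hilbert_universe)"
    and \<F>: "\<forall>w\<in>polydisc. blinfun_apply (\<F> w) = double_cayley f w" by blast
  obtain H A where rep: "closed_csubspace (H :: ('u, 'h) hilbert_universe set)"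
    "\<forall>k. positive_semidefinite (UNIV \<times> H) (A k)"
    "\<forall>z\<in>Omega. boundedly_invertible H (state_block A z) \<and>
      (\<forall>u. blinfun_apply (f z) u = schur_complement H A z u)"
    using f unfolding bessmertnyi_iff by blast
  obtain T :: "'u \<times> ('u, 'h) hilbert_universe \<Rightarrow> ('u, 'h) hilbert_universe" where "isometry T"
    by (rule isometry_of_sum)
  then obtain U where U: "agler_unitary_colligation (\<lambda>_ :: 'n. UNIV :: ('u, 'h) hilbert_universe set) U"
    "selfadjoint (orthogonal_sum (\<lambda>_ :: 'n. UNIV :: ('u, 'h) hilbert_universe set) \<times> UNIV) U"
    "\<And>w. w \<in> polydisc \<Longrightarrow> double_cayley f w = transfer_function (\<lambda>_. UNIV) U w"
    "\<And>w. w \<in> polydisc \<Longrightarrow> bij (\<lambda>u. blinfun_apply (f (cayley_point w)) u + u)"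
    using bessmertnyi_imp_selfadjoint_colligation[OF rep] by blast
  then have ?colligation using \<F> by (intro exI[of _ "\<lambda>_. UNIV"] exI[of _ U]) simp
  moreover have ?regular
  proof (rule spectrum_double_cayley[of f 0])
    show "bounded_op UNIV UNIV (blinfun_apply (f (cayley_point 0)))"
      using f cayley_point_Omega[OF zero] by (simp add: bessmertnyi_def holomorphic_op_on_def)
    show "bounded_op UNIV UNIV (blinfun_apply (\<F> 0))"
      using assms zero by (simp add: holomorphic_op_on_def)
  qed (use \<F> zero U(4) in auto)
  ultimately show "?colligation \<and> ?regular" ..
next
  have zero: "0 \<in> (polydisc :: (complex ^ 'n) set)" by (simp add: polydisc_def)
  assume "?colligation \<and> ?regular"
  then obtain X U where col: "agler_unitary_colligation (X :: 'n \<Rightarrow> ('u, 'h) hilbert_universe set) U"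
    "selfadjoint (orthogonal_sum X \<times> UNIV) U"
    and \<F>: "\<forall>w\<in>polydisc. blinfun_apply (\<F> w) = transfer_function X U w"
    and "1 \<notin> spectrum (blinfun_apply (\<F> 0))" by blast
  then have spec: "1 \<notin> spectrum (transfer_function X U 0)" using zero by simp
  obtain \<iota> :: "('u, 'h) hilbert_universe ^ 'n \<Rightarrow> ('u, 'h) hilbert_universe" where "isometry \<iota>"
    by (rule isometry_of_power)
  then obtain f where "f \<in> bessmertnyi TYPE(('u, 'h) hilbert_universe)"
    "\<And>w. w \<in> polydisc \<Longrightarrow> double_cayley f w = transfer_function X U w"
    using selfadjoint_colligation_imp_bessmertnyi[OF col spec] by blast
  with \<F> show ?bessmertnyi by (intro bexI[of _ f]) simp_all
qed

end
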